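(* Let $k$ be an algebraically closed field, $\Lambda=k[[T]]$, and let $\Gamma,\widetilde\Gamma$ be LR-tableaux of the same type $(\alpha,\beta,\gamma)$ such that $\widetilde\Gamma$ is obtained from $\Gamma$ by an increasing box move. Then $\Gamma\prec_{\sf boundary}\widetilde\Gamma$, i.e. $\Gamma\neq\widetilde\Gamma$ and $\mathbb V_{\widetilde\Gamma}\cap\overline{\mathbb V}_{\Gamma}\neq\emptyset$.
   Context: Put $p=T\in\Lambda=k[[T]]$. All modules are finite length $\Lambda$-modules. For a partition $\beta=(\beta_1\ge\dots\ge\beta_s\ge1)$ put $N_\beta=\bigoplus_i\Lambda/(p^{\beta_i})$; a module isomorphic to $N_\beta$ has type $\beta$. $\beta'$ denotes the transpose partition. Tableaux. The Young diagram of $\beta$ is drawn with columns of lengths $\beta_1,\beta_2,\dots$ from left to right, aligned at the top; rows are numbered from the top, so row $i$ has $(\beta')_i$ boxes. A tableau is a sequence $\Gamma=[\gamma^{(0)}\subset\gamma^{(1)}\subset\dots\subset\gamma^{(s)}]$ of partitions; boxes in $\gamma^{(0)}$ are empty and boxes in $\gamma^{(e)}\setminus\gamma^{(e-1)}$ carry the entry $e$ (repeating the last partition does not change the tableau). An LR-tableau of type $(\alpha,\beta,\gamma)$ (shape $\beta\setminus\gamma$, content $\alpha$) is a tableau with $\gamma^{(0)}=\gamma$, $\gamma^{(s)}=\beta$, having $(\alpha')_e$ entries $e$ for each $e\geq1$, whose entries weakly increase along rows (left to right), strictly increase down columns, and such that for every vertical column and every $e\ge1$, on the right hand side of this column there occur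 at least as many entries $e$ as entries $e+1$. The tableau of an embedding $A\subset B$ (of finite length modules) is $[\gamma^{(0)},\dots,\gamma^{(r)}]$ where $p^rA=0$ and $\gamma^{(e)}$ is the type of $B/p^eA$. The union of tableaux $[\varepsilon^{(i)}]$, $[\zeta^{(i)}]$ is $[\varepsilon^{(i)}\cup\zeta^{(i)}]$ (union of multisets of parts, where the last partition of the shorter sequence is repeated). For $1\le e\le f$, the column tableau $C(e,f)_n$ is the one-column tableau of height $n$ whose lowest $f-e+1$ boxes contain $e,e+1,\dots,f$ from top to bottom, the other boxes being empty; $C(1,0)_n$ is the empty column of height $n$. Increasing box move. Let $\Gamma,\widetilde\Gamma$ be LR-tableaux of the same shape and content. $\widetilde\Gamma$ is obtained from $\Gamma$ by an increasing box move if both are unions of column tableaux which differ in exactly two columns: $\Gamma=\Delta\cup C(e,f)_n\cup C(e',f')_{n'}$ and $\widetilde\Gamma=\Delta\cup C(e',f')_n\cup C(e,f)_{n'}$, where $\Delta$ is a union of column tableaux and $n>n'$, $1\le e\le f$, $e<e'$, $f<f'$, $f-e=f'-e'$. Varieties. $\mathbb V_{\alpha,\gamma}^\beta$ is the set of $\Lambda$-linear monomorphisms $f:N_\alpha\to N_\beta$ with cokernel isomorphic to $N_\gamma$, a subset of the affine space $\mathrm{Hom}_k(N_\alpha,N_\beta)$ with the Zariski topology. $\mathbb V_\Gamma\subset\mathbb V_{\alpha,\gamma}^\beta$ is the set of those $f$ for which the embedding $(f(N_\alpha)\subset N_\beta)$ has tableau $\Gamma$, and $\overline{\mathbb V}_\Gamma$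 is its closure. *)

theory Defs
  imports
    "HOL-Algebra.Algebraic_Closure_Type"
    "HOL-Computational_Algebra.Formal_Power_Series"
    "HOL-Analysis.Abstract_Topology"
begin

section \<open>Modules\<close>

text \<open>
  Modules over a ring record \<open>R\<close> are module records as in \<^theory>\<open>HOL-Algebra.Module\<close>.
  Such a record carries a ring structure of which a module uses only the additive part;
  in the modules built below the fields \<open>mult\<close> and \<open>one\<close> are left undefined.
\<close>

definition regular_module :: "('a, 'm) ring_scheme \<Rightarrow> ('a, 'a) module" where
  "regular_module R = \<lparr>carrier = carrier R, monoid.mult = undefined, one = undefined,
     zero = \<zero>\<^bsub>R\<^esub>, add = (\<lambda>x y. x \<oplus>\<^bsub>R\<^esub> y), module.smult = (\<lambda>r x. r \<otimes>\<^bsub>R\<^esub> x)\<rparr>"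

definition quotient_module :: "('a, 'b) module \<Rightarrow> 'b set \<Rightarrow> ('a, 'b set) module" where
  "quotient_module M U = \<lparr>carrier = a_rcosets\<^bsub>M\<^esub> U, monoid.mult = undefined, one = undefined,
     zero = U, add = set_add M, module.smult = (\<lambda>r S. \<Union>x\<in>S. U +>\<^bsub>M\<^esub> (r \<odot>\<^bsub>M\<^esub> x))\<rparr>"

definition direct_sum_module :: "nat \<Rightarrow> (nat \<Rightarrow> ('a, 'b) module) \<Rightarrow> ('a, nat \<Rightarrow> 'b) module" where
  "direct_sum_module s M = \<lparr>carrier = (\<Pi>\<^sub>E i\<in>{..<s}. carrier (M i)),
     monoid.mult = undefined, one = undefined,
     zero = (\<lambda>i\<in>{..<s}. \<zero>\<^bsub>M i\<^esub>),
     add = (\<lambda>x y. \<lambda>i\<in>{..<s}. x i \<oplus>\<^bsub>M i\<^esub> y i),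
     module.smult = (\<lambda>r x. \<lambda>i\<in>{..<s}. r \<odot>\<^bsub>M i\<^esub> x i)\<rparr>"

text \<open>Maps between modules are extensional, so that equality of functions is equality of maps.\<close>

definition module_homs ::
  "('a, 'm) ring_scheme \<Rightarrow> ('a, 'b) module \<Rightarrow> ('a, 'c) module \<Rightarrow> ('b \<Rightarrow> 'c) set" where
  "module_homs R M N = {f \<in> carrier M \<rightarrow>\<^sub>E carrier N.
     (\<forall>x\<in>carrier M. \<forall>y\<in>carrier M. f (x \<oplus>\<^bsub>M\<^esub> y) = f x \<oplus>\<^bsub>N\<^esub> f y) \<and>
     (\<forall>r\<in>carrier R. \<forall>x\<in>carrier M. f (r \<odot>\<^bsub>M\<^esub> x) = r \<odot>\<^bsub>N\<^esub> f x)}"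

definition module_isomorphic ::
  "('a, 'm) ring_scheme \<Rightarrow> ('a, 'b) module \<Rightarrow> ('a, 'c) module \<Rightarrow> bool" where
  "module_isomorphic R M N \<longleftrightarrow> (\<exists>f\<in>module_homs R M N. bij_betw f (carrier M) (carrier N))"

definition hom_module ::
  "('a, 'm) ring_scheme \<Rightarrow> ('a, 'b) module \<Rightarrow> ('a, 'c) module \<Rightarrow> ('a, 'b \<Rightarrow> 'c) module" where
  "hom_module R M N = \<lparr>carrier = module_homs R M N, monoid.mult = undefined, one = undefined,
     zero = (\<lambda>x\<in>carrier M. \<zero>\<^bsub>N\<^esub>),
     add = (\<lambda>f g. \<lambda>x\<in>carrier M. f x \<oplus>\<^bsub>N\<^esub> g x),
     module.smult = (\<lambda>r f. \<lambda>x\<in>carrier M. r \<odot>\<^bsub>N\<^esub> f x)\<rparr>"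

definition restrict_scalars :: "('c \<Rightarrow> 'a) \<Rightarrow> ('a, 'b) module \<Rightarrow> ('c, 'b) module" where
  "restrict_scalars h M = \<lparr>carrier = carrier M, monoid.mult = undefined, one = undefined,
     zero = \<zero>\<^bsub>M\<^esub>, add = (\<lambda>x y. x \<oplus>\<^bsub>M\<^esub> y), module.smult = (\<lambda>c x. h c \<odot>\<^bsub>M\<^esub> x)\<rparr>"


section \<open>Partitions and tableaux\<close>

definition partition :: "nat list \<Rightarrow> bool" where
  "partition b \<longleftrightarrow> sorted_wrt (\<ge>) b \<and> 0 \<notin> set b"

definition conjugate_part :: "nat list \<Rightarrow> nat \<Rightarrow> nat" where
  "conjugate_part b i = card {c. c < length b \<and> i \<le> b ! c}"

text \<open>
  The parts are the columns of the diagram.  The pair \<open>(r, c)\<close> is the box in row \<open>r\<close> and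
  column \<open>c\<close>, both counted from \<open>0\<close>.
\<close>

definition young_diagram :: "nat list \<Rightarrow> (nat \<times> nat) set" where
  "young_diagram b = {(r, c). c < length b \<and> r < b ! c}"

definition partition_union :: "nat list \<Rightarrow> nat list \<Rightarrow> nat list" where
  "partition_union a b = rev (sort (a @ b))"

text \<open>
  A tableau is encoded as the infinite sequence obtained by repeating its last partition for ever.
  Two finite sequences that differ in repetitions of the last partition become equal.
\<close>

type_synonym tableau = "nat \<Rightarrow> nat list"

definition is_tableau :: "tableau \<Rightarrow> bool" where
  "is_tableau \<Gamma> \<longleftrightarrow> (\<forall>i. partition (\<Gamma> i)) \<and>
     (\<forall>i. young_diagram (\<Gamma> i) \<subseteq> young_diagram (\<Gamma> (Suc i))) \<and>
     (\<exists>s. \<forall>i\<ge>s. \<Gamma> i = \<Gamma> s)"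

text \<open>The boxes with entry \<open>e \<ge> 1\<close>; for \<open>e = 0\<close> this set is empty.\<close>

definition entry_boxes :: "tableau \<Rightarrow> nat \<Rightarrow> (nat \<times> nat) set" where
  "entry_boxes \<Gamma> e = young_diagram (\<Gamma> e) - young_diagram (\<Gamma> (e - 1))"

definition LR_tableau :: "nat list \<Rightarrow> nat list \<Rightarrow> nat list \<Rightarrow> tableau \<Rightarrow> bool" where
  "LR_tableau \<alpha> \<beta> \<gamma> \<Gamma> \<longleftrightarrow>
     partition \<alpha> \<and> partition \<beta> \<and> partition \<gamma> \<and> is_tableau \<Gamma> \<and>
     \<Gamma> 0 = \<gamma> \<and> (\<exists>s. \<forall>i\<ge>s. \<Gamma> i = \<beta>) \<and>
     (\<forall>e\<ge>1. card (entry_boxes \<Gamma> e) = conjugate_part \<alpha> e) \<and>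
     (\<forall>r c c' e e'. (r, c) \<in> entry_boxes \<Gamma> e \<and> (r, c') \<in> entry_boxes \<Gamma> e' \<and> c < c' \<longrightarrow> e \<le> e') \<and>
     (\<forall>r r' c e e'. (r, c) \<in> entry_boxes \<Gamma> e \<and> (r', c) \<in> entry_boxes \<Gamma> e' \<and> r < r' \<longrightarrow> e < e') \<and>
     (\<forall>c. \<forall>e\<ge>1. card {(r, c') \<in> entry_boxes \<Gamma> (e + 1). c < c'}
                  \<le> card {(r, c') \<in> entry_boxes \<Gamma> e. c < c'})"

definition tableau_union :: "tableau \<Rightarrow> tableau \<Rightarrow> tableau" where
  "tableau_union E Z = (\<lambda>i. partition_union (E i) (Z i))"

text \<open>
  In \<open>C(e,f)\<^sub>n\<close> the boxes that are empty or have entry at most \<open>i\<close> form a column whose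
  height is \<open>n\<close> minus the number of entries greater than \<open>i\<close>.  The parameters are meaningful
  if \<open>is_column e f n\<close>; the second alternative is the empty column \<open>C(1,0)\<^sub>n\<close>.
\<close>

definition is_column :: "nat \<Rightarrow> nat \<Rightarrow> nat \<Rightarrow> bool" where
  "is_column e f n \<longleftrightarrow> n \<ge> 1 \<and> (1 \<le> e \<and> e \<le> f \<and> f - e + 1 \<le> n \<or> e = 1 \<and> f = 0)"

definition column_tableau :: "nat \<Rightarrow> nat \<Rightarrow> nat \<Rightarrow> tableau" where
  "column_tableau e f n = (\<lambda>i. let h = n - card {j \<in> {e..f}. i < j} in if h = 0 then [] else [h])"

inductive union_of_columns :: "tableau \<Rightarrow> bool" where
  empty: "union_of_columns (\<lambda>_. [])"
| column: "union_of_columns \<Delta> \<Longrightarrow> is_column e f n \<Longrightarrow>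
     union_of_columns (tableau_union \<Delta> (column_tableau e f n))"

definition increasing_box_move :: "tableau \<Rightarrow> tableau \<Rightarrow> bool" where
  "increasing_box_move \<Gamma> \<Gamma>' \<longleftrightarrow> (\<exists>\<Delta> e f e' f' n n'. union_of_columns \<Delta> \<and>
     n > n' \<and> 1 \<le> e \<and> e \<le> f \<and> e < e' \<and> f < f' \<and> f - e = f' - e' \<and>
     is_column e f n \<and> is_column e' f' n' \<and> is_column e' f' n \<and> is_column e f n' \<and>
     \<Gamma> = tableau_union (tableau_union \<Delta> (column_tableau e f n)) (column_tableau e' f' n') \<and>
     \<Gamma>' = tableau_union (tableau_union \<Delta> (column_tableau e' f' n)) (column_tableau e f n'))"


section \<open>Modules over the power series ring\<close>

abbreviation field_ring :: "'k::field ring" where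
  "field_ring \<equiv> ring_of_type_algebra"

abbreviation Lam :: "'k::field fps ring" where
  "Lam \<equiv> ring_of_type_algebra"

type_synonym 'k N_module = "('k fps, nat \<Rightarrow> 'k fps set) module"
type_synonym 'k N_map = "(nat \<Rightarrow> 'k fps set) \<Rightarrow> (nat \<Rightarrow> 'k fps set)"

definition N_mod :: "nat list \<Rightarrow> 'k::field N_module" where
  "N_mod \<beta> = direct_sum_module (length \<beta>)
     (\<lambda>i. quotient_module (regular_module Lam) (PIdl\<^bsub>Lam\<^esub> (fps_X ^ (\<beta> ! i))))"

definition has_type :: "('k::field fps, 'b) module \<Rightarrow> nat list \<Rightarrow> bool" where
  "has_type M \<beta> \<longleftrightarrow> partition \<beta> \<and> module_isomorphic Lam M (N_mod \<beta> :: 'k N_module)"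

text \<open>The tableau of an embedding of a submodule \<open>A\<close> of \<open>B\<close>.\<close>

definition embedding_has_tableau ::
  "('k::field fps, 'b) module \<Rightarrow> 'b set \<Rightarrow> tableau \<Rightarrow> bool" where
  "embedding_has_tableau B A \<Gamma> \<longleftrightarrow>
     (\<forall>e. has_type (quotient_module B ((\<lambda>a. fps_X ^ e \<odot>\<^bsub>B\<^esub> a) ` A)) (\<Gamma> e))"


section \<open>Zariski topology and varieties\<close>

text \<open>
  Polynomial functions on a vector space \<open>V\<close> are the algebra of functions generated by the
  constants and the linear functionals.  If \<open>V\<close> has finite dimension, these are the polynomials
  in the coordinates with respect to any basis.
\<close>

inductive_set polynomial_functions :: "('k::field, 'v) module \<Rightarrow> ('v \<Rightarrow> 'k) set"
  for V :: "('k, 'v) module" where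
  const: "(\<lambda>_. c) \<in> polynomial_functions V"
| linear: "l \<in> module_homs field_ring V (regular_module field_ring) \<Longrightarrow> l \<in> polynomial_functions V"
| add: "p \<in> polynomial_functions V \<Longrightarrow> q \<in> polynomial_functions V \<Longrightarrow>
     (\<lambda>v. p v + q v) \<in> polynomial_functions V"
| mult: "p \<in> polynomial_functions V \<Longrightarrow> q \<in> polynomial_functions V \<Longrightarrow>
     (\<lambda>v. p v * q v) \<in> polynomial_functions V"

definition zariski_open :: "('k::field, 'v) module \<Rightarrow> 'v set \<Rightarrow> bool" where
  "zariski_open V U \<longleftrightarrow>
     (\<exists>P \<subseteq> polynomial_functions V. U = carrier V - {v \<in> carrier V. \<forall>p\<in>P. p v = 0})"

definition zariski_topology :: "('k::field, 'v) module \<Rightarrow> 'v topology" where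
  "zariski_topology V = topology (zariski_open V)"

lemma zariski_open_iff:
  "zariski_open V U \<longleftrightarrow> U \<subseteq> carrier V \<and>
     (\<forall>v\<in>U. \<exists>p\<in>polynomial_functions V. p v \<noteq> 0 \<and> (\<forall>w\<in>carrier V. p w \<noteq> 0 \<longrightarrow> w \<in> U))"
    (is "_ \<longleftrightarrow> ?R")
proof
  assume "zariski_open V U"
  then obtain P where P: "P \<subseteq> polynomial_functions V"
      and U: "U = carrier V - {v \<in> carrier V. \<forall>p\<in>P. p v = 0}"
    unfolding zariski_open_def by (elim exE conjE)
  show ?R
  proof (intro conjI ballI)
    show "U \<subseteq> carrier V" unfolding U by (rule Diff_subset)
    fix v assume "v \<in> U"
    then obtain p where p: "p \<in> P" "p v \<noteq> 0" unfolding U by force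
    moreover have "\<forall>w\<in>carrier V. p w \<noteq> 0 \<longrightarrow> w \<in> U" unfolding U using p(1) by simp blast
    ultimately show "\<exists>p\<in>polynomial_functions V. p v \<noteq> 0 \<and> (\<forall>w\<in>carrier V. p w \<noteq> 0 \<longrightarrow> w \<in> U)"
      using subsetD[OF P p(1)] by (intro bexI[of _ p]) simp_all
  qed
next
  assume R: ?R
  let ?P = "{p \<in> polynomial_functions V. \<forall>w\<in>carrier V. p w \<noteq> 0 \<longrightarrow> w \<in> U}"
  have "v \<in> U \<longleftrightarrow> v \<in> carrier V - {v \<in> carrier V. \<forall>p\<in>?P. p v = 0}" for v
    using R by simp blast
  then have "U = carrier V - {v \<in> carrier V. \<forall>p\<in>?P. p v = 0}"
    by (rule Set.set_eqI)
  then show "zariski_open V U"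
    unfolding zariski_open_def by (intro exI[of _ ?P] conjI) simp_all
qed

lemma istopology_zariski_open: "istopology (zariski_open V)"
  unfolding istopology_def
proof (intro conjI allI impI)
  fix S T
  assume S: "zariski_open V S" and T: "zariski_open V T"
  show "zariski_open V (S \<inter> T)"
    unfolding zariski_open_iff
  proof (intro conjI ballI)
    show "S \<inter> T \<subseteq> carrier V" using S unfolding zariski_open_iff by (simp add: le_infI1)
    fix v assume v: "v \<in> S \<inter> T"
    obtain p where p: "p \<in> polynomial_functions V" "p v \<noteq> 0" "\<forall>w\<in>carrier V. p w \<noteq> 0 \<longrightarrow> w \<in> S"
      using S v unfolding zariski_open_iff by (elim conjE IntE) (drule (1) bspec, elim bexE conjE, simp)
    obtain q where q: "q \<in> polynomial_functions V" "q v \<noteq> 0" "\<forall>w\<in>carrier V. q w \<noteq> 0 \<longrightarrow> w \<in> T"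
      using T v unfolding zariski_open_iff by (elim conjE IntE) (drule (1) bspec, elim bexE conjE, simp)
    show "\<exists>r\<in>polynomial_functions V. r v \<noteq> 0 \<and> (\<forall>w\<in>carrier V. r w \<noteq> 0 \<longrightarrow> w \<in> S \<inter> T)"
      using p q by (intro bexI[of _ "\<lambda>v. p v * q v"] polynomial_functions.mult) simp_all
  qed
next
  fix \<K>
  assume K: "\<forall>K\<in>\<K>. zariski_open V K"
  show "zariski_open V (\<Union>\<K>)"
    unfolding zariski_open_iff
  proof (intro conjI ballI)
    show "\<Union>\<K> \<subseteq> carrier V" using K unfolding zariski_open_iff by (simp add: Sup_le_iff)
    fix v assume "v \<in> \<Union>\<K>"
    then obtain K where K': "K \<in> \<K>" "v \<in> K" by (rule UnionE)
    with K have "\<exists>p\<in>polynomial_functions V. p v \<noteq> 0 \<and> (\<forall>w\<in>carrier V. p w \<noteq> 0 \<longrightarrow> w \<in> K)"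
      unfolding zariski_open_iff by simp
    then show "\<exists>p\<in>polynomial_functions V. p v \<noteq> 0 \<and> (\<forall>w\<in>carrier V. p w \<noteq> 0 \<longrightarrow> w \<in> \<Union>\<K>)"
      using K'(1) by (elim bexE conjE, intro bexI conjI) auto
  qed
qed

lemma openin_zariski_topology: "openin (zariski_topology V) = zariski_open V"
  unfolding zariski_topology_def by (rule topology_inverse'[OF istopology_zariski_open])

lemma topspace_zariski_topology: "topspace (zariski_topology V) = carrier V"
proof
  show "topspace (zariski_topology V) \<subseteq> carrier V"
    unfolding topspace_def openin_zariski_topology zariski_open_def by blast
  have "zariski_open V (carrier V)"
    unfolding zariski_open_def
    by (rule exI[of _ "{\<lambda>_. 1}"]) (auto intro: polynomial_functions.const)
  then show "carrier V \<subseteq> topspace (zariski_topology V)"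
    unfolding topspace_def openin_zariski_topology by blast
qed

text \<open>The affine space \<open>Hom\<^sub>k(N\<^sub>\<alpha>, N\<^sub>\<beta>)\<close> of all linear maps over the field.\<close>

definition Hom_k :: "nat list \<Rightarrow> nat list \<Rightarrow> ('k::field, 'k N_map) module" where
  "Hom_k \<alpha> \<beta> = hom_module field_ring
     (restrict_scalars fps_const (N_mod \<alpha>)) (restrict_scalars fps_const (N_mod \<beta>))"

definition V_embeddings :: "nat list \<Rightarrow> nat list \<Rightarrow> nat list \<Rightarrow> 'k::field N_map set" where
  "V_embeddings \<alpha> \<beta> \<gamma> = {f \<in> module_homs Lam (N_mod \<alpha>) (N_mod \<beta>).
     inj_on f (carrier (N_mod \<alpha>)) \<and>
     module_isomorphic Lam (quotient_module (N_mod \<beta>) (f ` carrier (N_mod \<alpha>)))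
       (N_mod \<gamma> :: 'k N_module)}"

definition V_tableau :: "nat list \<Rightarrow> nat list \<Rightarrow> nat list \<Rightarrow> tableau \<Rightarrow> 'k::field N_map set" where
  "V_tableau \<alpha> \<beta> \<gamma> \<Gamma> =
     {f \<in> V_embeddings \<alpha> \<beta> \<gamma>. embedding_has_tableau (N_mod \<beta>) (f ` carrier (N_mod \<alpha>)) \<Gamma>}"

lemma V_tableau_subset_Hom_k: "V_tableau \<alpha> \<beta> \<gamma> \<Gamma> \<subseteq> carrier (Hom_k \<alpha> \<beta>)"
  by (auto simp: V_tableau_def V_embeddings_def Hom_k_def hom_module_def module_homs_def
      restrict_scalars_def ring_of_type_algebra_def)

text \<open>The relation depends on the field, which is passed as a type argument.\<close>

definition boundary_less ::
  "'k::field itself \<Rightarrow> nat list \<Rightarrow> nat list \<Rightarrow> nat list \<Rightarrow> tableau \<Rightarrow> tableau \<Rightarrow> bool" where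
  "boundary_less _ \<alpha> \<beta> \<gamma> \<Gamma> \<Gamma>' \<longleftrightarrow> \<Gamma> \<noteq> \<Gamma>' \<and>
     V_tableau \<alpha> \<beta> \<gamma> \<Gamma>' \<inter>
       Abstract_Topology.closure_of (zariski_topology (Hom_k \<alpha> \<beta>))
         (V_tableau \<alpha> \<beta> \<gamma> \<Gamma> :: 'k N_map set) \<noteq> {}"

end

theory Submission
  imports Defs "HOL-Library.Function_Algebras" "HOL-Combinatorics.Permutations"
begin

text \<open>
  A union of columns is the tableau of a direct sum of embeddings with cyclic submodules: entries
  being counted row by row, the lattice condition allows a matching of every column \<open>C(k+1,f)\<^sub>n\<close> with a
  column \<open>C(e,k)\<^sub>m\<close> such that \<open>m - k \<le> n - f\<close>.  The columns thus form chains
  \<open>C(1,f\<^sub>1), C(f\<^sub>1+1,f\<^sub>2), \<dots>\<close> of heights \<open>m\<^sub>i\<close>, and the element with components \<open>X ^ (m\<^sub>i - f\<^sub>i)\<close> in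
  \<open>\<Oplus> \<Lambda>/(X ^ m\<^sub>i)\<close> generates a submodule whose tableau is the union of the columns of the chain.
  For a box move, one matching serves both tableaux.  In the resulting embedding \<open>f\<^sub>0\<close> with tableau
  \<open>\<Gamma>'\<close> the columns \<open>C(e',f')\<^sub>n\<close> and \<open>C(e,f)\<^sub>n\<^sub>'\<close> lie in different chains; let \<open>f\<^sub>t\<close> be obtained by adding the
  component \<open>t X ^ (n' - f')\<close> in the column of height \<open>n'\<close> to the generator of the former.  For
  \<open>t \<noteq> 0\<close> a base change turns \<open>f\<^sub>t\<close> into the direct sum for \<open>\<Gamma>\<close>, up to an extra component of one generator
  that does not affect the tableau.  So \<open>f\<^sub>t \<in> V\<^sub>\<Gamma>\<close> for \<open>t \<noteq> 0\<close>, and \<open>f\<^sub>0\<close> is in the closure since a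
  polynomial function restricted to the line \<open>t \<mapsto> f\<^sub>t\<close> is a polynomial in \<open>t\<close>.
\<close>

section \<open>Modules as images of free modules\<close>

text \<open>A union sorts its parts anew at every level, so a summand \<open>C(e,f)_n\<close> need
  not be a column of the diagram. Numbers of boxes in the first rows, however, add up over the
  summands; this is why the lattice condition must become a statement about rows before columns can
  be matched. The matching inequality says that the exponents \<open>m_i - f_i\<close> do not
  decrease along a chain, so multiples of earlier components can be subtracted from later ones. The
  extra component left by the base change is not simply absorbed: subtracting a multiple of the
  other generator would clear that one column but may put components into the other columns of the
  other chain. So the component stays, and for every j the type of \<open>B/p^j A\<close> is read
  off after a unitriangular change of coordinates that turns \<open>p^j A\<close> and the relations
  into a lattice spanned by powers of X. The exponents in this change are nonnegative by the chain
  inequalities of \<Gamma>', which is a second use of the common matching; they fit the level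
  heights because both intervals of the box move have the same length.\<close>

definition linear_onto ::
  "('r \<Rightarrow> 'v \<Rightarrow> 'v) \<Rightarrow> ('v::ab_group_add \<Rightarrow> 'b) \<Rightarrow> ('r, 'b) module \<Rightarrow> bool" where
  "linear_onto sc \<pi> M \<longleftrightarrow> carrier M = range \<pi> \<and> \<zero>\<^bsub>M\<^esub> = \<pi> 0 \<and>
     (\<forall>v w. \<pi> v \<oplus>\<^bsub>M\<^esub> \<pi> w = \<pi> (v + w)) \<and> (\<forall>r v. r \<odot>\<^bsub>M\<^esub> \<pi> v = \<pi> (sc r v))"

text \<open>Elements of coset modules are written as \<open>\<pi> v\<close>, so that all
  computations take place on representatives \<open>v\<close> in an additive type class.\<close>

lemma linear_ontoD:
  assumes "linear_onto sc \<pi> M"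
  shows "carrier M = range \<pi>" "\<zero>\<^bsub>M\<^esub> = \<pi> 0"
    "\<pi> v \<oplus>\<^bsub>M\<^esub> \<pi> w = \<pi> (v + w)" "r \<odot>\<^bsub>M\<^esub> \<pi> v = \<pi> (sc r v)"
  using assms unfolding linear_onto_def by auto

text \<open>The values off the range of \<open>\<pi>\<close> are undefined because
  \<open>module_homs\<close> asks for extensional maps.\<close>

definition descend :: "('v \<Rightarrow> 'b) \<Rightarrow> ('v \<Rightarrow> 'c) \<Rightarrow> 'b \<Rightarrow> 'c" where
  "descend \<pi> \<rho> = (\<lambda>x\<in>range \<pi>. \<rho> (SOME v. \<pi> v = x))"

lemma descend_apply:
  assumes "\<And>v w. \<pi> v = \<pi> w \<Longrightarrow> \<rho> v = \<rho> w"
  shows "descend \<pi> \<rho> (\<pi> v) = \<rho> v"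
proof -
  have "\<pi> (SOME w. \<pi> w = \<pi> v) = \<pi> v" by (rule someI) (rule refl)
  from assms[OF this] show ?thesis unfolding descend_def by simp
qed

lemma descend_hom:
  assumes M: "linear_onto sc \<pi> M" and N: "linear_onto sc' \<rho>' N"
    and wd: "\<And>v w. \<pi> v = \<pi> w \<Longrightarrow> \<rho>' (F v) = \<rho>' (F w)"
    and F: "\<And>v w. F (v + w) = F v + F w" "\<And>r v. r \<in> carrier R \<Longrightarrow> F (sc r v) = sc' r (F v)"
  shows "descend \<pi> (\<lambda>v. \<rho>' (F v)) \<in> module_homs R M N"
proof -
  have d: "descend \<pi> (\<lambda>v. \<rho>' (F v)) (\<pi> v) = \<rho>' (F v)" for v
    by (rule descend_apply) (rule wd)
  show ?thesis
    unfolding module_homs_def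
  proof (intro CollectI conjI ballI)
    show "descend \<pi> (\<lambda>v. \<rho>' (F v)) \<in> carrier M \<rightarrow>\<^sub>E carrier N"
      unfolding linear_ontoD(1)[OF M] linear_ontoD(1)[OF N] by (auto simp: d, simp add: descend_def)
  next
    fix x y assume "x \<in> carrier M" "y \<in> carrier M"
    then obtain v w where "x = \<pi> v" "y = \<pi> w" using linear_ontoD(1)[OF M] by auto
    then show "descend \<pi> (\<lambda>v. \<rho>' (F v)) (x \<oplus>\<^bsub>M\<^esub> y) =
      descend \<pi> (\<lambda>v. \<rho>' (F v)) x \<oplus>\<^bsub>N\<^esub> descend \<pi> (\<lambda>v. \<rho>' (F v)) y"
      by (simp add: linear_ontoD(3)[OF M] linear_ontoD(3)[OF N] d F)
  next
    fix r x assume r: "r \<in> carrier R" and "x \<in> carrier M"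
    then obtain v where "x = \<pi> v" using linear_ontoD(1)[OF M] by auto
    then show "descend \<pi> (\<lambda>v. \<rho>' (F v)) (r \<odot>\<^bsub>M\<^esub> x) = r \<odot>\<^bsub>N\<^esub> descend \<pi> (\<lambda>v. \<rho>' (F v)) x"
      by (simp add: linear_ontoD(4)[OF M] linear_ontoD(4)[OF N] d F r)
  qed
qed

text \<open>First isomorphism theorem: both modules are quotients of the same representatives by the
  same kernel.\<close>

lemma module_isomorphicI:
  assumes M: "linear_onto sc \<pi> M" and N: "linear_onto sc \<rho> N"
    and ker: "\<And>v w. \<pi> v = \<pi> w \<longleftrightarrow> \<rho> v = \<rho> w"
  shows "module_isomorphic R M N"
proof -
  have d: "descend \<pi> \<rho> (\<pi> v) = \<rho> v" for v
    by (rule descend_apply) (simp add: ker)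
  have "descend \<pi> (\<lambda>v. \<rho> ((\<lambda>v. v) v)) \<in> module_homs R M N"
    by (rule descend_hom[OF M N]) (simp_all add: ker)
  moreover have "bij_betw (descend \<pi> \<rho>) (carrier M) (carrier N)"
    unfolding linear_ontoD(1)[OF M] linear_ontoD(1)[OF N] bij_betw_def inj_on_def
    by (auto simp: d ker image_iff)
  ultimately show ?thesis unfolding module_isomorphic_def by auto
qed

text \<open>The closure conditions are put on the preimage \<open>K\<close> of \<open>U\<close>,
  because submodules are later given by divisibility conditions on representatives.\<close>

lemma quotient_module_linear_onto:
  assumes M: "linear_onto sc \<pi> M"
    and sc: "\<And>r v w. sc r (v + w) = sc r v + sc r w"
    and K: "K = {v. \<pi> v \<in> U}" "U \<subseteq> carrier M"
    and K0: "0 \<in> K" and Kp: "\<And>v w. v \<in> K \<Longrightarrow> w \<in> K \<Longrightarrow> v + w \<in> K"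
    and Km: "\<And>v. v \<in> K \<Longrightarrow> - v \<in> K" and Ks: "\<And>r v. v \<in> K \<Longrightarrow> sc r v \<in> K"
  shows "linear_onto sc (\<lambda>v. U +>\<^bsub>M\<^esub> \<pi> v) (quotient_module M U)" (is ?L)
    and "U +>\<^bsub>M\<^esub> \<pi> v = U +>\<^bsub>M\<^esub> \<pi> w \<longleftrightarrow> v - w \<in> K" (is "?E v w")
proof -
  have U: "U = \<pi> ` K"
    using K linear_ontoD(1)[OF M] by auto
  have coset: "U +>\<^bsub>M\<^esub> \<pi> v = (\<lambda>k. \<pi> (k + v)) ` K" for v
    unfolding a_r_coset_def' U by (auto simp: linear_ontoD(3)[OF M])
  have ker: "x - y \<in> K" if "\<pi> x = \<pi> y" for x y
  proof -
    have "\<pi> (x - y) = \<pi> x \<oplus>\<^bsub>M\<^esub> \<pi> (- y)" by (simp add: linear_ontoD(3)[OF M])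
    also have "\<dots> = \<pi> 0" unfolding that by (simp add: linear_ontoD(3)[OF M])
    finally show ?thesis using K0 unfolding K by simp
  qed
  have E: "?E v w" for v w
  proof
    assume "v - w \<in> K"
    then have "w - v \<in> K" using Km by fastforce
    have sub: "(\<lambda>k. \<pi> (k + v)) ` K \<subseteq> (\<lambda>k. \<pi> (k + w)) ` K" if "v - w \<in> K" for v w
    proof (rule image_subsetI)
      fix k assume "k \<in> K"
      then show "\<pi> (k + v) \<in> (\<lambda>k. \<pi> (k + w)) ` K"
        using Kp[OF _ that] by (intro image_eqI[of _ _ "k + (v - w)"]) simp_all
    qed
    show "U +>\<^bsub>M\<^esub> \<pi> v = U +>\<^bsub>M\<^esub> \<pi> w"
      unfolding coset using sub \<open>v - w \<in> K\<close> \<open>w - v \<in> K\<close> by (intro equalityI) simp_all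
  next
    assume "U +>\<^bsub>M\<^esub> \<pi> v = U +>\<^bsub>M\<^esub> \<pi> w"
    then have "\<pi> (0 + v) \<in> (\<lambda>k. \<pi> (k + w)) ` K" unfolding coset using K0 by blast
    then obtain k where k: "k \<in> K" "\<pi> (0 + v) = \<pi> (k + w)" by auto
    have "k + (0 + v - (k + w)) \<in> K" by (rule Kp[OF k(1) ker[OF k(2)]])
    then show "v - w \<in> K" by simp
  qed
  then show "?E v w" .
  have sm: "(\<Union>x\<in>U +>\<^bsub>M\<^esub> \<pi> v. U +>\<^bsub>M\<^esub> (r \<odot>\<^bsub>M\<^esub> x)) = U +>\<^bsub>M\<^esub> \<pi> (sc r v)" for r v
  proof -
    have "U +>\<^bsub>M\<^esub> (r \<odot>\<^bsub>M\<^esub> \<pi> (k + v)) = U +>\<^bsub>M\<^esub> \<pi> (sc r v)" if "k \<in> K" for k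
      unfolding linear_ontoD(4)[OF M] E using Ks[OF that] by (simp add: sc)
    then show ?thesis using K0 unfolding coset[of v] by auto
  qed
  have ad: "(U +>\<^bsub>M\<^esub> \<pi> v) <+>\<^bsub>M\<^esub> (U +>\<^bsub>M\<^esub> \<pi> w) = U +>\<^bsub>M\<^esub> \<pi> (v + w)" for v w
  proof -
    have "\<pi> (a + v) \<oplus>\<^bsub>M\<^esub> \<pi> (b + w) \<in> (\<lambda>k. \<pi> (k + (v + w))) ` K" if "a \<in> K" "b \<in> K" for a b
      unfolding linear_ontoD(3)[OF M]
      by (rule image_eqI[of _ _ "a + b"]) (simp_all add: Kp that ac_simps)
    moreover have "\<pi> (k + (v + w)) = \<pi> (k + v) \<oplus>\<^bsub>M\<^esub> \<pi> (0 + w)" for k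
      unfolding linear_ontoD(3)[OF M] by (simp add: ac_simps)
    ultimately show ?thesis
      unfolding set_add_def' coset using K0 by blast
  qed
  show ?L
    unfolding linear_onto_def
  proof (intro conjI allI)
    show "carrier (quotient_module M U) = range (\<lambda>v. U +>\<^bsub>M\<^esub> \<pi> v)"
      by (auto simp: quotient_module_def A_RCOSETS_def' linear_ontoD(1)[OF M] a_r_coset_def)
    have "U +>\<^bsub>M\<^esub> \<pi> 0 = U" using coset[of 0] U by simp
    then show "\<zero>\<^bsub>quotient_module M U\<^esub> = U +>\<^bsub>M\<^esub> \<pi> 0" by (simp add: quotient_module_def)
  qed (simp_all add: quotient_module_def ad sm)
qed

section \<open>The modules N_\<beta> and the types of their quotients\<close>

lemma Lam_simps [simp]:
  "carrier ring_of_type_algebra = UNIV" "x \<otimes>\<^bsub>ring_of_type_algebra\<^esub> y = x * y"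
  "x \<oplus>\<^bsub>ring_of_type_algebra\<^esub> y = x + y" "\<zero>\<^bsub>ring_of_type_algebra\<^esub> = 0"
  by (simp_all add: ring_of_type_algebra_def)

definition fscale :: "'a::times \<Rightarrow> (nat \<Rightarrow> 'a) \<Rightarrow> nat \<Rightarrow> 'a" where
  "fscale r v = (\<lambda>i. r * v i)"

lemma fscale_apply [simp]: "fscale r v i = r * v i"
  by (simp add: fscale_def)

definition N_proj :: "nat list \<Rightarrow> (nat \<Rightarrow> 'k::field fps) \<Rightarrow> nat \<Rightarrow> 'k fps set" where
  "N_proj b v = (\<lambda>i\<in>{..<length b}.
     PIdl\<^bsub>Lam\<^esub> (fps_X ^ (b ! i)) +>\<^bsub>regular_module Lam\<^esub> v i)"

lemma cyclic_linear_onto: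
  fixes q :: "'k::field fps"
  shows "linear_onto (*) (\<lambda>v. PIdl\<^bsub>Lam\<^esub> q +>\<^bsub>regular_module Lam\<^esub> v)
      (quotient_module (regular_module Lam) (PIdl\<^bsub>Lam\<^esub> q))"
    and "PIdl\<^bsub>Lam\<^esub> q +>\<^bsub>regular_module Lam\<^esub> v =
      PIdl\<^bsub>Lam\<^esub> q +>\<^bsub>regular_module Lam\<^esub> w \<longleftrightarrow> q dvd v - w"
proof -
  have P: "PIdl\<^bsub>Lam\<^esub> q = {v. q dvd v}"
    by (auto simp: cgenideal_def dvd_def mult.commute)
  have M: "linear_onto (*) (\<lambda>v. v) (regular_module (Lam :: 'k fps ring))"
    by (simp add: linear_onto_def regular_module_def)
  note q = quotient_module_linear_onto[OF M, where U = "PIdl\<^bsub>Lam\<^esub> q" and K = "{v. q dvd v}"]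
  show "linear_onto (*) (\<lambda>v. PIdl\<^bsub>Lam\<^esub> q +>\<^bsub>regular_module Lam\<^esub> v)
      (quotient_module (regular_module Lam) (PIdl\<^bsub>Lam\<^esub> q))"
    by (rule q(1)) (auto simp: P algebra_simps linear_ontoD(1)[OF M])
  have "PIdl\<^bsub>Lam\<^esub> q +>\<^bsub>regular_module Lam\<^esub> v =
      PIdl\<^bsub>Lam\<^esub> q +>\<^bsub>regular_module Lam\<^esub> w \<longleftrightarrow> v - w \<in> {v. q dvd v}"
    by (rule q(2)) (auto simp: P algebra_simps linear_ontoD(1)[OF M])
  then show "PIdl\<^bsub>Lam\<^esub> q +>\<^bsub>regular_module Lam\<^esub> v =
      PIdl\<^bsub>Lam\<^esub> q +>\<^bsub>regular_module Lam\<^esub> w \<longleftrightarrow> q dvd v - w" by simp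
qed

lemma N_proj_linear_onto: "linear_onto fscale (N_proj b) (N_mod b :: 'k::field N_module)"
  unfolding linear_onto_def
proof (intro conjI allI)
  show "carrier (N_mod b :: 'k N_module) = range (N_proj b)"
  proof (intro equalityI subsetI)
    fix x :: "nat \<Rightarrow> 'k fps set" assume "x \<in> carrier (N_mod b)"
    then have x: "x \<in> (\<Pi>\<^sub>E i\<in>{..<length b}.
        range (\<lambda>v. PIdl\<^bsub>Lam\<^esub> (fps_X ^ (b ! i)) +>\<^bsub>regular_module Lam\<^esub> v))"
      by (simp add: N_mod_def direct_sum_module_def linear_ontoD(1)[OF cyclic_linear_onto(1)])
    then have "\<forall>i\<in>{..<length b}. \<exists>v. x i = PIdl\<^bsub>Lam\<^esub> (fps_X ^ (b ! i)) +>\<^bsub>regular_module Lam\<^esub> v"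
      by (auto simp: PiE_iff)
    then obtain v where v: "\<forall>i\<in>{..<length b}.
        x i = PIdl\<^bsub>Lam\<^esub> (fps_X ^ (b ! i)) +>\<^bsub>regular_module Lam\<^esub> v i"
      by (rule bchoice[THEN exE])
    have "x = N_proj b v"
      using x v by (auto simp: N_proj_def PiE_iff extensional_def fun_eq_iff)
    then show "x \<in> range (N_proj b)" by simp
  next
    fix x :: "nat \<Rightarrow> 'k fps set" assume "x \<in> range (N_proj b)"
    then show "x \<in> carrier (N_mod b)"
      by (auto simp: N_mod_def direct_sum_module_def N_proj_def
          linear_ontoD(1)[OF cyclic_linear_onto(1)])
  qed
qed (auto simp: N_mod_def direct_sum_module_def N_proj_def fun_eq_iff
    linear_ontoD[OF cyclic_linear_onto(1)])

lemma N_proj_eq_iff: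
  "N_proj b v = N_proj b (w :: nat \<Rightarrow> 'k::field fps) \<longleftrightarrow> (\<forall>i<length b. fps_X ^ (b ! i) dvd v i - w i)"
  unfolding N_proj_def fun_eq_iff by (auto simp: cyclic_linear_onto(2) restrict_def)

text \<open>Partitions are sorted lists, whereas columns come in an arbitrary order;
  \<open>\<tau>\<close> records the sorting.\<close>

lemma mset_eq_image_obtain_bij:
  assumes "mset t = image_mset c (mset_set A)" "finite A"
  obtains \<tau> where "bij_betw \<tau> {..<length t} A" "\<And>k. k < length t \<Longrightarrow> t ! k = c (\<tau> k)"
proof -
  obtain xs where xs: "set xs = A" "distinct xs" using finite_distinct_list[OF assms(2)] by blast
  then have "mset_set A = mset xs" using mset_set_set by blast
  with assms have "mset t = mset (map c xs)" by simp
  then obtain p where p: "p permutes {..<length (map c xs)}" "permute_list p (map c xs) = t"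
    using mset_eq_permutation by metis
  then have len: "length t = length xs" by (metis length_map length_permute_list)
  show ?thesis
  proof (rule that[of "\<lambda>k. xs ! p k"])
    have "bij_betw p {..<length t} {..<length xs}" using p(1) len by (simp add: permutes_imp_bij)
    moreover have "bij_betw ((!) xs) {..<length xs} A" using xs by (intro bij_betw_nth) auto
    ultimately show "bij_betw (\<lambda>k. xs ! p k) {..<length t} A"
      using bij_betw_trans[of p _ _ "(!) xs"] by (simp add: comp_def)
    show "t ! k = c (xs ! p k)" if "k < length t" for k
    proof -
      have "p k < length xs" using permutes_in_image[OF p(1), of k] that len by simp
      then show ?thesis using permute_list_nth[OF p(1), of k] that len p(2) by simp
    qed
  qed
qed

text \<open>In the coordinates \<open>\<psi>\<close> the submodule is the product of the ideals
  generated by \<open>X ^ c i\<close>, so the quotient is the sum of the cyclic modules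
  \<open>\<Lambda>/(X ^ c i)\<close>. Summands with \<open>c i = 0\<close> vanish and are dropped,
  as partitions have no zero parts.\<close>

lemma has_type_quotientI:
  fixes \<psi> :: "(nat \<Rightarrow> 'k::field fps) \<Rightarrow> nat \<Rightarrow> 'k fps"
  assumes ker: "\<And>v. N_proj b v \<in> U \<longleftrightarrow> (\<forall>i<s. fps_X ^ c i dvd \<psi> v i)"
    and U: "U \<subseteq> carrier (N_mod b)"
    and \<psi>: "\<And>v w. \<psi> (v + w) = \<psi> v + \<psi> w" "\<And>r v. \<psi> (fscale r v) = fscale r (\<psi> v)"
    and surj: "\<And>w. \<exists>v. \<forall>i<s. \<psi> v i = w i"
    and t: "partition t" "mset t = {#h \<in># image_mset c (mset_set {..<s}). h \<noteq> 0#}"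
  shows "has_type (quotient_module (N_mod b) U) t"
proof -
  define A where "A = {i. i < s \<and> c i \<noteq> 0}"
  have "mset t = image_mset c (mset_set A)"
    unfolding t(2) A_def by (simp add: filter_mset_image_mset filter_mset_mset_set lessThan_def)
  moreover have "finite A" by (simp add: A_def)
  ultimately obtain \<tau> where \<tau>: "bij_betw \<tau> {..<length t} A" "\<And>k. k < length t \<Longrightarrow> t ! k = c (\<tau> k)"
    using mset_eq_image_obtain_bij by metis
  have \<psi>0: "\<psi> 0 = 0" using \<psi>(1)[of 0 0] by simp
  have \<psi>m: "\<psi> (- v) = - \<psi> v" for v using \<psi>(1)[of v "- v"] \<psi>0 by (simp add: eq_neg_iff_add_eq_0 add.commute)
  have \<psi>d: "\<psi> (v - w) = \<psi> v - \<psi> w" for v w using \<psi>(1)[of v "- w"] \<psi>m by simp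
  let ?K = "{v. N_proj b v \<in> U}"
  note q = quotient_module_linear_onto[OF N_proj_linear_onto[of b], where U = U and K = ?K]
  have 1: "linear_onto fscale (\<lambda>v. U +>\<^bsub>N_mod b\<^esub> N_proj b v) (quotient_module (N_mod b) U)"
    by (rule q(1)) (auto simp: ker \<psi> \<psi>0 \<psi>m U fun_eq_iff algebra_simps)
  have 2: "U +>\<^bsub>N_mod b\<^esub> N_proj b v = U +>\<^bsub>N_mod b\<^esub> N_proj b w \<longleftrightarrow> v - w \<in> ?K" for v w
    by (rule q(2)) (auto simp: ker \<psi> \<psi>0 \<psi>m U fun_eq_iff algebra_simps)
  define \<rho> where "\<rho> v = N_proj t (\<lambda>k. \<psi> v (\<tau> k))" for v
  note N = linear_ontoD[OF N_proj_linear_onto[of t]]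
  have 3: "linear_onto fscale \<rho> (N_mod t :: 'k N_module)"
    unfolding linear_onto_def
  proof (intro conjI allI)
    have "N_proj t u \<in> range \<rho>" for u :: "nat \<Rightarrow> 'k fps"
    proof -
      obtain v where v: "\<forall>i<s. \<psi> v i = u (inv_into {..<length t} \<tau> i)"
        using surj[of "\<lambda>i. u (inv_into {..<length t} \<tau> i)"] by blast
      have "\<psi> v (\<tau> k) = u k" if "k < length t" for k
      proof -
        have "\<tau> k \<in> A" using \<tau>(1) that by (auto simp: bij_betw_def)
        then have "\<tau> k < s" by (simp add: A_def)
        then show ?thesis using v \<tau>(1) that by (simp add: bij_betw_def inv_into_f_f)
      qed
      then have "N_proj t u = \<rho> v" unfolding \<rho>_def N_proj_eq_iff by simp
      then show ?thesis by simp
    qed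
    then show "carrier (N_mod t :: 'k N_module) = range \<rho>"
      unfolding N(1) by (auto simp: \<rho>_def)
    show "\<zero>\<^bsub>(N_mod t :: 'k N_module)\<^esub> = \<rho> 0"
      unfolding N(2) \<rho>_def \<psi>0 by (simp add: N_proj_eq_iff)
    show "\<rho> v \<oplus>\<^bsub>N_mod t\<^esub> \<rho> w = \<rho> (v + w)" for v w
      unfolding \<rho>_def N(3) \<psi> by (simp add: N_proj_eq_iff)
    show "r \<odot>\<^bsub>N_mod t\<^esub> \<rho> v = \<rho> (fscale r v)" for r v
      unfolding \<rho>_def N(4) \<psi> by (simp add: N_proj_eq_iff)
  qed
  have "module_isomorphic Lam (quotient_module (N_mod b) U) (N_mod t :: 'k N_module)"
  proof (rule module_isomorphicI[OF 1 3])
    fix v w :: "nat \<Rightarrow> 'k fps"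
    have "(\<forall>i<s. fps_X ^ c i dvd \<psi> (v - w) i) \<longleftrightarrow> (\<forall>i\<in>A. fps_X ^ c i dvd \<psi> (v - w) i)"
      by (auto simp: A_def) (metis gr0I one_dvd power_0)
    also have "\<dots> \<longleftrightarrow> (\<forall>k<length t. fps_X ^ c (\<tau> k) dvd \<psi> (v - w) (\<tau> k))"
      using \<tau>(1) by (auto simp: bij_betw_def)
    also have "\<dots> \<longleftrightarrow> \<rho> v = \<rho> w"
      unfolding \<rho>_def N_proj_eq_iff \<psi>d using \<tau>(2) by auto
    finally show "U +>\<^bsub>N_mod b\<^esub> N_proj b v = U +>\<^bsub>N_mod b\<^esub> N_proj b w \<longleftrightarrow> \<rho> v = \<rho> w"
      unfolding 2 by (simp add: ker)
  qed
  with t(1) show ?thesis unfolding has_type_def by simp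
qed

section \<open>Embeddings given on representatives\<close>

definition N_map ::
  "nat list \<Rightarrow> nat list \<Rightarrow> ((nat \<Rightarrow> 'k::field fps) \<Rightarrow> nat \<Rightarrow> 'k fps) \<Rightarrow> 'k N_map" where
  "N_map a b F = descend (N_proj a) (\<lambda>v. N_proj b (F v))"

text \<open>\<open>wd\<close> sends relations to relations, which makes \<open>N_map\<close> well
  defined.\<close>

locale N_linear =
  fixes a b :: "nat list" and F :: "(nat \<Rightarrow> 'k::field fps) \<Rightarrow> nat \<Rightarrow> 'k fps"
  assumes add: "F (v + w) = F v + F w"
    and scale: "F (fscale r v) = fscale r (F v)"
    and wd: "\<forall>r<length a. fps_X ^ (a ! r) dvd v r \<Longrightarrow> i < length b \<Longrightarrow> fps_X ^ (b ! i) dvd F v i"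
begin

lemma diff: "F (v - w) = F v - F w"
proof -
  have 0: "F 0 = 0" using add[of 0 0] by simp
  have "F (- w) = - F w" using add[of w "- w"] 0 by (simp add: eq_neg_iff_add_eq_0 add.commute)
  then show ?thesis using add[of v "- w"] by simp
qed

lemma N_proj_wd: "N_proj a v = N_proj a w \<Longrightarrow> N_proj b (F v) = N_proj b (F w)"
  unfolding N_proj_eq_iff using wd[of "v - w"] diff[of v w] by simp

lemma N_map_N_proj: "N_map a b F (N_proj a v) = N_proj b (F v)"
  unfolding N_map_def by (rule descend_apply) (rule N_proj_wd)

lemma N_map_hom: "N_map a b F \<in> module_homs Lam (N_mod a) (N_mod b)"
  unfolding N_map_def
  by (rule descend_hom[OF N_proj_linear_onto N_proj_linear_onto])
    (erule N_proj_wd, simp_all add: add scale)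

lemma N_map_Hom_k: "N_map a b F \<in> carrier (Hom_k a b)"
proof -
  have r: "linear_onto (\<lambda>r. fscale (fps_const r)) (N_proj c)
     (restrict_scalars fps_const (N_mod c :: 'k N_module))" for c
    using linear_ontoD[OF N_proj_linear_onto[of c, where ?'k = 'k]]
    by (simp add: linear_onto_def restrict_scalars_def)
  show ?thesis
    unfolding Hom_k_def N_map_def hom_module_def
    by (simp, rule descend_hom[OF r r]) (erule N_proj_wd, simp_all add: add scale)
qed

end

text \<open>By \<open>ker\<close>, the coordinates \<open>\<psi> j\<close> carry the j-th multiple
  of the image, together with the relations, to a lattice spanned by powers of X with exponents
  \<open>c j i\<close>; these are the parts of \<open>\<Gamma> j\<close>. Level 0 is the condition
  on the cokernel.\<close>

lemma V_tableauI:
  fixes F :: "(nat \<Rightarrow> 'k::field fps) \<Rightarrow> nat \<Rightarrow> 'k fps"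
  assumes F: "N_linear \<alpha> \<beta> F"
    and inj: "\<And>l r. \<forall>i<length \<beta>. fps_X ^ (\<beta> ! i) dvd F l i \<Longrightarrow> r < length \<alpha> \<Longrightarrow>
       fps_X ^ (\<alpha> ! r) dvd l r"
    and part: "\<And>j. partition (\<Gamma> j)"
    and types: "\<And>j. mset (\<Gamma> j) = {#h \<in># image_mset (c j) (mset_set {..<length \<beta>}). h \<noteq> 0#}"
    and \<psi>: "\<And>j v w. \<psi> j (v + w) = \<psi> j v + \<psi> j w" "\<And>j r v. \<psi> j (fscale r v) = fscale r (\<psi> j v)"
    and surj: "\<And>j w. \<exists>v. \<forall>i<length \<beta>. \<psi> j v i = w i"
    and ker: "\<And>j v. (\<exists>l. \<forall>i<length \<beta>. fps_X ^ (\<beta> ! i) dvd v i - fps_X ^ j * F l i) \<longleftrightarrow>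
       (\<forall>i<length \<beta>. fps_X ^ c j i dvd \<psi> j v i)"
  shows "N_map \<alpha> \<beta> F \<in> V_tableau \<alpha> \<beta> (\<Gamma> 0) \<Gamma>"
proof -
  interpret N_linear \<alpha> \<beta> F by (rule F)
  let ?f = "N_map \<alpha> \<beta> F" and ?A = "carrier (N_mod \<alpha> :: 'k N_module)"
  have A: "?A = range (N_proj \<alpha>)" by (rule linear_ontoD(1)[OF N_proj_linear_onto])
  have im: "(\<lambda>a. fps_X ^ j \<odot>\<^bsub>N_mod \<beta>\<^esub> a) ` (?f ` ?A) =
      range (\<lambda>l. N_proj \<beta> (fscale (fps_X ^ j) (F l)))" for j
    unfolding A by (simp add: image_image N_map_N_proj linear_ontoD(4)[OF N_proj_linear_onto])
  have type: "has_type (quotient_module (N_mod \<beta>) ((\<lambda>a. fps_X ^ j \<odot>\<^bsub>N_mod \<beta>\<^esub> a) ` (?f ` ?A))) (\<Gamma> j)"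
    for j
  proof (rule has_type_quotientI[OF _ _ \<psi> surj part types])
    show "(\<lambda>a. fps_X ^ j \<odot>\<^bsub>N_mod \<beta>\<^esub> a) ` (?f ` ?A) \<subseteq> carrier (N_mod \<beta>)"
      unfolding im unfolding linear_ontoD(1)[OF N_proj_linear_onto] by auto
    show "N_proj \<beta> v \<in> (\<lambda>a. fps_X ^ j \<odot>\<^bsub>N_mod \<beta>\<^esub> a) ` (?f ` ?A) \<longleftrightarrow>
        (\<forall>i<length \<beta>. fps_X ^ c j i dvd \<psi> j v i)" for v
      unfolding im image_iff ker[symmetric] by (simp add: N_proj_eq_iff)
  qed
  have 0: "(\<lambda>a. fps_X ^ 0 \<odot>\<^bsub>N_mod \<beta>\<^esub> a) ` (?f ` ?A) = ?f ` ?A"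
    unfolding im unfolding A by (simp add: image_image N_map_N_proj) (simp add: fscale_def)
  have "inj_on ?f ?A"
  proof (rule inj_onI)
    fix x y assume "x \<in> ?A" "y \<in> ?A" and eq: "?f x = ?f y"
    then obtain v w where vw: "x = N_proj \<alpha> v" "y = N_proj \<alpha> w" unfolding A by auto
    have "\<forall>i<length \<beta>. fps_X ^ (\<beta> ! i) dvd F (v - w) i"
      using eq unfolding vw N_map_N_proj N_proj_eq_iff by (simp add: diff)
    from inj[OF this] show "x = y" unfolding vw N_proj_eq_iff by simp
  qed
  then have "?f \<in> V_embeddings \<alpha> \<beta> (\<Gamma> 0)"
    unfolding V_embeddings_def using N_map_hom type[of 0] unfolding 0 has_type_def by simp
  then show ?thesis
    unfolding V_tableau_def embedding_has_tableau_def using type by simp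
qed

section \<open>Closures and lines\<close>

text \<open>The map \<open>N_map a b\<close> is affine along the line, so a linear functional
  becomes a polynomial of degree at most one in t; sums and products of polynomials are
  polynomials.\<close>

lemma polynomial_on_line:
  fixes F0 F1 :: "(nat \<Rightarrow> 'k::field fps) \<Rightarrow> nat \<Rightarrow> 'k fps"
  assumes F0: "N_linear a b F0" and F1: "N_linear a b F1"
    and "p \<in> polynomial_functions (Hom_k a b :: ('k, 'k N_map) module)"
  shows "\<exists>q. \<forall>t. p (N_map a b (\<lambda>v. F0 v + fscale (fps_const t) (F1 v))) = poly q t"
  using assms(3)
proof induction
  case (const c)
  show ?case by (rule exI[of _ "[:c:]"]) simp
next
  case (add p q)
  then obtain p' q' where "\<forall>t. p (N_map a b (\<lambda>v. F0 v + fscale (fps_const t) (F1 v))) = poly p' t"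
    "\<forall>t. q (N_map a b (\<lambda>v. F0 v + fscale (fps_const t) (F1 v))) = poly q' t" by blast
  then show ?case by (intro exI[of _ "p' + q'"]) (simp only: poly_add simp_thms)
next
  case (mult p q)
  then obtain p' q' where "\<forall>t. p (N_map a b (\<lambda>v. F0 v + fscale (fps_const t) (F1 v))) = poly p' t"
    "\<forall>t. q (N_map a b (\<lambda>v. F0 v + fscale (fps_const t) (F1 v))) = poly q' t" by blast
  then show ?case by (intro exI[of _ "p' * q'"]) (simp only: poly_mult simp_thms)
next
  case (linear l)
  let ?V = "Hom_k a b :: ('k, 'k N_map) module"
  have l: "l (x \<oplus>\<^bsub>?V\<^esub> y) = l x + l y" "l (t \<odot>\<^bsub>?V\<^esub> x) = t * l x"
    if "x \<in> carrier ?V" "y \<in> carrier ?V" for x y t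
    using linear that by (auto simp: module_homs_def regular_module_def)
  interpret F0: N_linear a b F0 by (rule F0)
  interpret F1: N_linear a b F1 by (rule F1)
  have tF: "N_linear a b (\<lambda>v. fscale (fps_const t) (F1 v))" for t
    by unfold_locales (auto simp: F1.add F1.scale F1.wd fun_eq_iff algebra_simps)
  have sF: "N_linear a b (\<lambda>v. F0 v + fscale (fps_const t) (F1 v))" for t
    by unfold_locales
      (auto simp: F1.add F1.scale F1.wd F0.add F0.scale F0.wd fun_eq_iff algebra_simps)
  note N = linear_ontoD[OF N_proj_linear_onto]
  have 1: "N_map a b (\<lambda>v. fscale (fps_const t) (F1 v)) = t \<odot>\<^bsub>?V\<^esub> N_map a b F1" for t
  proof
    fix x
    show "N_map a b (\<lambda>v. fscale (fps_const t) (F1 v)) x = (t \<odot>\<^bsub>?V\<^esub> N_map a b F1) x"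
    proof (cases "x \<in> range (N_proj a)")
      case True
      then obtain v where "x = N_proj a v" by auto
      then show ?thesis
        by (simp add: N_linear.N_map_N_proj[OF tF] F1.N_map_N_proj Hom_k_def hom_module_def
            restrict_scalars_def N)
    next
      case False
      then show ?thesis by (simp add: N_map_def descend_def Hom_k_def hom_module_def restrict_scalars_def N)
    qed
  qed
  have 2: "N_map a b (\<lambda>v. F0 v + fscale (fps_const t) (F1 v)) =
      N_map a b F0 \<oplus>\<^bsub>?V\<^esub> N_map a b (\<lambda>v. fscale (fps_const t) (F1 v))" for t
  proof
    fix x
    show "N_map a b (\<lambda>v. F0 v + fscale (fps_const t) (F1 v)) x =
      (N_map a b F0 \<oplus>\<^bsub>?V\<^esub> N_map a b (\<lambda>v. fscale (fps_const t) (F1 v))) x"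
    proof (cases "x \<in> range (N_proj a)")
      case True
      then obtain v where "x = N_proj a v" by auto
      then show ?thesis
        by (simp add: N_linear.N_map_N_proj[OF tF] N_linear.N_map_N_proj[OF sF] F0.N_map_N_proj
            Hom_k_def hom_module_def restrict_scalars_def N)
    next
      case False
      then show ?thesis by (simp add: N_map_def descend_def Hom_k_def hom_module_def restrict_scalars_def N)
    qed
  qed
  have "l (N_map a b (\<lambda>v. F0 v + fscale (fps_const t) (F1 v))) =
      poly [:l (N_map a b F0), l (N_map a b F1):] t" for t
    unfolding 2 l(1)[OF F0.N_map_Hom_k N_linear.N_map_Hom_k[OF tF]]
    unfolding 1 l(2)[OF F1.N_map_Hom_k F1.N_map_Hom_k] by simp
  then show ?case by blast
qed

lemma closure_of_line:
  fixes F0 F1 :: "(nat \<Rightarrow> 'k::field fps) \<Rightarrow> nat \<Rightarrow> 'k fps"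
  assumes inf: "infinite (UNIV :: 'k set)"
    and F0: "N_linear a b F0" and F1: "N_linear a b F1"
    and S: "\<And>t. t \<noteq> 0 \<Longrightarrow> N_map a b (\<lambda>v. F0 v + fscale (fps_const t) (F1 v)) \<in> S"
  shows "N_map a b F0 \<in> Abstract_Topology.closure_of (zariski_topology (Hom_k a b)) S"
  unfolding in_closure_of topspace_zariski_topology
proof (intro conjI allI impI)
  show 0: "N_map a b F0 \<in> carrier (Hom_k a b)" by (rule N_linear.N_map_Hom_k[OF F0])
  fix U :: "'k N_map set"
  assume "N_map a b F0 \<in> U \<and> openin (zariski_topology (Hom_k a b)) U"
  then obtain p where p: "p \<in> polynomial_functions (Hom_k a b)" "p (N_map a b F0) \<noteq> 0"
    and pU: "\<And>w. w \<in> carrier (Hom_k a b) \<Longrightarrow> p w \<noteq> 0 \<Longrightarrow> w \<in> U"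
    unfolding openin_zariski_topology zariski_open_iff by blast
  define D where "D t = N_map a b (\<lambda>v. F0 v + fscale (fps_const t) (F1 v))" for t
  have D: "D t \<in> carrier (Hom_k a b)" for t
    unfolding D_def
  proof (rule N_linear.N_map_Hom_k)
    interpret F0: N_linear a b F0 by (rule F0)
    interpret F1: N_linear a b F1 by (rule F1)
    show "N_linear a b (\<lambda>v. F0 v + fscale (fps_const t) (F1 v))"
    by unfold_locales
      (auto simp: F1.add F1.scale F1.wd F0.add F0.scale F0.wd fun_eq_iff algebra_simps)
  qed
  have D0: "D 0 = N_map a b F0" by (simp add: D_def plus_fun_def fscale_def)
  obtain q where q: "\<And>t. p (D t) = poly q t"
    using polynomial_on_line[OF F0 F1 p(1)] unfolding D_def by blast
  have "q \<noteq> 0" using p(2) q[of 0] D0 by auto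
  \<comment> \<open>Besides the roots, 0 must be avoided, since membership in \<open>S\<close> is
    known only for nonzero t.\<close>
  then have "finite (insert 0 {t. poly q t = 0})" by (simp add: poly_roots_finite)
  then obtain t where "t \<notin> insert 0 {t. poly q t = 0}" using inf by (metis ex_new_if_finite)
  then have "t \<noteq> 0" "p (D t) \<noteq> 0" using q by auto
  then show "\<exists>y. y \<in> S \<and> y \<in> U" using pU[OF D] S[of t] unfolding D_def by blast
qed

section \<open>Embeddings given by chains of columns\<close>

text \<open>Well-founded recursion along \<open>\<mu>\<close>. It serves to invert unitriangular
  coordinate changes and to define chain labels recursively.\<close>

lemma triangular_fixpoint:
  fixes \<mu> :: "'i \<Rightarrow> nat"
  assumes "\<And>i V W. (\<And>l. \<mu> l < \<mu> i \<Longrightarrow> V l = W l) \<Longrightarrow> H V i = H W i"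
  shows "\<exists>V. \<forall>i. V i = H V i"
proof -
  have "adm_wf (measure \<mu>) H"
    unfolding adm_wf_def by (intro allI impI, rule assms) simp
  then have "wfrec (measure \<mu>) H = H (wfrec (measure \<mu>) H)"
    by (intro wfrec_fixpoint) simp_all
  then show ?thesis by metis
qed

lemma fps_X_power_dvd_cancel:
  "fps_X ^ (a + b) dvd fps_X ^ a * (u :: 'k::field fps) \<longleftrightarrow> fps_X ^ b dvd u"
  by (simp add: power_add)

lemma fps_X_power_dvd_mult:
  assumes "fps_X ^ b dvd (u :: 'k::field fps)" "n \<le> a + b"
  shows "fps_X ^ n dvd fps_X ^ a * u"
proof -
  have "fps_X ^ (a + b) dvd fps_X ^ a * u" using assms(1) by (simp add: power_add)
  with assms(2) show ?thesis by (rule power_le_dvd[rotated])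
qed

text \<open>
  Column \<open>i\<close> carries the entries \<open>e i, \<dots>, f i\<close>.  The columns of a chain carry consecutive intervals
  of entries, and \<open>\<rho> i\<close> is the part of \<open>\<alpha>\<close> that belongs to the chain of \<open>i\<close>.  The generator of a
  chain has the component \<open>X ^ g i\<close> in its columns.
\<close>

locale chain_data =
  fixes \<alpha> \<beta> :: "nat list" and e f g \<rho> pred :: "nat \<Rightarrow> nat"
  assumes height: "i < length \<beta> \<Longrightarrow> \<beta> ! i = g i + f i"
    and pred: "i < length \<beta> \<Longrightarrow> 2 \<le> e i \<Longrightarrow> pred i < length \<beta>"
      "i < length \<beta> \<Longrightarrow> 2 \<le> e i \<Longrightarrow> f (pred i) = e i - 1"
      "i < length \<beta> \<Longrightarrow> 2 \<le> e i \<Longrightarrow> g (pred i) \<le> g i"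
      "i < length \<beta> \<Longrightarrow> 2 \<le> e i \<Longrightarrow> \<rho> (pred i) = \<rho> i"
    and e_le_f: "i < length \<beta> \<Longrightarrow> 2 \<le> e i \<Longrightarrow> e i \<le> f i"
    and disjoint: "i < length \<beta> \<Longrightarrow> l < length \<beta> \<Longrightarrow> \<rho> i = \<rho> l \<Longrightarrow> i \<noteq> l \<Longrightarrow> 1 \<le> f i \<Longrightarrow>
       f i \<le> f l \<Longrightarrow> f i < e l"
    and last: "r < length \<alpha> \<Longrightarrow> \<exists>i<length \<beta>. \<rho> i = r \<and> f i = \<alpha> ! r"
    and le_last: "i < length \<beta> \<Longrightarrow> 1 \<le> f i \<Longrightarrow> \<rho> i < length \<alpha> \<and> f i \<le> \<alpha> ! \<rho> i"
begin

text \<open>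
  Let \<open>w i\<close> be the sum of \<open>X ^ (g l - g i)\<close> times the \<open>l\<close>-th unit vector, where \<open>l\<close> runs through the
  part of the chain that starts with \<open>i\<close>.  The coordinate of \<open>V\<close> at \<open>w i\<close> involves only \<open>V i\<close> and
  \<open>V (pred i)\<close>.
\<close>

definition clean :: "nat \<Rightarrow> (nat \<Rightarrow> 'k::field fps) \<Rightarrow> nat \<Rightarrow> bool" where
  "clean j V i \<longleftrightarrow> (if j + 1 < e i
     then fps_X ^ (g i + e i - 1) dvd V i - fps_X ^ (g i - g (pred i)) * V (pred i)
     else fps_X ^ (g i + j) dvd V i)"

text \<open>Going up the chain, each \<open>V i\<close> is divisible by
  \<open>X ^ (g i + j)\<close>, and the quotients \<open>L i\<close> agree modulo
  \<open>X ^ (f i - j)\<close> with those of all later columns. So the quotient at the column with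
  the largest \<open>f\<close> serves for the whole chain.\<close>

lemma chain_solve:
  fixes V :: "nat \<Rightarrow> 'k::field fps"
  assumes cl: "\<And>i. i < length \<beta> \<Longrightarrow> \<rho> i = r \<Longrightarrow> j < f i \<Longrightarrow> clean j V i"
  shows "\<exists>u. \<forall>i<length \<beta>. \<rho> i = r \<longrightarrow> j < f i \<longrightarrow> fps_X ^ (\<beta> ! i) dvd V i - fps_X ^ (j + g i) * u"
proof -
  have p: "pred i < length \<beta>" "f (pred i) = e i - 1" "g (pred i) \<le> g i" "\<rho> (pred i) = \<rho> i" "e i \<le> f i"
    if "i < length \<beta>" "j + 1 < e i" for i
    using that pred e_le_f by auto
  have "fps_X ^ (g i + j) dvd V i" if "i < length \<beta>" "\<rho> i = r" "j < f i" for i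
    using that
  proof (induction "f i" arbitrary: i rule: less_induct)
    case less
    show ?case
    proof (cases "j + 1 < e i")
      case True
      note p = p[OF less.prems(1) True]
      have "fps_X ^ (g i + e i - 1) dvd V i - fps_X ^ (g i - g (pred i)) * V (pred i)"
        using cl[OF less.prems] True by (simp add: clean_def)
      then have 1: "fps_X ^ (g i + j) dvd V i - fps_X ^ (g i - g (pred i)) * V (pred i)"
        by (rule power_le_dvd) (use True in simp)
      have "fps_X ^ (g (pred i) + j) dvd V (pred i)"
        by (rule less.hyps) (use p True less.prems in simp_all)
      then have "fps_X ^ (g i + j) dvd fps_X ^ (g i - g (pred i)) * V (pred i)"
        by (rule fps_X_power_dvd_mult) (use p in simp)
      from dvd_add[OF 1 this] show ?thesis by simp
    next
      case False
      then show ?thesis using cl[OF less.prems] by (simp add: clean_def)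
    qed
  qed
  then have "\<forall>i. \<exists>L. i < length \<beta> \<and> \<rho> i = r \<and> j < f i \<longrightarrow> V i = fps_X ^ (g i + j) * L"
    unfolding dvd_def by metis
  then obtain L where L: "\<And>i. i < length \<beta> \<Longrightarrow> \<rho> i = r \<Longrightarrow> j < f i \<Longrightarrow> V i = fps_X ^ (g i + j) * L i"
    by metis
  have cong: "fps_X ^ (f i - j) dvd L i - L l"
    if "i < length \<beta>" "\<rho> i = r" "j < f i" "l < length \<beta>" "\<rho> l = r" "f i \<le> f l" for i l
    using that(4-)
  proof (induction "f l" arbitrary: l rule: less_induct)
    case less
    show ?case
    proof (cases "i = l")
      case False
      \<comment> \<open>Disjointness gives \<open>f i \<le> f (pred l)\<close>, so the descent from
        \<open>l\<close> along \<open>pred\<close> cannot pass below \<open>i\<close> without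
        reaching it.\<close>
      then have fe: "f i < e l" using disjoint[of i l] that less.prems by simp
      then have jl: "j + 1 < e l" using that by simp
      note p = p[OF less.prems(1) jl]
      have 1: "fps_X ^ (f i - j) dvd L i - L (pred l)"
        by (rule less.hyps) (use p jl fe less.prems in simp_all)
      have jf: "j < f l" using less.prems that by simp
      have "fps_X ^ (g l + e l - 1) dvd V l - fps_X ^ (g l - g (pred l)) * V (pred l)"
        using cl[OF less.prems(1,2) jf] jl by (simp add: clean_def)
      also have "V l = fps_X ^ (g l + j) * L l"
        by (rule L[OF less.prems(1,2) jf])
      also have "V (pred l) = fps_X ^ (g (pred l) + j) * L (pred l)"
        by (rule L) (use p jl less.prems in simp_all)
      also have "fps_X ^ (g l + j) * L l - fps_X ^ (g l - g (pred l)) * (fps_X ^ (g (pred l) + j) * L (pred l)) =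
          fps_X ^ (g l + j) * (L l - L (pred l))"
        using p(3) by (simp add: right_diff_distrib mult.assoc[symmetric] power_add[symmetric])
      also have "g l + e l - 1 = (g l + j) + (e l - 1 - j)"
        using jl by simp
      finally have "fps_X ^ (e l - 1 - j) dvd L l - L (pred l)"
        by (simp only: fps_X_power_dvd_cancel)
      then have "fps_X ^ (f i - j) dvd L l - L (pred l)"
        by (rule power_le_dvd) (use fe in simp)
      from dvd_diff[OF 1 this] show ?thesis by simp
    qed simp
  qed
  show ?thesis
  proof (cases "\<exists>i<length \<beta>. \<rho> i = r \<and> j < f i")
    case True
    define A where "A = {i. i < length \<beta> \<and> \<rho> i = r \<and> j < f i}"
    have A: "finite A" "A \<noteq> {}" using True by (auto simp: A_def)
    have "Max (f ` A) \<in> f ` A" using A by simp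
    then obtain i0 where i0: "i0 \<in> A" "f i0 = Max (f ` A)" by (elim imageE) simp
    show ?thesis
    proof (intro exI[of _ "L i0"] allI impI)
      fix i assume i: "i < length \<beta>" "\<rho> i = r" "j < f i"
      then have "f i \<le> f i0" unfolding i0(2) using A by (intro Max_ge) (auto simp: A_def)
      then have "fps_X ^ (f i - j) dvd L i - L i0" using cong i i0(1) by (simp add: A_def)
      then have "fps_X ^ (\<beta> ! i) dvd fps_X ^ (g i + j) * (L i - L i0)"
        by (rule fps_X_power_dvd_mult) (use height[OF i(1)] i(3) in simp)
      then show "fps_X ^ (\<beta> ! i) dvd V i - fps_X ^ (j + g i) * L i0"
        using L[OF i] by (simp add: right_diff_distrib add.commute)
    qed
  qed auto
qed

end

text \<open>
  The generator of the chain \<open>\<rho> x\<close> has an extra component in column \<open>y\<close>, which lies in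
  another chain.  For \<open>c = 0\<close> the parameters \<open>x\<close>, \<open>y\<close> and \<open>\<delta>\<close> are immaterial.
\<close>

locale perturbed_chain_data = chain_data +
  fixes x y \<delta> :: nat and c :: "'k::field fps"
  assumes pert: "c \<noteq> 0 \<Longrightarrow> x < length \<beta>" "c \<noteq> 0 \<Longrightarrow> y < length \<beta>" "c \<noteq> 0 \<Longrightarrow> \<rho> x \<noteq> \<rho> y"
      "c \<noteq> 0 \<Longrightarrow> f y = f x + \<delta>" "c \<noteq> 0 \<Longrightarrow> e y = e x + \<delta>" "c \<noteq> 0 \<Longrightarrow> 1 \<le> f x"
      "c \<noteq> 0 \<Longrightarrow> 2 \<le> e x \<Longrightarrow> g (pred x) \<le> g y + \<delta>"
      "\<And>i. c \<noteq> 0 \<Longrightarrow> i < length \<beta> \<Longrightarrow> 2 \<le> e i \<Longrightarrow> pred i = y \<Longrightarrow> g x \<le> g i + \<delta>"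
begin

text \<open>\<open>u r\<close> is the coefficient of the generator of chain \<open>r\<close>. The
  exponent \<open>g y + \<delta>\<close> equals \<open>\<beta> ! y - f x\<close>, so that
  \<open>X ^ f x\<close> kills the extra component, just as it kills the component in column
  \<open>x\<close>.\<close>

definition generators :: "(nat \<Rightarrow> 'k fps) \<Rightarrow> nat \<Rightarrow> 'k fps" where
  "generators u = (\<lambda>i. fps_X ^ g i * u (\<rho> i) +
     (if i = y then c * fps_X ^ (g y + \<delta>) * u (\<rho> x) else 0))"

text \<open>This is the part that column \<open>i\<close> contributes to \<open>\<Gamma> j\<close>,
  expressed through \<open>g\<close>; see \<open>column_part_level_height\<close>.\<close>

definition level_height :: "nat \<Rightarrow> nat \<Rightarrow> nat" where
  "level_height j i = (if f i \<le> j then \<beta> ! i else if j + 1 < e i then g i + e i - 1 else g i + j)"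

text \<open>
  The last two terms compensate the extra component in column \<open>y\<close>.  They are chosen such that
  \<open>coords j\<close> is unitriangular and sends the lattice generated by \<open>X ^ j * generators\<close> and the
  relations \<open>X ^ (\<beta> ! i)\<close> to a lattice generated by powers of \<open>X\<close> in each coordinate.
\<close>

definition coords :: "nat \<Rightarrow> (nat \<Rightarrow> 'k fps) \<Rightarrow> nat \<Rightarrow> 'k fps" where
  "coords j V = (\<lambda>i. V i
     - (if j < f i \<and> j + 1 < e i then fps_X ^ (g i - g (pred i)) * V (pred i) else 0)
     - (if j < f x \<and> i = y \<and> j + 1 < e x then c * fps_X ^ (g y + \<delta> - g (pred x)) * V (pred x) else 0)
     + (if j < f x \<and> 2 \<le> e i \<and> pred i = y then c * fps_X ^ (g i + \<delta> - g x) * V x else 0))"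

lemma coords_linear:
  "coords j (V + W) = coords j V + coords j W"
  "coords j (fscale r V) = fscale r (coords j V)"
proof -
  have alt: "coords j V i = V i
     - (if j < f i \<and> j + 1 < e i then fps_X ^ (g i - g (pred i)) else 0) * V (pred i)
     - (if j < f x \<and> i = y \<and> j + 1 < e x then c * fps_X ^ (g y + \<delta> - g (pred x)) else 0) * V (pred x)
     + (if j < f x \<and> 2 \<le> e i \<and> pred i = y then c * fps_X ^ (g i + \<delta> - g x) else 0) * V x" for V i
    by (simp only: coords_def if_distribR mult_zero_left if_distrib[where f = "\<lambda>z. z * _"])
  show "coords j (V + W) = coords j V + coords j W"
    by (rule ext) (simp only: alt plus_fun_apply algebra_simps)
  show "coords j (fscale r V) = fscale r (coords j V)"
    by (rule ext) (simp only: alt fscale_apply algebra_simps)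
qed

lemma pred_eq_y:
  assumes "c \<noteq> 0" "i < length \<beta>" "2 \<le> e i" "pred i = y"
  shows "e i = f x + \<delta> + 1" "f x < f i" "i \<noteq> y" "\<rho> i = \<rho> y" "\<rho> i \<noteq> \<rho> x"
  using pred(2,4)[OF assms(2,3)] e_le_f[OF assms(2,3)] pert(3,4)[OF assms(1)] assms(3,4) by auto

lemma pred_x:
  assumes "c \<noteq> 0" "2 \<le> e x"
  shows "pred x < length \<beta>" "f (pred x) + 1 = e x" "\<rho> (pred x) = \<rho> x" "pred x \<noteq> y"
    "g (pred x) \<le> g y + \<delta>" "e x \<le> f x"
  using pred[OF pert(1)[OF assms(1)] assms(2)] pert(3)[OF assms(1)] pert(7)[OF assms] assms(2)
    e_le_f[OF pert(1)[OF assms(1)] assms(2)] by auto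

lemma e_le_f_x: "c \<noteq> 0 \<Longrightarrow> e x \<le> f x"
  using pert(1,6) e_le_f[of x] by (cases "2 \<le> e x") auto

text \<open>The correction terms at \<open>i\<close> only involve columns with smaller
  \<open>f\<close>: \<open>pred i\<close>, then \<open>pred x\<close> if \<open>i = y\<close>, and
  \<open>x\<close> if \<open>pred i = y\<close>. So the system is unitriangular with respect to
  \<open>f\<close>.\<close>

lemma coords_surj: "\<exists>V. \<forall>i<length \<beta>. coords j V i = w i"
proof -
  define H where "H V i = (if i < length \<beta> then w i - (coords j V i - V i) else w i)"
    for V :: "nat \<Rightarrow> 'k fps" and i
  have "\<exists>V. \<forall>i. V i = H V i"
  proof (rule triangular_fixpoint[of f H])
    fix i and V W :: "nat \<Rightarrow> 'k fps"
    assume eq: "\<And>l. f l < f i \<Longrightarrow> V l = W l"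
    have 1: "V (pred i) = W (pred i)" if "i < length \<beta>" "j + 1 < e i"
      using pred(2)[OF that(1)] e_le_f[OF that(1)] that(2) by (intro eq) auto
    have 2: "V (pred x) = W (pred x)" if "c \<noteq> 0" "i = y" "j + 1 < e x"
      using pred_x[OF that(1)] pert(4)[OF that(1)] that(2,3) by (intro eq) auto
    have 3: "V x = W x" if "c \<noteq> 0" "i < length \<beta>" "2 \<le> e i" "pred i = y"
      using pred_eq_y[OF that] by (intro eq) auto
    have 4: "(if j < f i \<and> j + 1 < e i then fps_X ^ (g i - g (pred i)) * V (pred i) else 0) =
        (if j < f i \<and> j + 1 < e i then fps_X ^ (g i - g (pred i)) * W (pred i) else 0)"
      if "i < length \<beta>" using 1[OF that] by simp
    have 5: "(if j < f x \<and> i = y \<and> j + 1 < e x then c * fps_X ^ (g y + \<delta> - g (pred x)) * V (pred x) else 0) =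
        (if j < f x \<and> i = y \<and> j + 1 < e x then c * fps_X ^ (g y + \<delta> - g (pred x)) * W (pred x) else 0)"
      using 2 by (cases "c = 0") simp_all
    have 6: "(if j < f x \<and> 2 \<le> e i \<and> pred i = y then c * fps_X ^ (g i + \<delta> - g x) * V x else 0) =
        (if j < f x \<and> 2 \<le> e i \<and> pred i = y then c * fps_X ^ (g i + \<delta> - g x) * W x else 0)"
      if "i < length \<beta>" using 3[OF _ that] by (cases "c = 0") simp_all
    show "H V i = H W i"
    proof (cases "i < length \<beta>")
      case True
      show ?thesis unfolding H_def coords_def 4[OF True] 5 6[OF True] by simp
    qed (simp add: H_def)
  qed
  then obtain V where V: "\<And>i. V i = H V i" by blast
  have "coords j V i = w i" if "i < length \<beta>" for i
    using V[of i] that by (simp add: H_def algebra_simps)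
  then show ?thesis by blast
qed

text \<open>In column \<open>y\<close> the extra component is already killed by
  \<open>X ^ f x\<close>, and \<open>f x\<close> is at most the part of \<alpha> that belongs to the
  chain of \<open>x\<close>.\<close>

lemma generators_wd:
  assumes u: "\<forall>r<length \<alpha>. fps_X ^ (\<alpha> ! r) dvd u r" and i: "i < length \<beta>"
  shows "fps_X ^ (\<beta> ! i) dvd generators u i"
proof -
  have 0: "fps_X ^ f l dvd u (\<rho> l)" if "l < length \<beta>" for l
  proof (cases "f l = 0")
    case False
    then have "\<rho> l < length \<alpha>" "f l \<le> \<alpha> ! \<rho> l" using le_last[OF that] by auto
    then show ?thesis using u power_le_dvd by blast
  qed simp
  have "fps_X ^ (\<beta> ! i) dvd fps_X ^ g i * u (\<rho> i)"
    by (rule fps_X_power_dvd_mult[OF 0[OF i]]) (simp add: height[OF i])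
  moreover have "fps_X ^ (\<beta> ! y) dvd c * (fps_X ^ (g y + \<delta>) * u (\<rho> x))"
  proof (cases "c = 0")
    case False
    note p = pert(1-5)[OF this]
    have "fps_X ^ (\<beta> ! y) dvd fps_X ^ (g y + \<delta>) * u (\<rho> x)"
      by (rule fps_X_power_dvd_mult[OF 0[OF p(1)]]) (simp add: height[OF p(2)] p(4))
    then show ?thesis by (rule dvd_mult)
  qed simp
  ultimately show ?thesis by (simp add: generators_def mult.assoc)
qed

text \<open>The last column of chain \<open>r\<close> detects \<open>u r\<close>. If that column is
  \<open>y\<close>, the extra component interferes; but the chain of \<open>x\<close> does not
  contain \<open>y\<close>, so \<open>u (\<rho> x)\<close> is treated first and the interference
  then vanishes modulo the relation.\<close>

lemma generators_inj:
  assumes G: "\<forall>i<length \<beta>. fps_X ^ (\<beta> ! i) dvd generators u i" and r: "r < length \<alpha>"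
  shows "fps_X ^ (\<alpha> ! r) dvd u r"
proof -
  have main: "fps_X ^ (\<alpha> ! r) dvd u r" if r: "r < length \<alpha>"
    and *: "\<And>i. i < length \<beta> \<Longrightarrow> i = y \<Longrightarrow> \<rho> i = r \<Longrightarrow> fps_X ^ (\<beta> ! y) dvd c * (fps_X ^ (g y + \<delta>) * u (\<rho> x))"
    for r
  proof -
    obtain i where i: "i < length \<beta>" "\<rho> i = r" "f i = \<alpha> ! r" using last[OF r] by blast
    have 1: "fps_X ^ (\<beta> ! i) dvd fps_X ^ g i * u r +
        (if i = y then c * (fps_X ^ (g y + \<delta>) * u (\<rho> x)) else 0)"
      using G[rule_format, OF i(1)] unfolding generators_def mult.assoc i(2) by simp
    have "fps_X ^ (\<beta> ! i) dvd (if i = y then c * (fps_X ^ (g y + \<delta>) * u (\<rho> x)) else 0)"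
      using *[OF i(1) _ i(2)] by auto
    from dvd_diff[OF 1 this] have "fps_X ^ (g i + f i) dvd fps_X ^ g i * u r"
      using height[OF i(1)] by simp
    then show ?thesis unfolding fps_X_power_dvd_cancel i(3) .
  qed
  show ?thesis
  proof (rule main[OF r])
    show "fps_X ^ (\<beta> ! y) dvd c * (fps_X ^ (g y + \<delta>) * u (\<rho> x))"
    proof (cases "c = 0")
      case False
      note p = pert(1-6)[OF this]
      have l: "\<rho> x < length \<alpha>" "f x \<le> \<alpha> ! \<rho> x" using le_last[OF p(1) p(6)] by auto
      have "fps_X ^ (\<alpha> ! \<rho> x) dvd u (\<rho> x)"
        by (rule main[OF l(1)]) (use p(3) in auto)
      then have "fps_X ^ (\<beta> ! y) dvd fps_X ^ (g y + \<delta>) * u (\<rho> x)"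
        by (rule fps_X_power_dvd_mult) (use height[OF p(2)] p(4) l(2) in simp)
      then show ?thesis by (rule dvd_mult)
    qed simp
  qed
qed

lemma dvd_multI:
  assumes "n \<le> a"
  shows "fps_X ^ n dvd c * fps_X ^ a * (u :: 'k fps)"
  by (intro dvd_mult2 dvd_mult le_imp_power_dvd assms)

text \<open>Relations go into the lattice, with exponents that match exactly: for instance
  \<open>g i - g (pred i) + \<beta> ! pred i = g i + e i - 1\<close>. For the two compensating terms
  this rests on \<open>e y = e x + \<delta>\<close> and \<open>f y = f x + \<delta>\<close>.\<close>

lemma coords_small:
  assumes A: "\<And>i. i < length \<beta> \<Longrightarrow> fps_X ^ (\<beta> ! i) dvd A i" and i: "i < length \<beta>"
  shows "fps_X ^ level_height j i dvd coords j A i"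
proof -
  have h: "level_height j i \<le> \<beta> ! i"
    using height[OF i] e_le_f[OF i] by (auto simp: level_height_def)
  have 1: "fps_X ^ level_height j i dvd A i"
    using A[OF i] h by (rule power_le_dvd)
  have 2: "fps_X ^ level_height j i dvd fps_X ^ (g i - g (pred i)) * A (pred i)"
    if "j < f i" "j + 1 < e i"
  proof -
    have "2 \<le> e i" using that by simp
    note p = pred[OF i this]
    show ?thesis
      by (rule fps_X_power_dvd_mult[OF A[OF p(1)]])
        (use that height[OF p(1)] p(2,3) in \<open>simp add: level_height_def\<close>)
  qed
  have 3: "fps_X ^ level_height j i dvd c * fps_X ^ (g y + \<delta> - g (pred x)) * A (pred x)"
    if "j < f x" "i = y" "j + 1 < e x"
  proof (cases "c = 0")
    case False
    have "2 \<le> e x" using that by simp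
    note p = pred_x[OF False this]
    have "fps_X ^ level_height j i dvd fps_X ^ (g y + \<delta> - g (pred x)) * A (pred x)"
      by (rule fps_X_power_dvd_mult[OF A[OF p(1)]])
        (use that height[OF p(1)] p(2,5) pert(4,5)[OF False] in \<open>simp add: level_height_def\<close>)
    then show ?thesis by (simp add: mult.assoc dvd_mult)
  qed simp
  have 4: "fps_X ^ level_height j i dvd c * fps_X ^ (g i + \<delta> - g x) * A x"
    if "j < f x" "2 \<le> e i" "pred i = y"
  proof (cases "c = 0")
    case False
    note p = pred_eq_y[OF False i that(2,3)]
    have "fps_X ^ level_height j i dvd fps_X ^ (g i + \<delta> - g x) * A x"
      by (rule fps_X_power_dvd_mult[OF A[OF pert(1)[OF False]]])
        (use that height[OF pert(1)[OF False]] p(1,2) pert(8)[OF False i that(2,3)]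
          in \<open>simp add: level_height_def\<close>)
    then show ?thesis by (simp add: mult.assoc dvd_mult)
  qed simp
  show ?thesis
    unfolding coords_def using 1 2 3 4 by (intro dvd_add dvd_diff) auto
qed

text \<open>Each term of the generators is cancelled by a correction in \<open>coords\<close>, or
  its exponent is at least the level height.\<close>

lemma coords_generators:
  assumes i: "i < length \<beta>"
  shows "fps_X ^ level_height j i dvd coords j (\<lambda>i. fps_X ^ j * generators u i) i"
proof -
  define W where "W = (\<lambda>i. fps_X ^ j * generators u i)"
  have W: "W l = fps_X ^ (j + g l) * u (\<rho> l) +
      (if l = y then c * fps_X ^ (j + g y + \<delta>) * u (\<rho> x) else 0)" for l
    by (simp add: W_def generators_def algebra_simps power_add)
  have merge: "fps_X ^ a * (fps_X ^ b * v) = fps_X ^ (a + b) * v" for a b and v :: "'k fps"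
    by (simp add: power_add mult.assoc)
  have "fps_X ^ level_height j i dvd coords j W i"
  proof (cases "f i \<le> j")
    case True
    have b: "\<beta> ! i \<le> j + g i" using height[OF i] True by simp
    have "coords j W i = W i"
      unfolding coords_def using True pred_eq_y[OF _ i] pert(4) by (cases "c = 0") auto
    moreover have "fps_X ^ (\<beta> ! i) dvd W i"
      unfolding W using b by (intro dvd_add) (auto intro: dvd_multI dvd_mult2 le_imp_power_dvd)
    ultimately show ?thesis using True by (simp add: level_height_def)
  next
    case False
    \<comment> \<open>Subtracting the multiple of \<open>W (pred i)\<close> removes the regular
      component of column \<open>i\<close>, but it carries the extra component of \<open>y\<close>
      over to the successor of \<open>y\<close>. This explains the last term of
      \<open>coords\<close>.\<close>
    have T1: "W i - (if j + 1 < e i then fps_X ^ (g i - g (pred i)) * W (pred i) else 0) =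
        (if j + 1 < e i then 0 else fps_X ^ (j + g i) * u (\<rho> i)) +
        (if i = y then c * fps_X ^ (j + g y + \<delta>) * u (\<rho> x) else 0) -
        (if j + 1 < e i \<and> pred i = y then c * fps_X ^ (j + g i + \<delta>) * u (\<rho> x) else 0)"
    proof (cases "j + 1 < e i")
      case True
      then have "2 \<le> e i" by simp
      note p = pred[OF i this]
      have "g i - g (pred i) + (j + g (pred i)) = j + g i"
        "g i - g (pred i) + (j + g (pred i) + \<delta>) = j + g i + \<delta>" using p(3) by simp_all
      then show ?thesis using True p(4)
        by (auto simp: W distrib_left merge mult.left_commute[of _ c] mult.assoc add_ac)
    qed (simp add: W)
    show ?thesis
    proof (cases "c = 0")
      case True
      have "coords j W i = (if j + 1 < e i then 0 else fps_X ^ (j + g i) * u (\<rho> i))"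
        unfolding coords_def using T1 True False by simp
      then show ?thesis using False by (simp add: level_height_def add.commute)
    next
      case c: False
      have T2: "c * fps_X ^ (g y + \<delta> - g (pred x)) * W (pred x) = c * fps_X ^ (j + g y + \<delta>) * u (\<rho> x)"
        if "2 \<le> e x"
      proof -
        note p = pred_x[OF c that]
        have "g y + \<delta> - g (pred x) + (j + g (pred x)) = j + g y + \<delta>" using p(5) by simp
        then show ?thesis using p(3,4) by (simp add: W merge mult.assoc)
      qed
      have T3: "c * fps_X ^ (g i + \<delta> - g x) * W x = c * fps_X ^ (j + g i + \<delta>) * u (\<rho> x)"
        if "2 \<le> e i" "pred i = y"
      proof -
        have "g i + \<delta> - g x + (j + g x) = j + g i + \<delta>" using pert(8)[OF c i that] by simp
        then show ?thesis using pert(3)[OF c] by (auto simp: W merge mult.assoc)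
      qed
      have "coords j W i =
        (if j + 1 < e i then 0 else fps_X ^ (j + g i) * u (\<rho> i)) +
        (if i = y \<and> \<not> (j < f x \<and> j + 1 < e x) then c * fps_X ^ (j + g y + \<delta>) * u (\<rho> x) else 0) -
        (if j + 1 < e i \<and> pred i = y \<and> \<not> j < f x then c * fps_X ^ (j + g i + \<delta>) * u (\<rho> x) else 0)"
      proof -
        have A: "(if j < f i \<and> j + 1 < e i then fps_X ^ (g i - g (pred i)) * W (pred i) else 0) =
            (if j + 1 < e i then fps_X ^ (g i - g (pred i)) * W (pred i) else 0)"
          using False by simp
        have B: "(if j < f x \<and> i = y \<and> j + 1 < e x then c * fps_X ^ (g y + \<delta> - g (pred x)) * W (pred x) else 0) =
            (if j < f x \<and> i = y \<and> j + 1 < e x then c * fps_X ^ (j + g y + \<delta>) * u (\<rho> x) else 0)"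
          using T2 by simp
        have C: "(if j < f x \<and> 2 \<le> e i \<and> pred i = y then c * fps_X ^ (g i + \<delta> - g x) * W x else 0) =
            (if j < f x \<and> j + 1 < e i \<and> pred i = y then c * fps_X ^ (j + g i + \<delta>) * u (\<rho> x) else 0)"
          using T3 pred_eq_y(1)[OF c i] by auto
        show ?thesis
          unfolding coords_def A T1 B C
          by (cases "j + 1 < e i"; cases "j < f x"; cases "i = y"; cases "pred i = y"; simp)
      qed
      moreover have "fps_X ^ level_height j i dvd
          (if j + 1 < e i then 0 else fps_X ^ (j + g i) * u (\<rho> i))"
        using False by (simp add: level_height_def add.commute)
      moreover have "fps_X ^ level_height j i dvd
        (if i = y \<and> \<not> (j < f x \<and> j + 1 < e x) then c * fps_X ^ (j + g y + \<delta>) * u (\<rho> x) else 0)"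
      proof -
        \<comment> \<open>Either \<open>e x \<le> j + 1\<close>, hence
          \<open>e y - 1 \<le> j + \<delta>\<close>, or \<open>f x \<le> j\<close>, hence
          \<open>f y \<le> j + \<delta>\<close>.\<close>
        have "level_height j i \<le> j + g y + \<delta>" if "i = y" "\<not> (j < f x \<and> j + 1 < e x)"
          using that False pert(4,5)[OF c] e_le_f_x[OF c] by (auto simp: level_height_def)
        then show ?thesis by (auto intro: dvd_multI)
      qed
      moreover have "fps_X ^ level_height j i dvd
        (if j + 1 < e i \<and> pred i = y \<and> \<not> j < f x then c * fps_X ^ (j + g i + \<delta>) * u (\<rho> x) else 0)"
      proof -
        have "level_height j i \<le> j + g i + \<delta>" if "j + 1 < e i" "pred i = y" "\<not> j < f x"
          using that False pred_eq_y(1)[OF c i] by (auto simp: level_height_def)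
        then show ?thesis by (auto intro: dvd_multI)
      qed
      ultimately show ?thesis by (simp add: dvd_add dvd_diff)
    qed
  qed
  then show ?thesis by (simp add: W_def)
qed

text \<open>From left to right both generating families of the lattice have been checked. For the
  converse, the coefficients are recovered chain by chain with \<open>chain_solve\<close>, whose
  hypothesis \<open>clean\<close> is what the divisibility of \<open>coords\<close> becomes once the
  extra component is removed.\<close>

lemma coords_dvd_iff:
  "(\<exists>u. \<forall>i<length \<beta>. fps_X ^ (\<beta> ! i) dvd V i - fps_X ^ j * generators u i) \<longleftrightarrow>
   (\<forall>i<length \<beta>. fps_X ^ level_height j i dvd coords j V i)"
proof (intro iffI allI impI)
  fix i assume i: "i < length \<beta>"
    and "\<exists>u. \<forall>i<length \<beta>. fps_X ^ (\<beta> ! i) dvd V i - fps_X ^ j * generators u i"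
  then obtain u where u: "\<And>i. i < length \<beta> \<Longrightarrow> fps_X ^ (\<beta> ! i) dvd V i - fps_X ^ j * generators u i"
    by blast
  have "(\<lambda>i. V i - fps_X ^ j * generators u i) + (\<lambda>i. fps_X ^ j * generators u i) = V"
    by (rule ext) simp
  then have "coords j V i = coords j (\<lambda>i. V i - fps_X ^ j * generators u i) i +
      coords j (\<lambda>i. fps_X ^ j * generators u i) i"
    using coords_linear(1)[of j "\<lambda>i. V i - fps_X ^ j * generators u i" "\<lambda>i. fps_X ^ j * generators u i"]
    by simp
  then show "fps_X ^ level_height j i dvd coords j V i"
    using coords_small[OF u i] coords_generators[OF i] by (simp add: dvd_add)
next
  assume D: "\<forall>i<length \<beta>. fps_X ^ level_height j i dvd coords j V i"
  \<comment> \<open>The chain of \<open>x\<close> does not meet the extra component, so its coefficient \<open>q\<close> can be found first.\<close>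
  have clQ: "clean j V i" if "i < length \<beta>" "\<rho> i = \<rho> x" "j < f i" for i
  proof -
    have "coords j V i = V i - (if j + 1 < e i then fps_X ^ (g i - g (pred i)) * V (pred i) else 0)"
      unfolding coords_def using that pred_eq_y[OF _ that(1)] pert(3) by (cases "c = 0") auto
    then show ?thesis using D that by (auto simp: clean_def level_height_def split: if_splits)
  qed
  obtain q where q: "\<And>i. i < length \<beta> \<Longrightarrow> \<rho> i = \<rho> x \<Longrightarrow> j < f i \<Longrightarrow>
      fps_X ^ (\<beta> ! i) dvd V i - fps_X ^ (j + g i) * q"
    using chain_solve[OF clQ] by blast
  \<comment> \<open>The extra component is now known from \<open>q\<close> and is subtracted from
    column \<open>y\<close>; what remains should come from an unperturbed direct sum.\<close>
  define V' where "V' i = V i - (if i = y then c * fps_X ^ (j + g y + \<delta>) * q else 0)" for i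
  have cl: "clean j V' i" if i: "i < length \<beta>" and j: "j < f i" for i
  proof (cases "c = 0")
    case True
    then have "V' = V" by (auto simp: V'_def fun_eq_iff)
    moreover have "coords j V i = V i - (if j + 1 < e i then fps_X ^ (g i - g (pred i)) * V (pred i) else 0)"
      unfolding coords_def using j True by simp
    ultimately show ?thesis using D i j by (auto simp: clean_def level_height_def split: if_splits)
  next
    case c: False
    note p = pert(1-6)[OF c]
    show ?thesis
    proof (cases "j + 1 < e i")
      case False
      have "coords j V i = V i"
        using False pred_eq_y[OF c i] p(5) j by (auto simp: coords_def)
      then have "fps_X ^ (g i + j) dvd V i" using D i j False by (auto simp: level_height_def)
      moreover have "fps_X ^ (g i + j) dvd (if i = y then c * fps_X ^ (j + g y + \<delta>) * q else 0)"
        by (auto intro: dvd_multI)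
      ultimately show ?thesis using False by (simp add: clean_def V'_def dvd_diff)
    next
      case True
      then have e2: "2 \<le> e i" by simp
      note pr = pred[OF i e2]
      let ?n = "g i + e i - 1"
      let ?R = "fps_X ^ (g i - g (pred i)) * V (pred i)"
      have D': "fps_X ^ ?n dvd coords j V i" using D i j True by (auto simp: level_height_def)
      consider "i = y" | "pred i = y" | "i \<noteq> y" "pred i \<noteq> y" by blast
      then have "fps_X ^ ?n dvd V' i - fps_X ^ (g i - g (pred i)) * V' (pred i)"
      proof cases
        case 1
        then have py: "pred i \<noteq> y" using pred_eq_y(3)[OF c i e2] by blast
        show ?thesis
        proof (cases "j < f x \<and> j + 1 < e x")
          case True
          then have ex: "2 \<le> e x" by simp
          note px = pred_x[OF c ex]
          \<comment> \<open>Up to a relation \<open>V (pred x)\<close> is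
            \<open>X ^ (j + g (pred x)) * q\<close>. This exchanges the compensating term of
            \<open>coords\<close> for the term subtracted in \<open>V'\<close>.\<close>
          have "fps_X ^ (\<beta> ! pred x) dvd V (pred x) - fps_X ^ (j + g (pred x)) * q"
            by (rule q) (use px True in simp_all)
          then have "fps_X ^ ?n dvd fps_X ^ (g y + \<delta> - g (pred x)) * (V (pred x) - fps_X ^ (j + g (pred x)) * q)"
            by (rule fps_X_power_dvd_mult) (use px height[OF px(1)] 1 p in simp)
          then have "fps_X ^ ?n dvd c * (fps_X ^ (g y + \<delta> - g (pred x)) * (V (pred x) - fps_X ^ (j + g (pred x)) * q))"
            by (rule dvd_mult)
          from dvd_add[OF D' this] show ?thesis
          proof (rule back_subst[of "\<lambda>z. fps_X ^ ?n dvd z"])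
            have "fps_X ^ (g y + \<delta> - g (pred x)) * (fps_X ^ (j + g (pred x)) * q) = fps_X ^ (j + g y + \<delta>) * q"
              using px(5) by (simp add: mult.assoc[symmetric] power_add[symmetric])
            then show "coords j V i + c * (fps_X ^ (g y + \<delta> - g (pred x)) * (V (pred x) - fps_X ^ (j + g (pred x)) * q))
              = V' i - fps_X ^ (g i - g (pred i)) * V' (pred i)"
              using 1 py True \<open>j + 1 < e i\<close> j by (simp add: coords_def V'_def right_diff_distrib mult.assoc)
          qed
        next
          case False
          have "fps_X ^ ?n dvd c * fps_X ^ (j + g y + \<delta>) * q"
            by (rule dvd_multI) (use False 1 p e_le_f_x[OF c] in auto)
          from dvd_diff[OF D' this] show ?thesis
          proof (rule back_subst[of "\<lambda>z. fps_X ^ ?n dvd z"])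
            show "coords j V i - c * fps_X ^ (j + g y + \<delta>) * q =
                V' i - fps_X ^ (g i - g (pred i)) * V' (pred i)"
              using 1 py False True j pred_eq_y(3)[OF c i e2] by (auto simp: coords_def V'_def)
          qed
        qed
      next
        case 2
        note py = pred_eq_y[OF c i e2 2]
        have m: "fps_X ^ (g i - g y) * (c * fps_X ^ (j + g y + \<delta>) * q) = c * fps_X ^ (j + g i + \<delta>) * q"
        proof -
          have "g i - g y + (j + g y + \<delta>) = j + g i + \<delta>" using pr(3) 2 by simp
          then have "fps_X ^ (g i - g y) * fps_X ^ (j + g y + \<delta>) = (fps_X :: 'k fps) ^ (j + g i + \<delta>)"
            by (metis power_add)
          moreover have "fps_X ^ (g i - g y) * (c * fps_X ^ (j + g y + \<delta>) * q) =
              c * (fps_X ^ (g i - g y) * fps_X ^ (j + g y + \<delta>)) * q" by (simp only: ac_simps)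
          ultimately show ?thesis by simp
        qed
        show ?thesis
        proof (cases "j < f x")
          case True
          have "fps_X ^ (\<beta> ! x) dvd V x - fps_X ^ (j + g x) * q"
            by (rule q) (use p True in simp_all)
          then have "fps_X ^ ?n dvd fps_X ^ (g i + \<delta> - g x) * (V x - fps_X ^ (j + g x) * q)"
            by (rule fps_X_power_dvd_mult) (use height[OF p(1)] py(1) pert(8)[OF c i e2 2] in simp)
          then have "fps_X ^ ?n dvd c * (fps_X ^ (g i + \<delta> - g x) * (V x - fps_X ^ (j + g x) * q))"
            by (rule dvd_mult)
          from dvd_diff[OF D' this] show ?thesis
          proof (rule back_subst[of "\<lambda>z. fps_X ^ ?n dvd z"])
            have E: "fps_X ^ (g i + \<delta> - g x) * (fps_X ^ (j + g x) * q) = fps_X ^ (j + g i + \<delta>) * q"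
              using pert(8)[OF c i e2 2] by (simp add: mult.assoc[symmetric] power_add[symmetric])
            have L: "coords j V i = V i - ?R + c * (fps_X ^ (g i + \<delta> - g x) * V x)"
              using 2 py(3) True \<open>j + 1 < e i\<close> e2 j by (simp add: coords_def mult.assoc)
            have R: "V' i - fps_X ^ (g i - g (pred i)) * V' (pred i) =
                V i - ?R + fps_X ^ (g i - g y) * (c * fps_X ^ (j + g y + \<delta>) * q)"
              using 2 py(3) by (simp add: V'_def right_diff_distrib)
            show "coords j V i - c * (fps_X ^ (g i + \<delta> - g x) * (V x - fps_X ^ (j + g x) * q))
              = V' i - fps_X ^ (g i - g (pred i)) * V' (pred i)"
              unfolding L R m right_diff_distrib E by (simp only: algebra_simps)
          qed
        next
          case False
          have "fps_X ^ ?n dvd c * fps_X ^ (j + g i + \<delta>) * q"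
            by (rule dvd_multI) (use False py in auto)
          from dvd_add[OF D' this] show ?thesis
          proof (rule back_subst[of "\<lambda>z. fps_X ^ ?n dvd z"])
            have L: "coords j V i = V i - ?R"
              using 2 py(3) False True j by (simp add: coords_def)
            have R: "V' i - fps_X ^ (g i - g (pred i)) * V' (pred i) =
                V i - ?R + fps_X ^ (g i - g y) * (c * fps_X ^ (j + g y + \<delta>) * q)"
              using 2 py(3) by (simp add: V'_def right_diff_distrib)
            show "coords j V i + c * fps_X ^ (j + g i + \<delta>) * q =
                V' i - fps_X ^ (g i - g (pred i)) * V' (pred i)"
              unfolding L R m ..
          qed
        qed
      next
        case 3
        then show ?thesis using D' True j by (simp add: coords_def V'_def)
      qed
      then show ?thesis using True by (simp add: clean_def)
    qed
  qed
  have "\<exists>u. \<forall>i<length \<beta>. \<rho> i = r \<longrightarrow> j < f i \<longrightarrow> fps_X ^ (\<beta> ! i) dvd V' i - fps_X ^ (j + g i) * u" for r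
    by (rule chain_solve) (rule cl)
  then obtain u where u: "\<And>i. i < length \<beta> \<Longrightarrow> j < f i \<Longrightarrow>
      fps_X ^ (\<beta> ! i) dvd V' i - fps_X ^ (j + g i) * u (\<rho> i)"
    by metis
  \<comment> \<open>Coefficients are determined only modulo powers of X, so
    \<open>u (\<rho> x)\<close> may differ from \<open>q\<close>; \<open>V'\<close> was formed with
    \<open>q\<close>.\<close>
  define u' where "u' = u(\<rho> x := q)"
  have "fps_X ^ (\<beta> ! i) dvd V i - fps_X ^ j * generators u' i" if i: "i < length \<beta>" for i
  proof (cases "j < f i")
    case True
    have "fps_X ^ (\<beta> ! i) dvd V' i - fps_X ^ (j + g i) * u' (\<rho> i)"
    proof (cases "\<rho> i = \<rho> x")
      case True
      then have "V' i = V i" unfolding V'_def using pert(3) by (cases "c = 0") auto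
      then show ?thesis using True q[OF i True \<open>j < f i\<close>] by (simp add: u'_def)
    qed (use u[OF i True] in \<open>simp add: u'_def\<close>)
    moreover have "V' i - fps_X ^ (j + g i) * u' (\<rho> i) = V i - fps_X ^ j * generators u' i"
      by (simp add: V'_def generators_def u'_def power_add algebra_simps)
    ultimately show ?thesis by simp
  next
    case False
    have "coords j V i = V i"
      unfolding coords_def using False pred_eq_y[OF _ i] pert(4) by (cases "c = 0") auto
    moreover have "fps_X ^ (\<beta> ! i) dvd coords j V i" using D i False by (auto simp: level_height_def)
    ultimately have "fps_X ^ (\<beta> ! i) dvd V i" by simp
    moreover have "fps_X ^ (\<beta> ! i) dvd fps_X ^ j * generators u' i"
    proof -
      have b: "\<beta> ! i \<le> j + g i" using height[OF i] False by simp
      have eq: "fps_X ^ j * generators u' i = fps_X ^ (j + g i) * u' (\<rho> i) +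
         (if i = y then c * fps_X ^ (j + g i + \<delta>) * u' (\<rho> x) else 0)"
        by (simp add: generators_def algebra_simps power_add)
      show ?thesis
        unfolding eq
      proof (rule dvd_add)
        show "fps_X ^ (\<beta> ! i) dvd fps_X ^ (j + g i) * u' (\<rho> i)"
          using b by (intro dvd_mult2 le_imp_power_dvd)
        show "fps_X ^ (\<beta> ! i) dvd (if i = y then c * fps_X ^ (j + g i + \<delta>) * u' (\<rho> x) else 0)"
        proof -
          have "fps_X ^ (\<beta> ! i) dvd c * fps_X ^ (j + g i + \<delta>) * u' (\<rho> x)"
            by (rule dvd_multI) (use b in simp)
          then show ?thesis by (metis dvd_0_right)
        qed
      qed
    qed
    ultimately show ?thesis by (rule dvd_diff)
  qed
  then show "\<exists>u. \<forall>i<length \<beta>. fps_X ^ (\<beta> ! i) dvd V i - fps_X ^ j * generators u i" by blast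
qed

end

section \<open>Littlewood-Richardson tableaux as unions of columns\<close>

text \<open>The induction adds elements in increasing order of \<open>p\<close>, so the new
  \<open>a\<close> has the largest value. It is matched with the largest admissible
  \<open>q\<close>, and the counting hypothesis survives for the rest.\<close>

lemma greedy_matching:
  fixes p :: "'a \<Rightarrow> nat" and q :: "'b \<Rightarrow> nat"
  assumes "finite S" "finite T"
    and "\<And>R. card {s \<in> S. p s \<le> R} \<le> card {t \<in> T. q t \<le> R}"
  shows "\<exists>\<sigma>. inj_on \<sigma> S \<and> \<sigma> ` S \<subseteq> T \<and> (\<forall>s\<in>S. q (\<sigma> s) \<le> p s)"
  using assms
proof (induction S arbitrary: T rule: finite_ranking_induct[where f = p])
  case empty
  then show ?case by simp
next
  case (insert a S)
  show ?case
  proof (cases "a \<in> S")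
    case True
    then show ?thesis using insert by (simp add: insert_absorb)
  next
    case a: False
    have all: "{s \<in> insert a S. p s \<le> R} = insert a S" if "p a \<le> R" for R
      using insert.hyps(2) that by force
    have big: "card S + 1 \<le> card {t \<in> T. q t \<le> R}" if "p a \<le> R" for R
      using insert.prems(2)[of R] all[OF that] a insert.hyps(1) by simp
    let ?Q = "{t \<in> T. q t \<le> p a}"
    have "card ?Q \<noteq> 0" using big[of "p a"] by simp
    then have Q: "finite ?Q" "?Q \<noteq> {}" by (metis card.infinite, metis card.empty)
    have "Max (q ` ?Q) \<in> q ` ?Q" using Q by (intro Max_in) auto
    then obtain t0 where t0: "t0 \<in> ?Q" "q t0 = Max (q ` ?Q)" by (elim imageE) metis
    have max: "q t \<le> q t0" if "t \<in> ?Q" for t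
      unfolding t0(2) using Q that by (intro Max_ge) auto
    have "card {s \<in> S. p s \<le> R} \<le> card {t \<in> T - {t0}. q t \<le> R}" for R
    proof (cases "q t0 \<le> R")
      case True
      have "card S + 1 \<le> card {t \<in> T. q t \<le> R}"
      proof (cases "p a \<le> R")
        case False
        \<comment> \<open>Here \<open>R\<close> lies between \<open>q t0\<close> and
          \<open>p a\<close>. By maximality of \<open>q t0\<close> every candidate for
          \<open>a\<close> is below \<open>R\<close>, and there are at least
          \<open>card S + 1\<close> of them.\<close>
        then have "?Q \<subseteq> {t \<in> T. q t \<le> R}" using max True by force
        then show ?thesis using big[of "p a"] card_mono[of "{t \<in> T. q t \<le> R}" ?Q] insert.prems(1) by simp
      qed (rule big)
      moreover have "{t \<in> T - {t0}. q t \<le> R} = {t \<in> T. q t \<le> R} - {t0}" by auto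
      moreover have "card {s \<in> S. p s \<le> R} \<le> card S" using insert.hyps(1) by (intro card_mono) auto
      ultimately show ?thesis using t0(1) True insert.prems(1) by (simp add: card_Diff_singleton)
    next
      case False
      then have "\<not> p a \<le> R" using t0(1) by simp
      then have "{s \<in> insert a S. p s \<le> R} = {s \<in> S. p s \<le> R}" by auto
      moreover have "{t \<in> T - {t0}. q t \<le> R} = {t \<in> T. q t \<le> R}" using False by auto
      ultimately show ?thesis using insert.prems(2)[of R] by simp
    qed
    then obtain \<sigma> where \<sigma>: "inj_on \<sigma> S" "\<sigma> ` S \<subseteq> T - {t0}" "\<forall>s\<in>S. q (\<sigma> s) \<le> p s"
      using insert.IH[of "T - {t0}"] insert.prems(1) by auto
    show ?thesis
      by (rule exI[of _ "\<sigma>(a := t0)"]) (use \<sigma> t0 a in \<open>auto simp: inj_on_def\<close>)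
  qed
qed

lemma bij_of_equal_fibres:
  assumes "finite A" "finite B" and eq: "\<And>k. card {i \<in> A. p i = k} = card {r \<in> B. q r = k}"
  shows "\<exists>h. bij_betw h A B \<and> (\<forall>i\<in>A. q (h i) = p i)"
proof -
  have "\<forall>k. \<exists>h. bij_betw h {i \<in> A. p i = k} {r \<in> B. q r = k}"
    using assms by (intro allI finite_same_card_bij) auto
  then obtain h where h: "\<And>k. bij_betw (h k) {i \<in> A. p i = k} {r \<in> B. q r = k}" by metis
  have im: "h (p i) i \<in> B \<and> q (h (p i) i) = p i" if "i \<in> A" for i
    using bij_betwE[OF h[of "p i"]] that by auto
  have "bij_betw (\<lambda>i. h (p i) i) A B"
    unfolding bij_betw_def
  proof (intro conjI inj_onI equalityI subsetI)
    fix i l assume il: "i \<in> A" "l \<in> A" "h (p i) i = h (p l) l"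
    then have "p i = p l" using im by metis
    then show "i = l" using il h[of "p i"] by (auto simp: bij_betw_def inj_on_def)
  next
    fix r assume "r \<in> B"
    then have "r \<in> h (q r) ` {i \<in> A. p i = q r}" using h[of "q r"] by (simp add: bij_betw_def)
    then obtain i where "i \<in> A" "p i = q r" "r = h (q r) i" by auto
    then show "r \<in> (\<lambda>i. h (p i) i) ` A" by (intro image_eqI[of _ _ i]) simp_all
  qed (use im in auto)
  then show ?thesis using im by blast
qed

section \<open>Tableaux presented by lists of columns\<close>

definition column_part :: "nat \<Rightarrow> nat \<Rightarrow> nat \<Rightarrow> nat \<Rightarrow> nat" where
  "column_part j e f n = n - card {k \<in> {e..f}. j < k}"

lemma column_part_eq: "column_part j e f n = n - (f + 1 - max (j + 1) e)"
proof -
  have "{k \<in> {e..f}. j < k} = {max (j + 1) e..f}" by auto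
  then show ?thesis by (simp add: column_part_def)
qed

text \<open>A column gains a box at step \<open>k\<close> iff it carries the entry \<open>k\<close>.
  As \<open>f\<close> stands in row \<open>n\<close>, the entry \<open>k\<close> stands in row
  \<open>n - f + k\<close>, rows being counted from 1.\<close>

lemma column_part_step:
  assumes "is_column e f n" "1 \<le> k"
  shows "column_part k e f n = column_part (k - 1) e f n + (if e \<le> k \<and> k \<le> f then 1 else 0)"
    and "e \<le> k \<and> k \<le> f \<Longrightarrow> column_part k e f n + f = n + k"
proof -
  have *: "column_part k e f n = column_part (k - 1) e f n + (if e \<le> k \<and> k \<le> f then 1 else 0) \<and>
      (e \<le> k \<and> k \<le> f \<longrightarrow> column_part k e f n + f = n + k)"
  proof (cases "1 \<le> e \<and> e \<le> f \<and> f - e + 1 \<le> n")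
    case True
    then show ?thesis using assms(2) unfolding column_part_eq by (simp add: max_def) linarith
  next
    case False
    then show ?thesis using assms unfolding column_part_eq is_column_def by (auto simp: max_def)
  qed
  then show "column_part k e f n = column_part (k - 1) e f n + (if e \<le> k \<and> k \<le> f then 1 else 0)"
    and "e \<le> k \<and> k \<le> f \<Longrightarrow> column_part k e f n + f = n + k" by simp_all
qed

text \<open>An indexed family in place of an inductive union makes it possible to permute columns
  and to exchange intervals between them. Zero heights are filtered out because partitions have no
  zero parts.\<close>

definition has_columns :: "nat \<Rightarrow> (nat \<Rightarrow> nat) \<Rightarrow> (nat \<Rightarrow> nat) \<Rightarrow> (nat \<Rightarrow> nat) \<Rightarrow> tableau \<Rightarrow> bool" where
  "has_columns s e f m \<Gamma> \<longleftrightarrow> (\<forall>i<s. is_column (e i) (f i) (m i)) \<and> (\<forall>j. mset (\<Gamma> j) =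
     {#h \<in># image_mset (\<lambda>i. column_part j (e i) (f i) (m i)) (mset_set {..<s}). h \<noteq> 0#})"

lemma has_columns_union:
  assumes "has_columns s e f m \<Delta>" "is_column e' f' n"
  shows "has_columns (Suc s) (e(s := e')) (f(s := f')) (m(s := n))
    (tableau_union \<Delta> (column_tableau e' f' n))"
  unfolding has_columns_def
proof (intro conjI allI impI)
  fix i assume "i < Suc s"
  then show "is_column ((e(s := e')) i) ((f(s := f')) i) ((m(s := n)) i)"
    using assms by (auto simp: has_columns_def less_Suc_eq)
next
  fix j
  have "image_mset (\<lambda>i. column_part j ((e(s := e')) i) ((f(s := f')) i) ((m(s := n)) i)) (mset_set {..<s})
     = image_mset (\<lambda>i. column_part j (e i) (f i) (m i)) (mset_set {..<s})"
    by (intro image_mset_cong) auto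
  then show "mset (tableau_union \<Delta> (column_tableau e' f' n) j) =
     {#h \<in># image_mset (\<lambda>i. column_part j ((e(s := e')) i) ((f(s := f')) i) ((m(s := n)) i))
        (mset_set {..<Suc s}). h \<noteq> 0#}"
    using assms(1)
    by (simp add: has_columns_def tableau_union_def partition_union_def column_tableau_def Let_def
        column_part_def lessThan_Suc)
qed

lemma union_of_columns_has_columns:
  assumes "union_of_columns \<Delta>"
  shows "\<exists>s e f m. has_columns s e f m \<Delta>"
  using assms
proof induction
  case empty
  show ?case by (rule exI[of _ 0]) (simp add: has_columns_def)
next
  case (column \<Delta> e f n)
  then show ?case using has_columns_union by blast
qed

lemma has_columns_reindex:
  assumes "has_columns s e f m \<Gamma>" "bij_betw \<tau> {..<t} {..<s}"
  shows "has_columns t (e \<circ> \<tau>) (f \<circ> \<tau>) (m \<circ> \<tau>) \<Gamma>"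
proof -
  have "image_mset (\<lambda>i. column_part j (e i) (f i) (m i)) (mset_set {..<s}) =
    image_mset (\<lambda>i. column_part j ((e \<circ> \<tau>) i) ((f \<circ> \<tau>) i) ((m \<circ> \<tau>) i)) (mset_set {..<t})" for j
  proof -
    have "mset_set {..<s} = image_mset \<tau> (mset_set {..<t})"
      using assms(2) by (simp add: bij_betw_def image_mset_mset_set)
    then show ?thesis by (simp add: image_mset.compositionality comp_def)
  qed
  then show ?thesis
    using assms bij_betwE[OF assms(2)] by (simp add: has_columns_def)
qed

lemma has_columns_limit:
  assumes "has_columns s e f m \<Gamma>" "LR_tableau \<alpha> \<beta> \<gamma> \<Gamma>"
  shows "mset \<beta> = image_mset m (mset_set {..<s})"
proof -
  obtain N where N: "\<And>i. i \<ge> N \<Longrightarrow> \<Gamma> i = \<beta>" using assms(2) by (auto simp: LR_tableau_def)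
  \<comment> \<open>A level beyond which \<Gamma> is constant and every column has all its
    entries.\<close>
  define j where "j = N + (\<Sum>i<s. f i)"
  have f: "f i \<le> j" if "i < s" for i
    using member_le_sum[of i "{..<s}" f] that by (simp add: j_def)
  have "\<Gamma> j = \<beta>" by (rule N) (simp add: j_def)
  then have "mset \<beta> = {#h \<in># image_mset (\<lambda>i. column_part j (e i) (f i) (m i)) (mset_set {..<s}). h \<noteq> 0#}"
    using assms(1) unfolding has_columns_def by metis
  also have "image_mset (\<lambda>i. column_part j (e i) (f i) (m i)) (mset_set {..<s}) =
      image_mset m (mset_set {..<s})"
    by (intro image_mset_cong) (simp add: column_part_eq le_diff_conv f max.coboundedI1)
  also have "{#h \<in># image_mset m (mset_set {..<s}). h \<noteq> 0#} = image_mset m (mset_set {..<s})"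
    using assms(1) by (intro filter_mset_eq_conv[THEN iffD2] conjI) (auto simp: has_columns_def is_column_def)
  finally show ?thesis .
qed

text \<open>The columns are renumbered so that column \<open>i\<close> has height
  \<open>\<beta> ! i\<close>; both tableaux then refer to the same summands of N_\<beta>. Here
  \<open>x\<close> is the taller column, which in \<Gamma> carries the smaller entries.\<close>

lemma increasing_box_move_columns:
  assumes LR: "LR_tableau \<alpha> \<beta> \<gamma> \<Gamma>" and move: "increasing_box_move \<Gamma> \<Gamma>'"
  obtains e f x y where "x < length \<beta>" "y < length \<beta>" "\<beta> ! y < \<beta> ! x" "1 \<le> e x" "e x \<le> f x"
    "e x < e y" "f x < f y" "f y - f x = e y - e x"
    "has_columns (length \<beta>) e f ((!) \<beta>) \<Gamma>"
    "has_columns (length \<beta>) (e \<circ> transpose x y) (f \<circ> transpose x y) ((!) \<beta>) \<Gamma>'"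
proof -
  obtain \<Delta> e0 f0 e1 f1 n0 n1 where \<Delta>: "union_of_columns \<Delta>"
    and h: "n0 > n1" "1 \<le> e0" "e0 \<le> f0" "e0 < e1" "f0 < f1" "f0 - e0 = f1 - e1"
    and cols: "is_column e0 f0 n0" "is_column e1 f1 n1" "is_column e1 f1 n0" "is_column e0 f0 n1"
    and \<Gamma>: "\<Gamma> = tableau_union (tableau_union \<Delta> (column_tableau e0 f0 n0)) (column_tableau e1 f1 n1)"
    and \<Gamma>': "\<Gamma>' = tableau_union (tableau_union \<Delta> (column_tableau e1 f1 n0)) (column_tableau e0 f0 n1)"
    using move unfolding increasing_box_move_def by blast
  obtain s e f m where sefm: "has_columns s e f m \<Delta>" using union_of_columns_has_columns[OF \<Delta>] by blast
  let ?t = "Suc (Suc s)"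
  define E where "E = e(s := e0, Suc s := e1)"
  define F where "F = f(s := f0, Suc s := f1)"
  define M where "M = m(s := n0, Suc s := n1)"
  have 1: "has_columns ?t E F M \<Gamma>"
    unfolding \<Gamma> E_def F_def M_def by (intro has_columns_union sefm cols)
  have "has_columns ?t (e(s := e1, Suc s := e0)) (f(s := f1, Suc s := f0)) M \<Gamma>'"
    unfolding \<Gamma>' M_def by (intro has_columns_union sefm cols)
  moreover have "e(s := e1, Suc s := e0) = E \<circ> transpose s (Suc s)"
    "f(s := f1, Suc s := f0) = F \<circ> transpose s (Suc s)"
    by (auto simp: E_def F_def fun_eq_iff transpose_def)
  ultimately have 2: "has_columns ?t (E \<circ> transpose s (Suc s)) (F \<circ> transpose s (Suc s)) M \<Gamma>'" by simp
  obtain \<tau> where \<tau>: "bij_betw \<tau> {..<length \<beta>} {..<?t}" "\<And>k. k < length \<beta> \<Longrightarrow> \<beta> ! k = M (\<tau> k)"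
    using mset_eq_image_obtain_bij[OF has_columns_limit[OF 1 LR]] by blast
  have "s \<in> \<tau> ` {..<length \<beta>}" "Suc s \<in> \<tau> ` {..<length \<beta>}"
    using \<tau>(1) by (simp_all add: bij_betw_def)
  then obtain x y where xy: "x < length \<beta>" "\<tau> x = s" "y < length \<beta>" "\<tau> y = Suc s" by auto
  have hc: "has_columns (length \<beta>) A B (M \<circ> \<tau>) G \<longleftrightarrow> has_columns (length \<beta>) A B ((!) \<beta>) G" for A B G
  proof -
    have "image_mset (\<lambda>i. column_part j (A i) (B i) ((M \<circ> \<tau>) i)) (mset_set {..<length \<beta>}) =
       image_mset (\<lambda>i. column_part j (A i) (B i) (\<beta> ! i)) (mset_set {..<length \<beta>})" for j
      using \<tau>(2) by (intro image_mset_cong) auto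
    then show ?thesis using \<tau>(2) by (simp add: has_columns_def)
  qed
  have "has_columns (length \<beta>) A B M' G \<longleftrightarrow> has_columns (length \<beta>) A' B' M' G"
    if "\<And>i. i < length \<beta> \<Longrightarrow> A i = A' i \<and> B i = B' i" for A B A' B' M' G
  proof -
    have "image_mset (\<lambda>i. column_part j (A i) (B i) (M' i)) (mset_set {..<length \<beta>}) =
       image_mset (\<lambda>i. column_part j (A' i) (B' i) (M' i)) (mset_set {..<length \<beta>})" for j
      using that by (intro image_mset_cong) auto
    then show ?thesis using that by (simp add: has_columns_def)
  qed
  note cong = this
  have inj: "\<tau> i = \<tau> l \<longleftrightarrow> i = l" if "i < length \<beta>" "l < length \<beta>" for i l
    using \<tau>(1) that by (auto simp: bij_betw_def inj_on_def)
  have "transpose s (Suc s) (\<tau> i) = \<tau> (transpose x y i)" if "i < length \<beta>" for i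
    using that xy inj[of i x] inj[of i y] by (auto simp: transpose_def)
  then have tr: "has_columns (length \<beta>) (E \<circ> transpose s (Suc s) \<circ> \<tau>) (F \<circ> transpose s (Suc s) \<circ> \<tau>) M' G \<longleftrightarrow>
      has_columns (length \<beta>) (E \<circ> \<tau> \<circ> transpose x y) (F \<circ> \<tau> \<circ> transpose x y) M' G" for M' G
    by (intro cong) simp
  show ?thesis
  proof (rule that[of x y "E \<circ> \<tau>" "F \<circ> \<tau>"])
    show "has_columns (length \<beta>) (E \<circ> \<tau>) (F \<circ> \<tau>) ((!) \<beta>) \<Gamma>"
      using has_columns_reindex[OF 1 \<tau>(1)] unfolding hc .
    show "has_columns (length \<beta>) (E \<circ> \<tau> \<circ> transpose x y) (F \<circ> \<tau> \<circ> transpose x y) ((!) \<beta>) \<Gamma>'"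
      using has_columns_reindex[OF 2 \<tau>(1)] unfolding hc tr .
    show "(F \<circ> \<tau>) y - (F \<circ> \<tau>) x = (E \<circ> \<tau>) y - (E \<circ> \<tau>) x"
      using h cols xy by (auto simp: E_def F_def is_column_def)
  qed (use h xy \<tau>(2) in \<open>auto simp: E_def F_def M_def\<close>)
qed

section \<open>The lattice condition in terms of rows\<close>

lemma card_young_diagram_rows:
  "finite {p \<in> young_diagram b. fst p < R}"
  "card {p \<in> young_diagram b. fst p < R} = sum_mset (image_mset (min R) (mset b))"
proof -
  have eq: "{p \<in> young_diagram b. fst p < R} = prod.swap ` (SIGMA c:{..<length b}. {..<min R (b ! c)})"
    by (auto simp: young_diagram_def image_iff)
  show "finite {p \<in> young_diagram b. fst p < R}" unfolding eq by simp
  have "card {p \<in> young_diagram b. fst p < R} = (\<Sum>c<length b. min R (b ! c))"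
    unfolding eq by (subst card_image) (auto simp: inj_on_def)
  also have "\<dots> = sum_list (map (min R) b)"
    by (simp add: sum_list_sum_nth atLeast0LessThan)
  finally show "card {p \<in> young_diagram b. fst p < R} = sum_mset (image_mset (min R) (mset b))"
    by (simp flip: sum_mset_sum_list)
qed

text \<open>Column \<open>i\<close> has its entry \<open>k\<close> in row
  \<open>m i - f i + k\<close>, and \<open>min R\<close> of its part grows at step \<open>k\<close>
  exactly if this row is among the first \<open>R\<close>. The sum of these minima counts boxes of
  the union.\<close>

lemma card_entry_boxes_rows:
  assumes C: "has_columns s e f m \<Gamma>" and T: "is_tableau \<Gamma>" and k: "1 \<le> k"
  shows "card {p \<in> entry_boxes \<Gamma> k. fst p < R} = card {i. i < s \<and> e i \<le> k \<and> k \<le> f i \<and> m i + k \<le> f i + R}"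
proof -
  have Y: "card {p \<in> young_diagram (\<Gamma> j). fst p < R} = (\<Sum>i<s. min R (column_part j (e i) (f i) (m i)))" for j
  proof -
    have "sum_mset (image_mset (min R) {#h \<in># M. h \<noteq> 0#}) = sum_mset (image_mset (min R) M)"
      for M :: "nat multiset"
      by (induction M) auto
    then show ?thesis
      using C by (simp add: card_young_diagram_rows(2) has_columns_def image_mset.compositionality comp_def
          sum_unfold_sum_mset)
  qed
  have step: "min R (column_part k (e i) (f i) (m i)) = min R (column_part (k - 1) (e i) (f i) (m i)) +
      (if e i \<le> k \<and> k \<le> f i \<and> m i + k \<le> f i + R then 1 else 0)" if "i < s" for i
  proof -
    have "is_column (e i) (f i) (m i)" using C that by (simp add: has_columns_def)
    from column_part_step[OF this k] show ?thesis
      by (auto simp: min_def)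
  qed
  have "young_diagram (\<Gamma> (k - 1)) \<subseteq> young_diagram (\<Gamma> (Suc (k - 1)))"
    using T by (simp add: is_tableau_def)
  then have sub: "{p \<in> young_diagram (\<Gamma> (k - 1)). fst p < R} \<subseteq> {p \<in> young_diagram (\<Gamma> k). fst p < R}"
    using k by auto
  have "{p \<in> entry_boxes \<Gamma> k. fst p < R} =
      {p \<in> young_diagram (\<Gamma> k). fst p < R} - {p \<in> young_diagram (\<Gamma> (k - 1)). fst p < R}"
    by (auto simp: entry_boxes_def)
  then have "card {p \<in> entry_boxes \<Gamma> k. fst p < R} =
      (\<Sum>i<s. min R (column_part k (e i) (f i) (m i))) - (\<Sum>i<s. min R (column_part (k - 1) (e i) (f i) (m i)))"
    using card_Diff_subset[OF card_young_diagram_rows(1) sub] by (simp add: Y)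
  also have "(\<Sum>i<s. min R (column_part k (e i) (f i) (m i))) =
     (\<Sum>i<s. min R (column_part (k - 1) (e i) (f i) (m i)) +
      (if e i \<le> k \<and> k \<le> f i \<and> m i + k \<le> f i + R then 1 else 0))"
    by (intro sum.cong refl step) simp
  also have "\<dots> = (\<Sum>i<s. min R (column_part (k - 1) (e i) (f i) (m i))) +
      card {i. i < s \<and> e i \<le> k \<and> k \<le> f i \<and> m i + k \<le> f i + R}"
  proof -
    have "{i \<in> {..<s}. e i \<le> k \<and> k \<le> f i \<and> m i + k \<le> f i + R} =
      {i. i < s \<and> e i \<le> k \<and> k \<le> f i \<and> m i + k \<le> f i + R}" by auto
    then show ?thesis
      using sum.inter_filter[of "{..<s}" "\<lambda>_. 1::nat" "\<lambda>i. e i \<le> k \<and> k \<le> f i \<and> m i + k \<le> f i + R"]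
      by (simp add: sum.distrib)
  qed
  finally show ?thesis by simp
qed

lemma young_diagram_corner:
  assumes "partition b" "(r', c') \<in> young_diagram b" "r \<le> r'" "c \<le> c'"
  shows "(r, c) \<in> young_diagram b"
proof -
  have "b ! c' \<le> b ! c"
    using assms by (cases "c = c'") (auto simp: partition_def young_diagram_def sorted_wrt_iff_nth_less)
  then show ?thesis using assms by (auto simp: young_diagram_def)
qed

lemma finite_entry_boxes: "finite (entry_boxes \<Gamma> k)"
proof -
  have "entry_boxes \<Gamma> k \<subseteq> {p \<in> young_diagram (\<Gamma> k). fst p < Suc (sum_list (\<Gamma> k))}"
    using elem_le_sum_list[of _ "\<Gamma> k"] by (force simp: entry_boxes_def young_diagram_def)
  then show ?thesis using card_young_diagram_rows(1) finite_subset by blast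
qed

lemma LR_content:
  assumes LR: "LR_tableau \<alpha> \<beta> \<gamma> \<Gamma>" and C: "has_columns s e f m \<Gamma>" and k: "1 \<le> k"
  shows "card {i. i < s \<and> e i \<le> k \<and> k \<le> f i} = conjugate_part \<alpha> k"
proof -
  \<comment> \<open>So large that the restriction to the first \<open>R\<close> rows is void, for
    boxes as well as for columns.\<close>
  define R where "R = Suc (sum_list (\<Gamma> k)) + (\<Sum>i<s. m i) + k"
  have "p \<in> entry_boxes \<Gamma> k \<Longrightarrow> fst p < R" for p
    using elem_le_sum_list[of _ "\<Gamma> k"] by (force simp: entry_boxes_def young_diagram_def R_def)
  then have 1: "{p \<in> entry_boxes \<Gamma> k. fst p < R} = entry_boxes \<Gamma> k" by auto
  have "m i + k \<le> f i + R" if "i < s" for i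
    using member_le_sum[of i "{..<s}" m] that by (simp add: R_def)
  then have 2: "{i. i < s \<and> e i \<le> k \<and> k \<le> f i \<and> m i + k \<le> f i + R} = {i. i < s \<and> e i \<le> k \<and> k \<le> f i}"
    by auto
  have "is_tableau \<Gamma>" "card (entry_boxes \<Gamma> k) = conjugate_part \<alpha> k"
    using LR k by (auto simp: LR_tableau_def)
  then show ?thesis using card_entry_boxes_rows[OF C _ k, of R] unfolding 1 2 by simp
qed

lemma conjugate_part_antimono: "conjugate_part \<alpha> (Suc k) \<le> conjugate_part \<alpha> k"
  unfolding conjugate_part_def by (intro card_mono) auto

text \<open>Let \<open>c0\<close> be the leftmost column with an entry \<open>k + 1\<close> in the
  first \<open>R + 1\<close> rows. The lattice condition compares the entries in columns from
  \<open>c0\<close> on. Every \<open>k\<close> there lies above the row of a \<open>k + 1\<close> in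
  column \<open>c0\<close>; otherwise the position of that \<open>k + 1\<close> would already belong
  to \<open>\<Gamma> k\<close>.\<close>

lemma LR_rows_entry_boxes:
  assumes LR: "LR_tableau \<alpha> \<beta> \<gamma> \<Gamma>" and k: "1 \<le> k"
  shows "card {p \<in> entry_boxes \<Gamma> (k + 1). fst p < R + 1} \<le> card {p \<in> entry_boxes \<Gamma> k. fst p < R}"
proof (cases "{p \<in> entry_boxes \<Gamma> (k + 1). fst p < R + 1} = {}")
  case False
  let ?D = "{p \<in> entry_boxes \<Gamma> (k + 1). fst p < R + 1}"
  define c0 where "c0 = Min (snd ` ?D)"
  have fin: "finite (snd ` ?D)" using finite_entry_boxes[of \<Gamma> "k + 1"] by simp
  have "c0 \<in> snd ` ?D" unfolding c0_def using False fin by (intro Min_in) auto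
  then obtain r0 where r0: "(r0, c0) \<in> entry_boxes \<Gamma> (k + 1)" "r0 < R + 1" by auto
  have "?D \<subseteq> {p \<in> entry_boxes \<Gamma> (k + 1). c0 \<le> snd p}"
    unfolding c0_def using fin by (auto intro!: Min_le image_eqI)
  then have "card ?D \<le> card {p \<in> entry_boxes \<Gamma> (k + 1). c0 \<le> snd p}"
    using finite_entry_boxes[of \<Gamma> "k + 1"] by (intro card_mono) auto
  also have "\<dots> \<le> card {p \<in> entry_boxes \<Gamma> k. c0 \<le> snd p}"
  proof (cases c0)
    \<comment> \<open>The lattice condition speaks of columns strictly to the right of a given one;
      for all columns together the comparison comes from the content.\<close>
    case 0
    have "card (entry_boxes \<Gamma> j) = conjugate_part \<alpha> j" if "1 \<le> j" for j
      using LR that by (simp add: LR_tableau_def)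
    then show ?thesis using k conjugate_part_antimono[of \<alpha> k] 0 by simp
  next
    case (Suc c1)
    have "card {(r, c') \<in> entry_boxes \<Gamma> (k + 1). c1 < c'} \<le> card {(r, c') \<in> entry_boxes \<Gamma> k. c1 < c'}"
      using LR k unfolding LR_tableau_def by blast
    moreover have "{(r, c') \<in> entry_boxes \<Gamma> l. c1 < c'} = {p \<in> entry_boxes \<Gamma> l. c0 \<le> snd p}" for l
      using Suc by auto
    ultimately show ?thesis by simp
  qed
  also have "\<dots> \<le> card {p \<in> entry_boxes \<Gamma> k. fst p < R}"
  proof (intro card_mono subsetI)
    fix p assume p: "p \<in> {p \<in> entry_boxes \<Gamma> k. c0 \<le> snd p}"
    obtain r c where rc: "p = (r, c)" by fastforce
    have "r < r0"
    proof (rule ccontr)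
      assume "\<not> r < r0"
      moreover have "(r, c) \<in> young_diagram (\<Gamma> k)" "c0 \<le> c" using p rc by (auto simp: entry_boxes_def)
      moreover have "partition (\<Gamma> k)" using LR by (simp add: LR_tableau_def is_tableau_def)
      ultimately have "(r0, c0) \<in> young_diagram (\<Gamma> k)" by (auto intro: young_diagram_corner)
      then show False using r0(1) by (simp add: entry_boxes_def)
    qed
    then show "p \<in> {p \<in> entry_boxes \<Gamma> k. fst p < R}" using p rc r0(2) by simp
  qed (simp add: finite_entry_boxes)
  finally show ?thesis .
qed (simp only: card.empty)

text \<open>
  In \<open>LR_rows_entry_boxes\<close> the columns that contain both entries contribute equally to both sides
  and cancel.
\<close>

lemma LR_rows:
  assumes LR: "LR_tableau \<alpha> \<beta> \<gamma> \<Gamma>" and C: "has_columns s e f m \<Gamma>" and k: "1 \<le> k"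
  shows "card {i. i < s \<and> e i = k + 1 \<and> m i + k \<le> f i + R} \<le> card {i. i < s \<and> f i = k \<and> m i \<le> R}"
proof -
  have T: "is_tableau \<Gamma>" using LR by (simp add: LR_tableau_def)
  have col: "1 \<le> e i \<and> (2 \<le> e i \<longrightarrow> e i \<le> f i) \<and> (1 \<le> f i \<longrightarrow> e i \<le> f i)" if "i < s" for i
    using C that by (auto simp: has_columns_def is_column_def)
  let ?B = "{i. i < s \<and> e i \<le> k \<and> k + 1 \<le> f i \<and> m i + k \<le> f i + R}"
  let ?S = "{i. i < s \<and> e i = k + 1 \<and> m i + k \<le> f i + R}"
  let ?T = "{i. i < s \<and> f i = k \<and> m i \<le> R}"
  \<comment> \<open>Granting one more row to \<open>k + 1\<close> than to \<open>k\<close> makes the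
    row conditions agree on the columns \<open>?B\<close> that contain both entries.\<close>
  have 1: "{i. i < s \<and> e i \<le> k + 1 \<and> k + 1 \<le> f i \<and> m i + (k + 1) \<le> f i + (R + 1)} = ?B \<union> ?S"
    using col k by force
  have 2: "{i. i < s \<and> e i \<le> k \<and> k \<le> f i \<and> m i + k \<le> f i + R} = ?B \<union> ?T"
    using col k by force
  have "card (?B \<union> ?S) \<le> card (?B \<union> ?T)"
    using LR_rows_entry_boxes[OF LR k, of R] card_entry_boxes_rows[OF C T, of "k + 1" "R + 1"]
      card_entry_boxes_rows[OF C T k, of R] unfolding 1 2 by simp
  moreover have "card (?B \<union> ?S) = card ?B + card ?S" by (rule card_Un_disjoint) auto
  moreover have "card (?B \<union> ?T) = card ?B + card ?T" by (rule card_Un_disjoint) auto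
  ultimately show ?thesis by simp
qed

section \<open>Matching columns to chains\<close>

text \<open>
  The two assignments of heights impose different conditions only where a column starts at \<open>e x\<close> or
  \<open>e y\<close> or ends at \<open>f x\<close> or \<open>f y\<close>.  The heights \<open>m \<circ> transpose x y\<close> give the stronger condition
  for \<open>e x\<close> and \<open>f y\<close>, the heights \<open>m\<close> for \<open>e y\<close> and \<open>f x\<close>.  These two kinds cannot occur for the
  same pair of consecutive entries, so a matching for the stronger condition serves both.
\<close>

lemma mutual_pred:
  fixes m :: "nat \<Rightarrow> nat" and x y :: nat
  assumes cols: "\<And>i. i < s \<Longrightarrow> is_column (e i) (f i) (m i)"
    "\<And>i. i < s \<Longrightarrow> is_column (e i) (f i) (m (transpose x y i))"
    and rows: "\<And>k R. 1 \<le> k \<Longrightarrow>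
      card {i. i < s \<and> e i = k + 1 \<and> m i + k \<le> f i + R} \<le> card {i. i < s \<and> f i = k \<and> m i \<le> R}"
    and rows': "\<And>k R. 1 \<le> k \<Longrightarrow>
      card {i. i < s \<and> e i = k + 1 \<and> m (transpose x y i) + k \<le> f i + R} \<le>
      card {i. i < s \<and> f i = k \<and> m (transpose x y i) \<le> R}"
    and xy: "m y < m x" "e x \<le> f x" "e x < e y" "f x < f y" "e y \<le> f y"
  shows "\<exists>pred. inj_on pred {i. i < s \<and> 2 \<le> e i} \<and> (\<forall>i<s. 2 \<le> e i \<longrightarrow> pred i < s \<and> f (pred i) + 1 = e i \<and>
     m (pred i) + f i \<le> m i + f (pred i) \<and>
     m (transpose x y (pred i)) + f i \<le> m (transpose x y i) + f (pred i))"
proof -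
  define m' where "m' i = m (transpose x y i)" for i
  have m'x: "m' x = m y" and m'y: "m' y = m x" and m'o: "\<And>i. i \<noteq> x \<Longrightarrow> i \<noteq> y \<Longrightarrow> m' i = m i"
    by (simp_all add: m'_def)
  define S where "S k = {i. i < s \<and> e i = k + 1}" for k
  define T where "T k = {i. i < s \<and> f i = k}" for k
  have match: "\<exists>\<sigma>. inj_on \<sigma> (S k) \<and> \<sigma> ` S k \<subseteq> T k \<and> (\<forall>i\<in>S k. M (\<sigma> i) + f i \<le> M i + k)"
    if k: "1 \<le> k" and c: "\<And>i. i < s \<Longrightarrow> is_column (e i) (f i) (M i)"
    and r: "\<And>R. card {i. i < s \<and> e i = k + 1 \<and> M i + k \<le> f i + R} \<le> card {i. i < s \<and> f i = k \<and> M i \<le> R}"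
    for k and M :: "nat \<Rightarrow> nat"
  proof -
    have ge: "f i \<le> M i + k" if "i \<in> S k" for i
      using c[of i] that k by (auto simp: S_def is_column_def)
    have "card {i \<in> S k. M i + k - f i \<le> R} \<le> card {i \<in> T k. M i \<le> R}" for R
    proof -
      have "{i \<in> S k. M i + k - f i \<le> R} = {i. i < s \<and> e i = k + 1 \<and> M i + k \<le> f i + R}"
        using ge by (force simp: S_def)
      moreover have "{i \<in> T k. M i \<le> R} = {i. i < s \<and> f i = k \<and> M i \<le> R}" by (auto simp: T_def)
      ultimately show ?thesis using r[of R] by simp
    qed
    \<comment> \<open>For \<open>e i = k + 1\<close> the number \<open>M i + k - f i\<close> counts
      the empty boxes of column \<open>i\<close>; the matched column must have at most this total
      height.\<close>
    then obtain \<sigma> where "inj_on \<sigma> (S k)" "\<sigma> ` S k \<subseteq> T k" "\<forall>i\<in>S k. M (\<sigma> i) \<le> M i + k - f i"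
      using greedy_matching[of "S k" "T k" "\<lambda>i. M i + k - f i" M] by (auto simp: S_def T_def)
    then show ?thesis using ge by (intro exI[of _ \<sigma>]) (auto simp: le_diff_conv2)
  qed
  have both: "\<exists>\<sigma>. inj_on \<sigma> (S k) \<and> \<sigma> ` S k \<subseteq> T k \<and>
      (\<forall>i\<in>S k. m (\<sigma> i) + f i \<le> m i + k \<and> m' (\<sigma> i) + f i \<le> m' i + k)" if k: "1 \<le> k" for k
  proof (cases "k + 1 = e x \<or> k = f y")
    case True
    obtain \<sigma> where \<sigma>: "inj_on \<sigma> (S k)" "\<sigma> ` S k \<subseteq> T k" "\<And>i. i \<in> S k \<Longrightarrow> m' (\<sigma> i) + f i \<le> m' i + k"
      using match[OF k, of m'] cols(2) rows'[OF k] unfolding m'_def by blast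
    have "m (\<sigma> i) + f i \<le> m i + k" if i: "i \<in> S k" for i
    proof -
      have "f (\<sigma> i) = k" using \<sigma>(2) i by (auto simp: T_def)
      then have "\<sigma> i \<noteq> x" using True xy by auto
      then have "m (\<sigma> i) \<le> m' (\<sigma> i)" using m'o[of "\<sigma> i"] m'y xy(1) by (cases "\<sigma> i = y") auto
      moreover have "e i = k + 1" using i by (simp add: S_def)
      then have "i \<noteq> y" using True xy by auto
      then have "m' i \<le> m i" using m'o[of i] m'x xy(1) by (cases "i = x") auto
      ultimately show ?thesis using \<sigma>(3)[OF i] by simp
    qed
    then show ?thesis using \<sigma> by blast
  next
    case False
    obtain \<sigma> where \<sigma>: "inj_on \<sigma> (S k)" "\<sigma> ` S k \<subseteq> T k" "\<And>i. i \<in> S k \<Longrightarrow> m (\<sigma> i) + f i \<le> m i + k"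
      using match[OF k, of m] cols(1) rows[OF k] by blast
    have "m' (\<sigma> i) + f i \<le> m' i + k" if i: "i \<in> S k" for i
    proof -
      have "f (\<sigma> i) = k" using \<sigma>(2) i by (auto simp: T_def)
      then have "\<sigma> i \<noteq> y" using False by auto
      then have "m' (\<sigma> i) \<le> m (\<sigma> i)" using m'o[of "\<sigma> i"] m'x xy(1) by (cases "\<sigma> i = x") auto
      moreover have "e i = k + 1" using i by (simp add: S_def)
      then have "i \<noteq> x" using False by auto
      then have "m i \<le> m' i" using m'o[of i] m'y xy(1) by (cases "i = y") auto
      ultimately show ?thesis using \<sigma>(3)[OF i] by simp
    qed
    then show ?thesis using \<sigma> by blast
  qed
  then obtain \<sigma> where \<sigma>: "\<And>k. 1 \<le> k \<Longrightarrow> inj_on (\<sigma> k) (S k) \<and> \<sigma> k ` S k \<subseteq> T k \<and>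
      (\<forall>i\<in>S k. m (\<sigma> k i) + f i \<le> m i + k \<and> m' (\<sigma> k i) + f i \<le> m' i + k)" by metis
  define pred where "pred i = \<sigma> (e i - 1) i" for i
  have pred: "pred i < s \<and> f (pred i) + 1 = e i \<and> m (pred i) + f i \<le> m i + f (pred i) \<and>
     m' (pred i) + f i \<le> m' i + f (pred i)" if "i < s" "2 \<le> e i" for i
  proof -
    have "1 \<le> e i - 1" using that by simp
    note \<sigma> = \<sigma>[OF this]
    have "i \<in> S (e i - 1)" using that by (simp add: S_def)
    moreover from this have "pred i \<in> T (e i - 1)" using \<sigma> by (auto simp: pred_def)
    ultimately show ?thesis using \<sigma> that by (auto simp: pred_def T_def)
  qed
  have "inj_on pred {i. i < s \<and> 2 \<le> e i}"
  proof (rule inj_onI)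
    fix i l assume il: "i \<in> {i. i < s \<and> 2 \<le> e i}" "l \<in> {i. i < s \<and> 2 \<le> e i}" "pred i = pred l"
    then have el: "e i = e l" using pred[of i] pred[of l] by simp
    have "i \<in> S (e i - 1)" "l \<in> S (e i - 1)" using il el by (auto simp: S_def)
    moreover have "inj_on (\<sigma> (e i - 1)) (S (e i - 1))" using \<sigma>[of "e i - 1"] il by auto
    ultimately show "i = l" using il(3) el by (auto simp: pred_def inj_on_def)
  qed
  then show ?thesis using pred unfolding m'_def by blast
qed

text \<open>A nonempty interval whose column is no predecessor ends a chain. Since
  \<open>pred\<close> is injective, the number of chain ends with \<open>f i = k\<close> is the
  difference of the contents of \<open>k\<close> and \<open>k + 1\<close>, that is, the number of
  parts of \<alpha> equal to \<open>k\<close>. So chain ends can be numbered by the parts of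
  \<alpha>, and labels pass from the ends down along \<open>pred\<close>.\<close>

lemma chain_labels:
  fixes e f pred :: "nat \<Rightarrow> nat"
  assumes col: "\<And>i. i < s \<Longrightarrow> 1 \<le> e i \<and> e i \<le> f i \<or> e i = 1 \<and> f i = 0"
    and inj: "inj_on pred {i. i < s \<and> 2 \<le> e i}"
    and pred: "\<And>i. i < s \<Longrightarrow> 2 \<le> e i \<Longrightarrow> pred i < s \<and> f (pred i) + 1 = e i"
    and \<alpha>: "partition \<alpha>"
    and content: "\<And>k. 1 \<le> k \<Longrightarrow> card {i. i < s \<and> e i \<le> k \<and> k \<le> f i} = conjugate_part \<alpha> k"
  shows "\<exists>\<rho>. (\<forall>i<s. 2 \<le> e i \<longrightarrow> \<rho> (pred i) = \<rho> i) \<and>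
     (\<forall>i<s. \<forall>l<s. \<rho> i = \<rho> l \<longrightarrow> i \<noteq> l \<longrightarrow> 1 \<le> f i \<longrightarrow> f i \<le> f l \<longrightarrow> f i < e l) \<and>
     (\<forall>r<length \<alpha>. \<exists>i<s. \<rho> i = r \<and> f i = \<alpha> ! r) \<and>
     (\<forall>i<s. 1 \<le> f i \<longrightarrow> \<rho> i < length \<alpha> \<and> f i \<le> \<alpha> ! \<rho> i)"
proof -
  define P where "P = {l. l < s \<and> 2 \<le> e l}"
  define E where "E = {i. i < s \<and> 1 \<le> f i \<and> i \<notin> pred ` P}"
  have "card {i \<in> E. f i = k} = card {r \<in> {..<length \<alpha>}. \<alpha> ! r = k}" for k
  proof (cases "k = 0")
    case True
    have "\<alpha> ! r \<noteq> 0" if "r < length \<alpha>" for r using \<alpha> that nth_mem unfolding partition_def by metis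
    then have "{r \<in> {..<length \<alpha>}. \<alpha> ! r = k} = {}" using True by auto
    moreover have "{i \<in> E. f i = k} = {}" using True by (auto simp: E_def)
    ultimately show ?thesis by (simp only:)
  next
    case False
    let ?F = "{i. i < s \<and> f i = k}" and ?S = "{i. i < s \<and> e i = k + 1}"
    let ?B = "{i. i < s \<and> e i \<le> k \<and> k + 1 \<le> f i}"
    have sub: "pred ` ?S \<subseteq> ?F"
    proof (rule image_subsetI)
      fix i assume "i \<in> ?S"
      then show "pred i \<in> ?F" using pred[of i] False by simp
    qed
    have "{i \<in> E. f i = k} = ?F - pred ` ?S"
    proof -
      have "i \<in> pred ` ?S" if "i < s" "f i = k" "i \<in> pred ` P" for i
      proof -
        from that(3) obtain l where "l \<in> P" "i = pred l" by auto
        then show ?thesis using that(2) pred[of l] by (intro image_eqI[of _ _ l]) (auto simp: P_def)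
      qed
      then show ?thesis using False by (auto simp: E_def P_def)
    qed
    moreover have "card (pred ` ?S) = card ?S"
      using False by (intro card_image inj_on_subset[OF inj]) auto
    ultimately have 1: "card {i \<in> E. f i = k} = card ?F - card ?S"
      using sub by (simp add: card_Diff_subset)
    have "{i. i < s \<and> e i \<le> k \<and> k \<le> f i} = ?B \<union> ?F" using col False by fastforce
    moreover have "card (?B \<union> ?F) = card ?B + card ?F" by (rule card_Un_disjoint) auto
    ultimately have 2: "card ?B + card ?F = conjugate_part \<alpha> k" using content[of k] False by simp
    have "{i. i < s \<and> e i \<le> k + 1 \<and> k + 1 \<le> f i} = ?B \<union> ?S" using col False by fastforce
    moreover have "card (?B \<union> ?S) = card ?B + card ?S" by (rule card_Un_disjoint) auto
    ultimately have 3: "card ?B + card ?S = conjugate_part \<alpha> (k + 1)" using content[of "k + 1"] by simp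
    have "{c. c < length \<alpha> \<and> k \<le> \<alpha> ! c} = {c. c < length \<alpha> \<and> k + 1 \<le> \<alpha> ! c} \<union> {r \<in> {..<length \<alpha>}. \<alpha> ! r = k}"
      by auto
    moreover have "card ({c. c < length \<alpha> \<and> k + 1 \<le> \<alpha> ! c} \<union> {r \<in> {..<length \<alpha>}. \<alpha> ! r = k}) =
        card {c. c < length \<alpha> \<and> k + 1 \<le> \<alpha> ! c} + card {r \<in> {..<length \<alpha>}. \<alpha> ! r = k}"
      by (rule card_Un_disjoint) auto
    ultimately have "conjugate_part \<alpha> k = conjugate_part \<alpha> (k + 1) + card {r \<in> {..<length \<alpha>}. \<alpha> ! r = k}"
      by (simp add: conjugate_part_def)
    then show ?thesis using 1 2 3 by simp
  qed
  then have "\<exists>h. bij_betw h E {..<length \<alpha>} \<and> (\<forall>i\<in>E. \<alpha> ! h i = f i)"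
    by (intro bij_of_equal_fibres) (auto simp: E_def)
  then obtain h where h: "bij_betw h E {..<length \<alpha>}" "\<And>i. i \<in> E \<Longrightarrow> \<alpha> ! h i = f i" by blast
  define M where "M = (\<Sum>i<s. f i)"
  have fM: "f i \<le> M" if "i < s" for i
    using member_le_sum[of i "{..<s}" f] that by (simp add: M_def)
  define nxt where "nxt = inv_into P pred"
  have nxt: "nxt (pred l) = l" if "l \<in> P" for l
    using inj that unfolding nxt_def P_def by (intro inv_into_f_f) auto
  have lt: "f (pred l) < f l" if "l \<in> P" for l
    using that pred[of l] col[of l] by (auto simp: P_def)
  have "\<exists>\<rho>. \<forall>i. \<rho> i = (if i \<in> pred ` P then \<rho> (nxt i) else h i)"
  \<comment> \<open>Labels are inherited from successors, whose \<open>f\<close> is larger, so the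
    measure is reversed.\<close>
  proof (rule triangular_fixpoint[of "\<lambda>i. M - f i"])
    fix i and V W :: "nat \<Rightarrow> nat"
    assume eq: "\<And>l. M - f l < M - f i \<Longrightarrow> V l = W l"
    have "V (nxt i) = W (nxt i)" if "i \<in> pred ` P"
    proof (rule eq)
      from that obtain l where l: "l \<in> P" "i = pred l" by auto
      then show "M - f (nxt i) < M - f i" using nxt lt[of l] fM[of l] by (auto simp: P_def)
    qed
    then show "(if i \<in> pred ` P then V (nxt i) else h i) = (if i \<in> pred ` P then W (nxt i) else h i)"
      by simp
  qed
  then obtain \<rho> where \<rho>: "\<And>i. \<rho> i = (if i \<in> pred ` P then \<rho> (nxt i) else h i)" by blast
  have \<rho>p: "\<rho> (pred l) = \<rho> l" if "l \<in> P" for l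
    using \<rho>[of "pred l"] nxt[OF that] that by simp
  have \<rho>h: "\<rho> i = h i" if "i \<in> E" for i
    using \<rho>[of i] that by (simp add: E_def)
  \<comment> \<open>The last conjunct says that only the end of a chain attains its part of
    \<alpha>; it excludes in \<open>disj\<close> that a column below the end reaches as far as the
    end.\<close>
  have top: "\<rho> i < length \<alpha> \<and> f i \<le> \<alpha> ! \<rho> i \<and> (f i = \<alpha> ! \<rho> i \<longrightarrow> i \<in> E)" if "i < s" "1 \<le> f i" for i
    using that
  proof (induction "M - f i" arbitrary: i rule: less_induct)
    case less
    show ?case
    proof (cases "i \<in> pred ` P")
      case False
      then have "i \<in> E" using less.prems by (simp add: E_def)
      then show ?thesis using \<rho>h h bij_betwE[OF h(1)] by auto
    next
      case True
      then obtain l where l: "l \<in> P" "i = pred l" by auto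
      then have "f i < f l" "l < s" using lt[of l] by (auto simp: P_def)
      moreover from this have "M - f l < M - f i" using fM[of l] by linarith
      ultimately have "\<rho> l < length \<alpha> \<and> f l \<le> \<alpha> ! \<rho> l"
        using less.hyps[of l] by linarith
      then show ?thesis using \<open>f i < f l\<close> \<rho>p[OF l(1)] l(2) by simp
    qed
  qed
  have disj: "i = l \<or> f i < e l \<or> f l < e i"
    if "i < s" "l < s" "1 \<le> f i" "1 \<le> f l" "\<rho> i = \<rho> l" for i l
    using that
  proof (induction "(M - f i) + (M - f l)" arbitrary: i l rule: less_induct)
    case less
    \<comment> \<open>If \<open>i\<close> ends its chain, only \<open>l\<close> is replaced by its
      successor; if neither column is an end, both are.\<close>
    have E_case: "i = l \<or> f i < e l \<or> f l < e i"
      if il: "i \<in> E" "l < s" "1 \<le> f l" "\<rho> i = \<rho> l" "i < s" "1 \<le> f i"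
      and IH: "\<And>l'. l' \<in> P \<Longrightarrow> l = pred l' \<Longrightarrow> i = l' \<or> f i < e l' \<or> f l' < e i" for i l
    proof (cases "l \<in> pred ` P")
      case False
      then have "l \<in> E" using il by (simp add: E_def)
      then show ?thesis using il \<rho>h h(1) by (auto simp: bij_betw_def inj_on_def)
    next
      case True
      then obtain l' where l': "l' \<in> P" "l = pred l'" by auto
      have e: "e l' = f l + 1" using pred[of l'] l' by (simp add: P_def)
      have "l \<notin> E" using l' by (simp add: E_def)
      then have "f l < f i" using top[OF il(2,3)] h(2)[OF il(1)] \<rho>h[OF il(1)] il(4) by auto
      then show ?thesis using IH[OF l'] e lt[OF l'(1)] l' col[OF il(5)] il(6) by auto
    qed
    show ?case
    proof (cases "i \<in> E \<or> l \<in> E")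
      case True
      then show ?thesis
      proof
        assume "i \<in> E"
        then show ?thesis
        proof (rule E_case)
          fix l' assume l': "l' \<in> P" "l = pred l'"
          then have "f l < f l'" "l' < s" using lt by (auto simp: P_def)
          moreover from this have "(M - f i) + (M - f l') < (M - f i) + (M - f l)"
            using fM[of l'] by linarith
          ultimately show "i = l' \<or> f i < e l' \<or> f l' < e i"
            using less.prems \<rho>p[OF l'(1)] l'(2) by (intro less.hyps) auto
        qed (use less.prems in auto)
      next
        assume "l \<in> E"
        then have "l = i \<or> f l < e i \<or> f i < e l"
        proof (rule E_case)
          fix l' assume l': "l' \<in> P" "i = pred l'"
          then have "f i < f l'" "l' < s" using lt by (auto simp: P_def)
          moreover from this have "(M - f l') + (M - f l) < (M - f i) + (M - f l)"
            using fM[of l'] by linarith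
          ultimately have "l' = l \<or> f l' < e l \<or> f l < e l'"
            using less.prems \<rho>p[OF l'(1)] l'(2) by (intro less.hyps) auto
          then show "l = l' \<or> f l < e l' \<or> f l' < e l" by auto
        qed (use less.prems in auto)
        then show ?thesis by auto
      qed
    next
      case False
      then obtain i' l' where i': "i' \<in> P" "i = pred i'" and l': "l' \<in> P" "l = pred l'"
        using less.prems by (auto simp: E_def)
      have f: "f i < f i'" "i' < s" "e i' = f i + 1" "f l < f l'" "l' < s" "e l' = f l + 1"
        using i' l' lt pred[of i'] pred[of l'] by (auto simp: P_def)
      have lt': "M - f i' < M - f i" "M - f l' < M - f l"
        using f fM[of i'] fM[of l'] by linarith+
      have \<rho>': "\<rho> i' = \<rho> i" "\<rho> l' = \<rho> l" using \<rho>p i' l' by auto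
      have "i' = l' \<or> f i' < e l' \<or> f l' < e i'"
        by (rule less.hyps) (use less.prems \<rho>' f lt' in auto)
      moreover have "i' = l \<or> f i' < e l \<or> f l < e i'"
        by (rule less.hyps) (use less.prems \<rho>' f lt' in auto)
      moreover have "i = l' \<or> f i < e l' \<or> f l' < e i"
        by (rule less.hyps) (use less.prems \<rho>' f lt' in auto)
      ultimately show ?thesis using i' l' f by auto
    qed
  qed
  show ?thesis
  proof (intro exI[of _ \<rho>] conjI allI impI)
    fix i l assume "i < s" "l < s" "\<rho> i = \<rho> l" "i \<noteq> l" "1 \<le> f i" "f i \<le> f l"
    then show "f i < e l" using disj[of i l] col[of i] by auto
  next
    fix r assume "r < length \<alpha>"
    then have "r \<in> h ` E" using h(1) by (auto simp: bij_betw_def)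
    then obtain i where "i \<in> E" "r = h i" by auto
    then show "\<exists>i<s. \<rho> i = r \<and> f i = \<alpha> ! r" using h(2) \<rho>h by (auto simp: E_def)
  qed (use \<rho>p top in \<open>auto simp: P_def\<close>)
qed

section \<open>The box move\<close>

context perturbed_chain_data
begin

lemma column_part_level_height:
  assumes "has_columns (length \<beta>) e f ((!) \<beta>) \<Gamma>" "i < length \<beta>"
  shows "column_part j (e i) (f i) (\<beta> ! i) = level_height j i"
proof -
  have "is_column (e i) (f i) (\<beta> ! i)" using assms by (simp add: has_columns_def)
  then show ?thesis
    using height[OF assms(2)] unfolding is_column_def column_part_eq level_height_def
    by (auto simp: max_def)
qed

text \<open>By \<open>surj\<close> and \<open>dvd\<close>, \<open>\<tau>\<close> induces an
  automorphism of N_\<beta>. It moves the embedding given by \<open>F\<close> to the one given by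
  \<open>generators\<close>, so the types can be computed in the coordinates
  \<open>coords j (\<tau> v)\<close>.\<close>

lemma V_tableau_change_of_coords:
  fixes \<tau> F :: "(nat \<Rightarrow> 'k fps) \<Rightarrow> nat \<Rightarrow> 'k fps"
  assumes C: "has_columns (length \<beta>) e f ((!) \<beta>) \<Gamma>" and part: "\<And>j. partition (\<Gamma> j)"
    and \<tau>: "\<And>v w. \<tau> (v + w) = \<tau> v + \<tau> w" "\<And>r v. \<tau> (fscale r v) = fscale r (\<tau> v)"
    and surj: "\<And>w. \<exists>v. \<tau> v = w"
    and dvd: "\<And>v. (\<forall>i<length \<beta>. fps_X ^ (\<beta> ! i) dvd \<tau> v i) \<longleftrightarrow> (\<forall>i<length \<beta>. fps_X ^ (\<beta> ! i) dvd v i)"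
    and F: "\<And>v w. F (v + w) = F v + F w" "\<And>r v. F (fscale r v) = fscale r (F v)"
    and \<tau>F: "\<And>u. \<tau> (F u) = generators u"
  shows "N_linear \<alpha> \<beta> F" "N_map \<alpha> \<beta> F \<in> V_tableau \<alpha> \<beta> (\<Gamma> 0) \<Gamma>"
proof -
  have wd: "fps_X ^ (\<beta> ! i) dvd F v i"
    if v: "\<forall>r<length \<alpha>. fps_X ^ (\<alpha> ! r) dvd v r" and i: "i < length \<beta>" for v i
  proof -
    have "\<forall>i<length \<beta>. fps_X ^ (\<beta> ! i) dvd \<tau> (F v) i"
      unfolding \<tau>F using generators_wd[OF v] by blast
    then show ?thesis using dvd i by blast
  qed
  show N: "N_linear \<alpha> \<beta> F" by (rule N_linear.intro) (simp_all add: F wd)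
  have \<tau>0: "\<tau> 0 = 0" using \<tau>(1)[of 0 0] by simp
  have \<tau>m: "\<tau> (- w) = - \<tau> w" for w
    using \<tau>(1)[of w "- w"] \<tau>0 by (simp add: eq_neg_iff_add_eq_0 add.commute)
  have \<tau>d: "\<tau> (v - w) = \<tau> v - \<tau> w" for v w using \<tau>(1)[of v "- w"] \<tau>m by simp
  show "N_map \<alpha> \<beta> F \<in> V_tableau \<alpha> \<beta> (\<Gamma> 0) \<Gamma>"
  proof (rule V_tableauI[OF N _ part, where c = level_height and \<psi> = "\<lambda>j v. coords j (\<tau> v)"])
    fix l r assume "\<forall>i<length \<beta>. fps_X ^ (\<beta> ! i) dvd F l i" "r < length \<alpha>"
    then show "fps_X ^ (\<alpha> ! r) dvd l r"
      using generators_inj[of l r] dvd[of "F l"] unfolding \<tau>F by blast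
  next
    fix j
    have "image_mset (\<lambda>i. column_part j (e i) (f i) (\<beta> ! i)) (mset_set {..<length \<beta>}) =
        image_mset (level_height j) (mset_set {..<length \<beta>})"
      using column_part_level_height[OF C] by (intro image_mset_cong) auto
    then show "mset (\<Gamma> j) = {#h \<in># image_mset (level_height j) (mset_set {..<length \<beta>}). h \<noteq> 0#}"
      using C by (simp add: has_columns_def)
  next
    fix j and w :: "nat \<Rightarrow> 'k fps"
    obtain V where V: "\<forall>i<length \<beta>. coords j V i = w i" using coords_surj by blast
    obtain v where "\<tau> v = V" using surj by blast
    then show "\<exists>v. \<forall>i<length \<beta>. coords j (\<tau> v) i = w i" using V by blast
  next
    fix j and v :: "nat \<Rightarrow> 'k fps"
    have "(\<forall>i<length \<beta>. fps_X ^ (\<beta> ! i) dvd v i - fps_X ^ j * F l i) \<longleftrightarrow>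
        (\<forall>i<length \<beta>. fps_X ^ (\<beta> ! i) dvd \<tau> v i - fps_X ^ j * generators l i)" for l
      using dvd[of "v - fscale (fps_X ^ j) (F l)"] by (simp add: \<tau>d \<tau> \<tau>F)
    then show "(\<exists>l. \<forall>i<length \<beta>. fps_X ^ (\<beta> ! i) dvd v i - fps_X ^ j * F l i) \<longleftrightarrow>
        (\<forall>i<length \<beta>. fps_X ^ level_height j i dvd coords j (\<tau> v) i)"
      using coords_dvd_iff[of "\<tau> v" j] by simp
  qed (simp_all only: \<tau> coords_linear)
qed

end

text \<open>Over a finite field, 1 plus the product of all \<open>X - a\<close> is nonconstant and
  takes the value 1 everywhere.\<close>

lemma infinite_alg_closed_field: "infinite (UNIV :: 'k::alg_closed_field set)"
proof
  assume fin: "finite (UNIV :: 'k set)"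
  let ?p = "\<Prod>a\<in>(UNIV :: 'k set). [:- a, 1:]"
  have "degree ?p = (\<Sum>a\<in>(UNIV :: 'k set). degree [:- a, 1:])"
    by (rule degree_prod_eq_sum_degree) simp
  then have deg: "degree ?p > 0" using fin by (simp add: card_gt_0_iff)
  then have "degree (1 + ?p) = degree ?p" by (intro degree_add_eq_right) simp
  then obtain x where "poly (1 + ?p) x = 0" using deg alg_closed_imp_poly_has_root by metis
  moreover have "poly ?p x = 0" using fin by (auto simp: poly_prod)
  ultimately show False by simp
qed

text \<open>At level \<open>f x\<close> column \<open>x\<close> has reached its height in \<Gamma>
  but not in \<Gamma>', where it carries entries up to \<open>f y\<close>. Column \<open>y\<close>
  is shorter and the others agree, so the parts equal to \<open>m x\<close> differ in
  number.\<close>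

lemma box_move_changes_tableau:
  assumes C: "has_columns s e f m \<Gamma>" "has_columns s (e \<circ> transpose x y) (f \<circ> transpose x y) m \<Gamma>'"
    and xy: "x < s" "y < s" "m y < m x" "e x \<le> f x" "f x < f y" "e y \<le> f y"
  shows "\<Gamma> \<noteq> \<Gamma>'"
proof
  assume eq: "\<Gamma> = \<Gamma>'"
  define a where "a i = column_part (f x) (e i) (f i) (m i)" for i
  define b where "b i = column_part (f x) ((e \<circ> transpose x y) i) ((f \<circ> transpose x y) i) (m i)" for i
  have cnt: "count {#h \<in># image_mset q (mset_set {..<s}). h \<noteq> 0#} (m x) = card {i. i < s \<and> q i = m x}"
    for q
  proof -
    have "{i \<in> {..<s}. q i = m x} = {i. i < s \<and> q i = m x}" by auto
    moreover have "count (image_mset q M) h = size (filter_mset (\<lambda>i. q i = h) M)" for M h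
      by (induction M) auto
    ultimately show ?thesis using xy(3) by (simp add: filter_mset_mset_set)
  qed
  have "card {i. i < s \<and> a i = m x} = card {i. i < s \<and> b i = m x}"
    using C cnt[of a] cnt[of b] eq unfolding has_columns_def a_def b_def by metis
  moreover have "card {i. i < s \<and> b i = m x} < card {i. i < s \<and> a i = m x}"
  proof (rule psubset_card_mono)
    have "a x = m x" using xy by (simp add: a_def column_part_eq)
    moreover have "b x \<noteq> m x" using xy by (simp add: b_def column_part_eq max_def) arith
    moreover have "b y \<noteq> m x" using xy by (simp add: b_def column_part_eq)
    moreover have "a i = b i" if "i \<noteq> x" "i \<noteq> y" for i using that by (simp add: a_def b_def)
    ultimately show "{i. i < s \<and> b i = m x} \<subset> {i. i < s \<and> a i = m x}"
      using xy(1) by (intro psubsetI subsetI notI) (force, blast)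
  qed simp
  ultimately show False by simp
qed

theorem theorem1p1:
  fixes \<alpha> \<beta> \<gamma> :: "nat list" and \<Gamma> \<Gamma>' :: tableau
  assumes "LR_tableau \<alpha> \<beta> \<gamma> \<Gamma>"
    and "LR_tableau \<alpha> \<beta> \<gamma> \<Gamma>'"
    and "increasing_box_move \<Gamma> \<Gamma>'"
  shows "boundary_less TYPE('k::alg_closed_field) \<alpha> \<beta> \<gamma> \<Gamma> \<Gamma>'"
proof -
  obtain e f x y where xy\<beta>: "x < length \<beta>" "y < length \<beta>" "\<beta> ! y < \<beta> ! x" "1 \<le> e x" "e x \<le> f x"
      "e x < e y" "f x < f y" "f y - f x = e y - e x"
    and C\<beta>: "has_columns (length \<beta>) e f ((!) \<beta>) \<Gamma>"
      "has_columns (length \<beta>) (e \<circ> transpose x y) (f \<circ> transpose x y) ((!) \<beta>) \<Gamma>'"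
    by (rule increasing_box_move_columns[OF assms(1,3)])
  define s where "s = length \<beta>"
  define m where "m = (!) \<beta>"
  note xy = xy\<beta>[folded s_def m_def] and C = C\<beta>(1)[folded s_def m_def] and C' = C\<beta>(2)[folded s_def m_def]
  define sw where "sw = transpose x y"
  have sw [simp]: "sw x = y" "sw y = x" "\<And>i. sw (sw i) = i" and swo: "\<And>i. i \<noteq> x \<Longrightarrow> i \<noteq> y \<Longrightarrow> sw i = i"
    by (simp_all add: sw_def)
  have sws: "sw i < s \<longleftrightarrow> i < s" for i using xy(1,2) swo[of i] by (cases "i = x \<or> i = y") auto
  have "bij_betw sw {..<s} {..<s}"
    by (rule bij_betw_byWitness[of _ sw]) (auto simp: sws)
  from has_columns_reindex[OF C' this]
  \<comment> \<open>Instead of exchanging the intervals, \<Gamma>' is presented by exchanging the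
    heights. Both tableaux then share \<open>e\<close> and \<open>f\<close>, and hence
    \<open>pred\<close> and \<open>\<rho>\<close>.\<close>
  have C2: "has_columns s e f (m \<circ> sw) \<Gamma>'"
    by (simp add: comp_def sw_def)
  have col: "is_column (e i) (f i) (m i)" "is_column (e i) (f i) (m (sw i))" if "i < s" for i
    using C C2 that by (simp_all add: has_columns_def)
  have col': "1 \<le> e i \<and> e i \<le> f i \<or> e i = 1 \<and> f i = 0" if "i < s" for i
    using col[OF that] by (auto simp: is_column_def)
  have ey: "e y \<le> f y" using col'[OF xy(2)] xy by auto
  have \<alpha>: "partition \<alpha>" using assms(1) by (simp add: LR_tableau_def)
  have "\<exists>pred. inj_on pred {i. i < s \<and> 2 \<le> e i} \<and> (\<forall>i<s. 2 \<le> e i \<longrightarrow> pred i < s \<and> f (pred i) + 1 = e i \<and>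
     m (pred i) + f i \<le> m i + f (pred i) \<and>
     m (transpose x y (pred i)) + f i \<le> m (transpose x y i) + f (pred i))"
  proof (rule mutual_pred)
    show "card {i. i < s \<and> e i = k + 1 \<and> m i + k \<le> f i + R} \<le> card {i. i < s \<and> f i = k \<and> m i \<le> R}"
      if "1 \<le> k" for k R by (rule LR_rows[OF assms(1) C that])
    show "card {i. i < s \<and> e i = k + 1 \<and> m (transpose x y i) + k \<le> f i + R} \<le>
        card {i. i < s \<and> f i = k \<and> m (transpose x y i) \<le> R}"
      if "1 \<le> k" for k R using LR_rows[OF assms(2) C2 that] by (simp add: sw_def)
  qed (use col xy ey in \<open>simp_all add: sw_def\<close>)
  then obtain pred where pred_inj: "inj_on pred {i. i < s \<and> 2 \<le> e i}"
    and pred: "\<And>i. i < s \<Longrightarrow> 2 \<le> e i \<Longrightarrow> pred i < s \<and> f (pred i) + 1 = e i \<and>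
      m (pred i) + f i \<le> m i + f (pred i) \<and> m (sw (pred i)) + f i \<le> m (sw i) + f (pred i)"
    unfolding sw_def by blast
  have "\<exists>\<rho>. (\<forall>i<s. 2 \<le> e i \<longrightarrow> \<rho> (pred i) = \<rho> i) \<and>
     (\<forall>i<s. \<forall>l<s. \<rho> i = \<rho> l \<longrightarrow> i \<noteq> l \<longrightarrow> 1 \<le> f i \<longrightarrow> f i \<le> f l \<longrightarrow> f i < e l) \<and>
     (\<forall>r<length \<alpha>. \<exists>i<s. \<rho> i = r \<and> f i = \<alpha> ! r) \<and>
     (\<forall>i<s. 1 \<le> f i \<longrightarrow> \<rho> i < length \<alpha> \<and> f i \<le> \<alpha> ! \<rho> i)"
    by (rule chain_labels[OF col' pred_inj _ \<alpha> LR_content[OF assms(1) C]]) (use pred in simp_all)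
  then obtain \<rho> where \<rho>p: "\<And>i. i < s \<Longrightarrow> 2 \<le> e i \<Longrightarrow> \<rho> (pred i) = \<rho> i"
    and disj: "\<And>i l. i < s \<Longrightarrow> l < s \<Longrightarrow> \<rho> i = \<rho> l \<Longrightarrow> i \<noteq> l \<Longrightarrow> 1 \<le> f i \<Longrightarrow> f i \<le> f l \<Longrightarrow> f i < e l"
    and last: "\<And>r. r < length \<alpha> \<Longrightarrow> \<exists>i<s. \<rho> i = r \<and> f i = \<alpha> ! r"
    and le_last: "\<And>i. i < s \<Longrightarrow> 1 \<le> f i \<Longrightarrow> \<rho> i < length \<alpha> \<and> f i \<le> \<alpha> ! \<rho> i"
    by blast
  \<comment> \<open>The exponents are honest differences: a chain starts with a column whose first
    entry is 1, where \<open>f i \<le> M i\<close> holds, and \<open>M i - f i\<close> does not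
    decrease along it.\<close>
  have fm: "f i \<le> M i"
    if "i < s" and c: "\<And>i. i < s \<Longrightarrow> is_column (e i) (f i) (M i)"
    and p: "\<And>i. i < s \<Longrightarrow> 2 \<le> e i \<Longrightarrow> M (pred i) + f i \<le> M i + f (pred i)" for i M
    using that(1)
  proof (induction "f i" arbitrary: i rule: less_induct)
    case less
    show ?case
    proof (cases "2 \<le> e i")
      case True
      then have "f (pred i) < f i" using pred[OF less.prems] col'[OF less.prems] by auto
      then have "f (pred i) \<le> M (pred i)" using less.hyps[of "pred i"] pred[OF less.prems True] by simp
      then show ?thesis using p[OF less.prems True] by simp
    next
      case False
      then show ?thesis using c[OF less.prems] by (auto simp: is_column_def)
    qed
  qed
  have fm1: "f i \<le> m i" if "i < s" for i by (rule fm[OF that]) (use col pred in auto)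
  have fm2: "f i \<le> m (sw i)" if "i < s" for i
    using fm[OF that, of "\<lambda>i. m (sw i)"] col pred by auto
  define g where "g i = m i - f i" for i
  \<comment> \<open>In \<Gamma>' the column of height \<open>m i\<close> carries the interval with
    index \<open>sw i\<close>.\<close>
  define g' where "g' i = m i - f (sw i)" for i
  have g_pred: "g (pred i) \<le> g i" "g' (sw (pred i)) \<le> g' (sw i)" if "i < s" "2 \<le> e i" for i
    using pred[OF that] fm1[of i] fm1[of "pred i"] fm2[of i] fm2[of "pred i"] that
    by (auto simp: g_def g'_def)
  have g_mono: "g i \<le> g l" if "i < s" "l < s" "\<rho> i = \<rho> l" "1 \<le> f i" "f i \<le> f l" for i l
    using that
  proof (induction "f l" arbitrary: l rule: less_induct)
    case less
    show ?case
    proof (cases "i = l")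
      case False
      then have fe: "f i < e l" using disj less.prems by blast
      then have e2: "2 \<le> e l" using less.prems by simp
      note p = pred[OF less.prems(2) e2]
      have "g i \<le> g (pred l)"
        by (rule less.hyps) (use p fe less.prems col'[OF less.prems(2)] \<rho>p[OF less.prems(2) e2] in auto)
      then show ?thesis using g_pred(1)[OF less.prems(2) e2] by simp
    qed simp
  qed
  \<comment> \<open>In a common chain \<open>f x < f y\<close> would force
    \<open>g x \<le> g y\<close>, whereas column \<open>x\<close> is taller and ends with a smaller
    entry.\<close>
  have \<rho>xy: "\<rho> x \<noteq> \<rho> y"
  proof
    assume "\<rho> x = \<rho> y"
    then have "g x \<le> g y" using g_mono[of x y] xy by simp
    then show False using xy fm1[of y] by (simp add: g_def)
  qed
  define \<delta> where "\<delta> = f y - f x"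
  have sw_eq: "sw i = sw l \<longleftrightarrow> i = l" for i l by (metis sw(3))
  interpret chain: chain_data \<alpha> \<beta> e f g \<rho> pred
  proof (unfold_locales, unfold s_def[symmetric])
    fix i assume i: "i < s"
    show "\<beta> ! i = g i + f i" using fm1[OF i] by (simp add: g_def m_def)
    show "1 \<le> f i \<Longrightarrow> \<rho> i < length \<alpha> \<and> f i \<le> \<alpha> ! \<rho> i" by (rule le_last[OF i])
    show "f i < e l" if "l < s" "\<rho> i = \<rho> l" "i \<noteq> l" "1 \<le> f i" "f i \<le> f l" for l
      using disj i that by blast
    assume e: "2 \<le> e i"
    show "pred i < s" "f (pred i) = e i - 1" using pred[OF i e] by linarith+
    show "g (pred i) \<le> g i" "\<rho> (pred i) = \<rho> i" "e i \<le> f i"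
      using g_pred(1)[OF i e] \<rho>p[OF i e] col'[OF i] e by auto
  qed (rule last)
  \<comment> \<open>The direct sum for \<Gamma>': all chain data are transported by
    \<open>sw\<close>, and there is no extra component.\<close>
  interpret chain': perturbed_chain_data \<alpha> \<beta> "e \<circ> sw" "f \<circ> sw" g' "\<rho> \<circ> sw" "sw \<circ> pred \<circ> sw" x y \<delta> "0 :: 'k fps"
  proof (unfold_locales, unfold s_def[symmetric] comp_def)
    fix i assume "i < s"
    then have i: "sw i < s" using sws by simp
    show "\<beta> ! i = g' i + f (sw i)" using fm2[OF i] by (simp add: g'_def m_def)
    show "1 \<le> f (sw i) \<Longrightarrow> \<rho> (sw i) < length \<alpha> \<and> f (sw i) \<le> \<alpha> ! \<rho> (sw i)" by (rule le_last[OF i])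
    show "f (sw i) < e (sw l)"
      if "l < s" "\<rho> (sw i) = \<rho> (sw l)" "i \<noteq> l" "1 \<le> f (sw i)" "f (sw i) \<le> f (sw l)" for l
      using disj[of "sw i" "sw l"] i that sws sw_eq by blast
    assume e: "2 \<le> e (sw i)"
    show "sw (pred (sw i)) < s" "f (sw (sw (pred (sw i)))) = e (sw i) - 1"
      using pred[OF i e] sws by (simp, metis diff_add_inverse2 sw(3))
    show "g' (sw (pred (sw i))) \<le> g' i" "\<rho> (sw (sw (pred (sw i)))) = \<rho> (sw i)" "e (sw i) \<le> f (sw i)"
      using g_pred(2)[OF i e] \<rho>p[OF i e] col'[OF i] e by auto
  next
    fix r assume "r < length \<alpha>"
    then obtain i where "i < s" "\<rho> i = r" "f i = \<alpha> ! r" using last by blast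
    then show "\<exists>i<s. \<rho> (sw i) = r \<and> f (sw i) = \<alpha> ! r" using sws by (intro exI[of _ "sw i"]) simp
  qed simp_all
  have gy: "g y + \<delta> = m y - f x" using fm1[of y] xy by (simp add: g_def \<delta>_def)
  \<comment> \<open>The inequalities for \<open>g (pred x)\<close> and \<open>g x\<close> are the
    matching conditions for \<Gamma>': there the interval of \<open>x\<close> sits at height
    \<open>m y\<close>, and that of \<open>y\<close> at height \<open>m x\<close>.\<close>
  have pert: "perturbed_chain_data \<alpha> \<beta> e f g \<rho> pred x y \<delta> (c :: 'k fps)" for c
  proof unfold_locales
    assume "2 \<le> e x"
    note p = pred[OF xy(1) this]
    then have "sw (pred x) = pred x" using xy by (intro swo) auto
    then show "g (pred x) \<le> g y + \<delta>" using p gy by (simp add: g_def) linarith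
  next
    fix i assume i: "i < length \<beta>" "2 \<le> e i" "pred i = y"
    then have p: "m x + f i \<le> m (sw i) + f y" "f y + 1 = e i"
      using pred[of i] by (auto simp: s_def)
    then have "i \<noteq> x" "i \<noteq> y" using xy col'[of y] by auto
    then have "sw i = i" by (rule swo)
    then show "g x \<le> g i + \<delta>" using p xy fm1[of i] i by (simp add: g_def \<delta>_def s_def)
  qed (use xy \<rho>xy in \<open>auto simp: s_def \<delta>_def\<close>)
  define F0 :: "(nat \<Rightarrow> 'k fps) \<Rightarrow> nat \<Rightarrow> 'k fps" where "F0 u = (\<lambda>i. fps_X ^ g' i * u (\<rho> (sw i)))" for u
  define F1 :: "(nat \<Rightarrow> 'k fps) \<Rightarrow> nat \<Rightarrow> 'k fps"
    where "F1 u = (\<lambda>i. if i = y then fps_X ^ g y * u (\<rho> y) else 0)" for u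
  have lin: "F0 (v + w) = F0 v + F0 w" "F0 (fscale r v) = fscale r (F0 v)"
    "F1 (v + w) = F1 v + F1 w" "F1 (fscale r v) = fscale r (F1 v)" for v w r
    by (auto simp: F0_def F1_def fun_eq_iff algebra_simps)
  have \<Gamma>: "partition (\<Gamma> j)" "partition (\<Gamma>' j)" "\<Gamma> 0 = \<gamma>" "\<Gamma>' 0 = \<gamma>" for j
    using assms(1,2) by (auto simp: LR_tableau_def is_tableau_def)
  have F0: "N_linear \<alpha> \<beta> F0" "N_map \<alpha> \<beta> F0 \<in> V_tableau \<alpha> \<beta> \<gamma> \<Gamma>'"
  proof -
    have "F0 u = chain'.generators u" for u
      by (rule ext) (simp add: F0_def chain'.generators_def)
    then show "N_linear \<alpha> \<beta> F0" "N_map \<alpha> \<beta> F0 \<in> V_tableau \<alpha> \<beta> \<gamma> \<Gamma>'"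
      using chain'.V_tableau_change_of_coords[of \<Gamma>' "\<lambda>v. v" F0] C' \<Gamma> lin
      by (auto simp: s_def m_def sw_def)
  qed
  have F1: "N_linear \<alpha> \<beta> F1"
  proof (rule N_linear.intro)
    fix v :: "nat \<Rightarrow> 'k fps" and i
    assume v: "\<forall>r<length \<alpha>. fps_X ^ (\<alpha> ! r) dvd v r" and i: "i < length \<beta>"
    have "\<rho> y < length \<alpha>" "f y \<le> \<alpha> ! \<rho> y" using le_last[OF xy(2)] xy by auto
    then have "fps_X ^ f y dvd v (\<rho> y)" using v power_le_dvd by blast
    then have "fps_X ^ m y dvd fps_X ^ g y * v (\<rho> y)"
      by (rule fps_X_power_dvd_mult) (simp add: g_def)
    then show "fps_X ^ (\<beta> ! i) dvd F1 v i" by (simp add: F1_def m_def)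
  qed (simp_all add: lin)
  have St: "N_map \<alpha> \<beta> (\<lambda>v. F0 v + fscale (fps_const t) (F1 v)) \<in> V_tableau \<alpha> \<beta> \<gamma> \<Gamma>" if t: "t \<noteq> 0" for t
  proof -
    interpret P: perturbed_chain_data \<alpha> \<beta> e f g \<rho> pred x y \<delta> "fps_const (1 / t)" by (rule pert)
    \<comment> \<open>the base change \<open>y' = t y + X ^ (m x - m y) x\<close>, \<open>x' = - x / t\<close>\<close>
    define \<tau> where "\<tau> v = (\<lambda>i. if i = y then fps_const (1 / t) * v y
      else if i = x then fps_X ^ (m x - m y) * v y - fps_const t * v x else v i)" for v :: "nat \<Rightarrow> 'k fps"
    have unit: "fps_const t * (fps_const (1 / t) * u) = u" "fps_const (1 / t) * (fps_const t * u) = u" for u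
      using t by (simp_all add: mult.assoc[symmetric])
    have xney: "x \<noteq> y" using xy by auto
    have "N_map \<alpha> \<beta> (\<lambda>v. F0 v + fscale (fps_const t) (F1 v)) \<in> V_tableau \<alpha> \<beta> (\<Gamma> 0) \<Gamma>"
    proof (rule P.V_tableau_change_of_coords(2)[of \<Gamma> \<tau>])
      show "has_columns (length \<beta>) e f ((!) \<beta>) \<Gamma>" using C by (simp add: s_def m_def)
      show "\<tau> (v + w) = \<tau> v + \<tau> w" "\<tau> (fscale r v) = fscale r (\<tau> v)" for v w r
        by (auto simp: \<tau>_def fun_eq_iff algebra_simps)
      show "\<exists>v. \<tau> v = w" for w
        by (rule exI[of _ "\<lambda>i. if i = y then fps_const t * w y else if i = x then
            fps_const (1 / t) * (fps_X ^ (m x - m y) * (fps_const t * w y) - w x) else w i"])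
          (simp add: \<tau>_def fun_eq_iff unit xney)
      show "(\<forall>i<length \<beta>. fps_X ^ (\<beta> ! i) dvd \<tau> v i) \<longleftrightarrow> (\<forall>i<length \<beta>. fps_X ^ (\<beta> ! i) dvd v i)" for v
      proof -
        have y: "fps_X ^ m y dvd \<tau> v y \<longleftrightarrow> fps_X ^ m y dvd v y"
          using dvd_mult[of "fps_X ^ m y" "v y" "fps_const (1 / t)"]
            dvd_mult[of "fps_X ^ m y" "fps_const (1 / t) * v y" "fps_const t"]
          unfolding unit by (auto simp: \<tau>_def)
        have x: "fps_X ^ m x dvd \<tau> v x \<longleftrightarrow> fps_X ^ m x dvd v x" if "fps_X ^ m y dvd v y"
        proof -
          have "fps_X ^ m x dvd fps_X ^ (m x - m y) * v y"
            by (rule fps_X_power_dvd_mult[OF that]) (use xy in simp)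
          then have "fps_X ^ m x dvd \<tau> v x \<longleftrightarrow> fps_X ^ m x dvd fps_const t * v x"
            using xney by (simp add: \<tau>_def dvd_diff_right_iff)
          also have "\<dots> \<longleftrightarrow> fps_X ^ m x dvd v x"
            using dvd_mult[of "fps_X ^ m x" "v x" "fps_const t"]
              dvd_mult[of "fps_X ^ m x" "fps_const t * v x" "fps_const (1 / t)"]
            unfolding unit by auto
          finally show ?thesis .
        qed
        have o: "\<tau> v i = v i" if "i \<noteq> x" "i \<noteq> y" for i using that by (simp add: \<tau>_def)
        show ?thesis
          unfolding s_def[symmetric] m_def[symmetric] using x y o xy(1,2) by metis
      qed
      show "(\<lambda>v. F0 v + fscale (fps_const t) (F1 v)) (v + w) =
          (\<lambda>v. F0 v + fscale (fps_const t) (F1 v)) v + (\<lambda>v. F0 v + fscale (fps_const t) (F1 v)) w" for v w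
        by (auto simp: lin fun_eq_iff algebra_simps)
      show "(\<lambda>v. F0 v + fscale (fps_const t) (F1 v)) (fscale r v) =
          fscale r ((\<lambda>v. F0 v + fscale (fps_const t) (F1 v)) v)" for r v
        by (auto simp: lin fun_eq_iff algebra_simps)
      show "\<tau> (F0 u + fscale (fps_const t) (F1 u)) = P.generators u" for u
      proof
        fix i
        have g'y: "g' y = g y + \<delta>" "g' x = m x - f y" by (simp_all add: g'_def gy)
        have Fy: "(F0 u + fscale (fps_const t) (F1 u)) y =
            fps_X ^ (g y + \<delta>) * u (\<rho> x) + fps_const t * (fps_X ^ g y * u (\<rho> y))"
          by (simp add: F0_def F1_def g'y)
        have Fx: "(F0 u + fscale (fps_const t) (F1 u)) x = fps_X ^ (m x - f y) * u (\<rho> y)"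
          using xney by (simp add: F0_def F1_def g'y)
        consider "i = y" | "i = x" "i \<noteq> y" | "i \<noteq> x" "i \<noteq> y" by blast
        then show "\<tau> (F0 u + fscale (fps_const t) (F1 u)) i = P.generators u i"
        proof cases
          case 1
          then have "\<tau> (F0 u + fscale (fps_const t) (F1 u)) i =
              fps_const (1 / t) * (fps_X ^ (g y + \<delta>) * u (\<rho> x)) + fps_X ^ g y * u (\<rho> y)"
            unfolding \<tau>_def Fy by (simp only: if_True simp_thms distrib_left unit)
          then show ?thesis using 1 by (simp add: P.generators_def mult.assoc)
        next
          case 2
          \<comment> \<open>With these exponents the two terms with \<open>u (\<rho> y)\<close>
            cancel in column \<open>x\<close>, and the term with \<open>u (\<rho> x)\<close> becomes
            the regular component of that column.\<close>
          have "m x - m y + (g y + \<delta>) = g x" "m x - m y + g y = m x - f y"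
            using xy fm1[of y] fm1[of x] gy by (simp_all add: g_def)
          then have X: "fps_X ^ (m x - m y) * (fps_X ^ (g y + \<delta>) * v) = fps_X ^ g x * v"
            "fps_X ^ (m x - m y) * (fps_X ^ g y * v) = fps_X ^ (m x - f y) * v" for v :: "'k fps"
            by (metis mult.assoc power_add)+
          have "\<tau> (F0 u + fscale (fps_const t) (F1 u)) i =
              fps_X ^ (m x - m y) * (fps_X ^ (g y + \<delta>) * u (\<rho> x)) +
              fps_const t * (fps_X ^ (m x - m y) * (fps_X ^ g y * u (\<rho> y)) -
                fps_X ^ (m x - f y) * u (\<rho> y))"
            using 2 unfolding \<tau>_def Fy Fx by (simp add: algebra_simps)
          then show ?thesis using 2 unfolding X by (simp add: P.generators_def)
        next
          case 3
          then show ?thesis by (simp add: \<tau>_def F0_def F1_def P.generators_def g'_def g_def swo)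
        qed
      qed
    qed (rule \<Gamma>)
    then show ?thesis using \<Gamma> by simp
  qed
  have "N_map \<alpha> \<beta> F0 \<in> Abstract_Topology.closure_of (zariski_topology (Hom_k \<alpha> \<beta>)) (V_tableau \<alpha> \<beta> \<gamma> \<Gamma>)"
    by (rule closure_of_line[OF infinite_alg_closed_field F0(1) F1 St])
  moreover have "\<Gamma> \<noteq> \<Gamma>'" by (rule box_move_changes_tableau[OF C C']) (use xy ey in auto)
  ultimately show ?thesis using F0(2) unfolding boundary_less_def by blast
qed

end
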